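(* Let $R$ be a local domain with maximal ideal $m_R$ and let $\mathcal I=\{I_n\}$ be a divisorial filtration on $R$, with $I_n=I(\nu_1)_{a_1n}\cap\cdots\cap I(\nu_r)_{a_rn}$ for $n\ge 1$, for some divisorial valuations $\nu_1,\dots,\nu_r$ of $R$ and some $a_1,\dots,a_r\in\mathbb Z_{>0}$. Suppose that $\ell(\mathcal I)=\dim R$. Then for some $i$ the center $m_{\nu_i}\cap R=\{f\in R\mid \nu_i(f)>0\}$ of $\nu_i$ on $R$ is $m_R$. Moreover, there exists a positive integer $n_0$ such that $m_R$ is an associated prime of $I_n=\overline{I_n}$ (i.e. $m_R\in\mathrm{Ass}(R/I_n)$) for all $n\ge n_0$.
   Context: Local rings are Noetherian. A filtration $\mathcal I=\{I_n\}_{n\in\mathbb N}$ on a ring $R$ is a descending chain of ideals $R=I_0\supset I_1\supset I_2\supset\cdots$ with $I_iI_j\subset I_{i+j}$ for all $i,j$. Its Rees ring is $R[\mathcal I]=\sum_{n\ge 0}I_nt^n\subset R[t]$ (not assumed Noetherian). For $R$ local with maximal ideal $m_R$, the analytic spread is $\ell(\mathcal I)=\dim R[\mathcal I]/m_RR[\mathcal I]$. Let $R$ be a local domain with quotient field $K$. A divisorial valuation of $R$ is a valuation $\nu$ of $K$ with valuation ring $\mathcal O_\nu$ and maximal ideal $m_\nu$ such that $R\subset\mathcal O_\nu$ and, with $\mathfrak p=m_\nu\cap R$ (the center of $\nu$), $\mathrm{trdeg}_{\kappa(\mathfrak p)}\kappa(\nu)=\mathrm{ht}(\mathfrak p)-1$,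 where $\kappa(\mathfrak p)$ and $\kappa(\nu)$ are the residue fields of $R_{\mathfrak p}$ and $\mathcal O_\nu$. Such $\nu$ is discrete (value group normalized to $\mathbb Z$). For $n\in\mathbb N$, $I(\nu)_n=\{f\in R\mid \nu(f)\ge n\}$. A divisorial filtration on $R$ is a filtration $\mathcal I=\{I_n\}$ for which there are divisorial valuations $\nu_1,\dots,\nu_r$ of $R$ and $a_1,\dots,a_r\in\mathbb Z_{\ge 0}$ with $I_n=I(\nu_1)_{na_1}\cap\cdots\cap I(\nu_r)_{na_r}$ for all $n\in\mathbb N$. The ideals $I_n$ of a divisorial filtration are integrally closed; $\overline{J}$ denotes the integral closure of an ideal $J$. *)

theory Defs
  imports "HOL-Algebra.Algebra" "HOL-Library.Extended_Nat"
begin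

section \<open>Local domains, quotient fields, dimension\<close>

definition local_domain :: "('a, 'm) ring_scheme \<Rightarrow> 'a set \<Rightarrow> bool" where
  "local_domain R m \<longleftrightarrow>
     noetherian_domain R \<and> maximalideal m R \<and> (\<forall>n. maximalideal n R \<longrightarrow> n = m)"

text \<open>The quotient field is taken to contain the domain, so that \<open>R\<close> is literally a
  subring of \<open>K\<close>.\<close>

definition quotient_field :: "('a, 'm) ring_scheme \<Rightarrow> ('a, 'm) ring_scheme \<Rightarrow> bool" where
  "quotient_field R K \<longleftrightarrow>
     field K \<and> subring (carrier R) K \<and> R = K\<lparr>carrier := carrier R\<rparr> \<and>
     (\<forall>x\<in>carrier K. \<exists>a\<in>carrier R. \<exists>b\<in>carrier R - {\<zero>\<^bsub>K\<^esub>}. x = a \<otimes>\<^bsub>K\<^esub> inv\<^bsub>K\<^esub> b)"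

definition prime_chain :: "('a, 'm) ring_scheme \<Rightarrow> (nat \<Rightarrow> 'a set) \<Rightarrow> nat \<Rightarrow> bool" where
  "prime_chain R P n \<longleftrightarrow> (\<forall>i\<le>n. primeideal (P i) R) \<and> (\<forall>i<n. P i \<subset> P (Suc i))"

text \<open>With values in \<^typ>\<open>enat\<close> the zero ring, which has no primes, gets dimension \<open>0\<close>; only
  nonzero rings are considered below.\<close>

definition krull_dim :: "('a, 'm) ring_scheme \<Rightarrow> enat" where
  "krull_dim R = (SUP n \<in> {n. \<exists>P. prime_chain R P n}. enat n)"

definition height :: "('a, 'm) ring_scheme \<Rightarrow> 'a set \<Rightarrow> enat" where
  "height R p = (SUP n \<in> {n. \<exists>P. prime_chain R P n \<and> P n = p}. enat n)"


section \<open>Transcendence degree\<close>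

text \<open>Elements of \<open>ring.indexed_pset L B F\<close> are the polynomials over \<open>F\<close> in variables indexed
  by \<open>B\<close>, as finitely supported maps from monomials (multisets over \<open>B\<close>) to coefficients.
  Below, the variable indexed by \<open>x \<in> B\<close> is evaluated at \<open>x\<close> itself.\<close>

definition eval_at_indices :: "('b, 'm) ring_scheme \<Rightarrow> ('b multiset \<Rightarrow> 'b) \<Rightarrow> 'b" where
  "eval_at_indices L P =
     (\<Oplus>\<^bsub>L\<^esub>M\<in>{M. P M \<noteq> \<zero>\<^bsub>L\<^esub>}. P M \<otimes>\<^bsub>L\<^esub> (\<Otimes>\<^bsub>L\<^esub>x\<in>set_mset M. x [^]\<^bsub>L\<^esub> count M x))"

definition alg_independent :: "('b, 'm) ring_scheme \<Rightarrow> 'b set \<Rightarrow> 'b set \<Rightarrow> bool" where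
  "alg_independent L F B \<longleftrightarrow> B \<subseteq> carrier L \<and>
     (\<forall>P\<in>ring.indexed_pset L B F. eval_at_indices L P = \<zero>\<^bsub>L\<^esub> \<longrightarrow> P = (\<lambda>_. \<zero>\<^bsub>L\<^esub>))"

definition trdeg :: "('b, 'm) ring_scheme \<Rightarrow> 'b set \<Rightarrow> enat" where
  "trdeg L F = (SUP B \<in> {B. finite B \<and> alg_independent L F B}. enat (card B))"


section \<open>Divisorial valuations\<close>

text \<open>A normalized discrete valuation is a surjection of the nonzero elements of \<open>K\<close> onto the
  integers. Its value at \<open>0\<close>, conventionally infinite, is left unspecified, and \<open>0\<close> is
  treated separately throughout.\<close>

definition discrete_valuation :: "('a, 'm) ring_scheme \<Rightarrow> ('a \<Rightarrow> int) \<Rightarrow> bool" where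
  "discrete_valuation K \<nu> \<longleftrightarrow>
     (\<forall>x\<in>carrier K - {\<zero>\<^bsub>K\<^esub>}. \<forall>y\<in>carrier K - {\<zero>\<^bsub>K\<^esub>}.
        \<nu> (x \<otimes>\<^bsub>K\<^esub> y) = \<nu> x + \<nu> y \<and>
        (x \<oplus>\<^bsub>K\<^esub> y \<noteq> \<zero>\<^bsub>K\<^esub> \<longrightarrow> min (\<nu> x) (\<nu> y) \<le> \<nu> (x \<oplus>\<^bsub>K\<^esub> y))) \<and>
     \<nu> ` (carrier K - {\<zero>\<^bsub>K\<^esub>}) = UNIV"

definition valuation_ring :: "('a, 'm) ring_scheme \<Rightarrow> ('a \<Rightarrow> int) \<Rightarrow> ('a, 'm) ring_scheme" where
  "valuation_ring K \<nu> = K\<lparr>carrier := {x \<in> carrier K. x = \<zero>\<^bsub>K\<^esub> \<or> 0 \<le> \<nu> x}\<rparr>"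

definition valuation_max_ideal :: "('a, 'm) ring_scheme \<Rightarrow> ('a \<Rightarrow> int) \<Rightarrow> 'a set" where
  "valuation_max_ideal K \<nu> = {x \<in> carrier K. x = \<zero>\<^bsub>K\<^esub> \<or> 0 < \<nu> x}"

definition valuation_residue_field :: "('a, 'm) ring_scheme \<Rightarrow> ('a \<Rightarrow> int) \<Rightarrow> 'a set ring" where
  "valuation_residue_field K \<nu> = valuation_ring K \<nu> Quot valuation_max_ideal K \<nu>"

definition center :: "('a, 'm) ring_scheme \<Rightarrow> ('a, 'm) ring_scheme \<Rightarrow> ('a \<Rightarrow> int) \<Rightarrow> 'a set" where
  "center R K \<nu> = valuation_max_ideal K \<nu> \<inter> carrier R"

definition localization_at ::
    "('a, 'm) ring_scheme \<Rightarrow> ('a, 'm) ring_scheme \<Rightarrow> 'a set \<Rightarrow> ('a, 'm) ring_scheme" where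
  "localization_at R K p =
     K\<lparr>carrier := {a \<otimes>\<^bsub>K\<^esub> inv\<^bsub>K\<^esub> b | a b. a \<in> carrier R \<and> b \<in> carrier R - p}\<rparr>"

definition localization_max_ideal ::
    "('a, 'm) ring_scheme \<Rightarrow> ('a, 'm) ring_scheme \<Rightarrow> 'a set \<Rightarrow> 'a set" where
  "localization_max_ideal R K p =
     {a \<otimes>\<^bsub>K\<^esub> inv\<^bsub>K\<^esub> b | a b. a \<in> p \<and> b \<in> carrier R - p}"

definition residue_field_at ::
    "('a, 'm) ring_scheme \<Rightarrow> ('a, 'm) ring_scheme \<Rightarrow> 'a set \<Rightarrow> 'a set ring" where
  "residue_field_at R K p = localization_at R K p Quot localization_max_ideal R K p"

text \<open>For \<open>p\<close> the center of \<open>\<nu>\<close>, the inclusion of the localization in the valuation ring induces an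
  embedding of residue fields, sending the coset of \<open>x\<close> to the coset of \<open>x\<close>.\<close>

definition residue_field_map ::
    "('a, 'm) ring_scheme \<Rightarrow> ('a \<Rightarrow> int) \<Rightarrow> 'a set \<Rightarrow> 'a set" where
  "residue_field_map K \<nu> C =
     the_elem ((\<lambda>x. valuation_max_ideal K \<nu> +>\<^bsub>valuation_ring K \<nu>\<^esub> x) ` C)"

text \<open>The condition that the transcendence degree is the height minus one is written without
  subtraction, since \<open>0 - 1 = 0\<close> in \<^typ>\<open>enat\<close>.\<close>

definition divisorial_valuation ::
    "('a, 'm) ring_scheme \<Rightarrow> ('a, 'm) ring_scheme \<Rightarrow> ('a \<Rightarrow> int) \<Rightarrow> bool" where
  "divisorial_valuation R K \<nu> \<longleftrightarrow>
     discrete_valuation K \<nu> \<and>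
     carrier R \<subseteq> carrier (valuation_ring K \<nu>) \<and>
     trdeg (valuation_residue_field K \<nu>)
       (residue_field_map K \<nu> ` carrier (residue_field_at R K (center R K \<nu>))) + 1
     = height R (center R K \<nu>)"


section \<open>Filtrations, Rees rings, analytic spread\<close>

definition filtration :: "('a, 'm) ring_scheme \<Rightarrow> (nat \<Rightarrow> 'a set) \<Rightarrow> bool" where
  "filtration R I \<longleftrightarrow>
     (\<forall>n. ideal (I n) R) \<and> I 0 = carrier R \<and> (\<forall>n. I (Suc n) \<subseteq> I n) \<and>
     (\<forall>i j. ideal_prod R (I i) (I j) \<subseteq> I (i + j))"

definition valuation_ideal :: "('a, 'm) ring_scheme \<Rightarrow> ('a \<Rightarrow> int) \<Rightarrow> nat \<Rightarrow> 'a set" where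
  "valuation_ideal R \<nu> n = {f \<in> carrier R. f = \<zero>\<^bsub>R\<^esub> \<or> int n \<le> \<nu> f}"

definition divisorial_filtration ::
    "('a, 'm) ring_scheme \<Rightarrow> ('a, 'm) ring_scheme \<Rightarrow> (nat \<Rightarrow> 'a set) \<Rightarrow> bool" where
  "divisorial_filtration R K I \<longleftrightarrow>
     filtration R I \<and>
     (\<exists>r \<nu> a. 1 \<le> (r::nat) \<and> (\<forall>i\<in>{1..r}. divisorial_valuation R K (\<nu> i)) \<and>
        (\<forall>n. I n = (\<Inter>i\<in>{1..r}. valuation_ideal R (\<nu> i) (n * a i))))"

definition rees_ring ::
    "('a, 'm) ring_scheme \<Rightarrow> (nat \<Rightarrow> 'a set) \<Rightarrow> ('a, nat \<Rightarrow> 'a) up_ring" where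
  "rees_ring R I = (UP R)\<lparr>carrier := {p \<in> carrier (UP R). \<forall>n. coeff (UP R) p n \<in> I n}\<rparr>"

definition analytic_spread ::
    "('a, 'm) ring_scheme \<Rightarrow> 'a set \<Rightarrow> (nat \<Rightarrow> 'a set) \<Rightarrow> enat" where
  "analytic_spread R m I =
     krull_dim (rees_ring R I Quot Idl\<^bsub>rees_ring R I\<^esub> ((\<lambda>x. monom (UP R) x 0) ` m))"


section \<open>Associated primes and integral closure of ideals\<close>

definition associated_primes :: "('a, 'm) ring_scheme \<Rightarrow> 'a set \<Rightarrow> 'a set set" where
  "associated_primes R J =
     {p. primeideal p R \<and>
         (\<exists>z\<in>carrier (R Quot J).
            p = {f \<in> carrier R. (J +>\<^bsub>R\<^esub> f) \<otimes>\<^bsub>R Quot J\<^esub> z = \<zero>\<^bsub>R Quot J\<^esub>})}"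

text \<open>Powers in \<^term>\<open>ideals_set R\<close> are powers of ideals.\<close>

definition integral_closure :: "('a, 'm) ring_scheme \<Rightarrow> 'a set \<Rightarrow> 'a set" where
  "integral_closure R J =
     {x \<in> carrier R. \<exists>k c. 0 < (k::nat) \<and>
        (\<forall>i\<in>{1..k}. c i \<in> J [^]\<^bsub>ideals_set R\<^esub> i) \<and>
        x [^]\<^bsub>R\<^esub> k \<oplus>\<^bsub>R\<^esub> (\<Oplus>\<^bsub>R\<^esub>i\<in>{1..k}. c i \<otimes>\<^bsub>R\<^esub> x [^]\<^bsub>R\<^esub> (k - i)) = \<zero>\<^bsub>R\<^esub>}"

end

theory Submission
  imports Defs
begin

text \<open>
Split the valuations into those centered at \<open>m\<close> and the others, and let \<open>J\<^sub>n \<supseteq> I\<^sub>n\<close> be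
cut out by the others alone. Every element of \<open>J\<^sub>n\<close> is multiplied into \<open>I\<^sub>n\<close> by a power of \<open>m\<close>,
so \<open>m \<in> Ass(R/I\<^sub>n)\<close> as soon as \<open>J\<^sub>n \<noteq> I\<^sub>n\<close>. If \<open>f \<in> J\<^sub>k - I\<^sub>k\<close> for a single \<open>k\<close>, then powers
of \<open>f\<close> show \<open>J\<^sub>n \<noteq> I\<^sub>n\<close> for all large \<open>n\<close>. It remains to exclude \<open>J\<^sub>n = I\<^sub>n\<close> for all \<open>n \<ge> 1\<close>,
that is, to show that the analytic spread is less than \<open>dim R\<close> when no center is \<open>m\<close>.

In that case a prime chain \<open>P\<^sub>0 \<subset> \<dots> \<subset> P\<^sub>e\<close> of \<open>R[I]\<close> over \<open>m\<close> has below it a prime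
\<open>Q = qR[t] \<inter> R[I]\<close> with \<open>q \<noteq> 0\<close>, and \<open>dim R/q < dim R\<close>. The bound \<open>e \<le> dim R/q\<close> is proved by
counting lengths in \<open>R[t]\<close>, without a dimension theory: there are parameters \<open>x\<^sub>1, \<dots>, x\<^sub>d\<close>
of \<open>R/q\<close>, and modulo \<open>V = q + (x\<^sub>1\<^sup>M, \<dots>, x\<^sub>d\<^sup>M)\<close> the polynomials of degree \<open>< D\<close> have length
\<open>O(D M\<^sup>d)\<close>. On the other hand choose \<open>y\<^sub>i \<in> P\<^sub>i - P\<^sub>i\<^sub>-\<^sub>1\<close> and \<open>z t\<^sup>s \<in> R[I] - P\<^sub>0\<close> with \<open>s \<ge> 1\<close>, so that
\<open>z \<notin> q\<close>. The products of a power of \<open>z\<close> and a monomial in the \<open>y\<^sub>i\<close>, all exponents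
being \<open>< N\<close>, give a strict chain of length \<open>N\<^sup>e\<^sup>+\<^sup>1\<close> modulo \<open>V\<close>, provided that \<open>D\<close> and \<open>M\<close> are suitable
linear functions of \<open>N\<close>; the linear bound for \<open>M\<close> comes from an Artin-Rees lemma in a finitely generated
subalgebra of \<open>R[I]\<close>. Comparing growth rates gives \<open>e \<le> d\<close>.
\<close>

section \<open>Lengths of modules over a local ring\<close>

text \<open>The Rees ring need not be Noetherian, so lengths are counted in \<open>R[t]\<close>
  below degree \<open>D\<close>, as modules over \<open>R\<close>. The price is that a polynomial in
  the \<open>y_i\<close> with coefficients in \<open>V\<close> is not visibly in \<open>P_0\<close>.
  The element \<open>z\<close> closes this gap. As \<open>z t^r\<close> is in \<open>R[I]\<close>
  for \<open>r \<le> s\<close>, multiplication by \<open>z^D\<close> carries polynomials of degree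
  \<open>< D\<close> over \<open>V\<close> into a finitely generated algebra
  \<open>A \<subseteq> R[I]\<close>, and there into the \<open>M\<close>-th power of the ideal
  generated by the parameters, up to elements with coefficients in \<open>q\<close>. Since
  \<open>z \<notin> q\<close>, a power \<open>z^(D+j)\<close> can be cancelled modulo the latter,
  and Artin-Rees bounds the loss in \<open>M\<close> by a multiple of \<open>D + j\<close>. As long
  as a positive power is left, the cancelled polynomial lies in \<open>P_0\<close>, because the
  parameters are in \<open>m\<close>. Truncation at \<open>D\<close> costs a factor proportional to
  \<open>N\<close> in the upper bound. The powers of \<open>z\<close> win it back: they lie in
  \<open>P_0\<close> and are invisible modulo that prime, yet by the same cancellation they multiply
  the length of the chain by \<open>N\<close>.\<close>

definition submod :: "('a, 'm) ring_scheme \<Rightarrow> 'a set \<Rightarrow> 'a set \<Rightarrow> bool" where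
  "submod R C S \<longleftrightarrow> S \<subseteq> carrier R \<and> \<zero>\<^bsub>R\<^esub> \<in> S \<and> (\<forall>x\<in>S. \<forall>y\<in>S. x \<oplus>\<^bsub>R\<^esub> y \<in> S) \<and>
     (\<forall>c\<in>C. \<forall>x\<in>S. c \<otimes>\<^bsub>R\<^esub> x \<in> S)"

definition adjoin :: "('a, 'm) ring_scheme \<Rightarrow> 'a set \<Rightarrow> 'a set \<Rightarrow> 'a \<Rightarrow> 'a set" where
  "adjoin R C S x = {y \<oplus>\<^bsub>R\<^esub> c \<otimes>\<^bsub>R\<^esub> x | y c. y \<in> S \<and> c \<in> C}"

lemma submodD:
  assumes "submod R C S"
  shows "x \<in> S \<Longrightarrow> x \<in> carrier R" "\<zero>\<^bsub>R\<^esub> \<in> S" "x \<in> S \<Longrightarrow> y \<in> S \<Longrightarrow> x \<oplus>\<^bsub>R\<^esub> y \<in> S"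
    "c \<in> C \<Longrightarrow> x \<in> S \<Longrightarrow> c \<otimes>\<^bsub>R\<^esub> x \<in> S"
  using assms unfolding submod_def by auto

text \<open>The scalars form a subring of one ambient ring, so that \<open>submod\<close> covers
  ideals of \<open>R\<close> (\<open>C = carrier R\<close>), modules of polynomials over the
  constants, and ideals of a subalgebra, all with the same operations. Closure under negation comes
  from \<open>\<ominus> \<one> \<in> C\<close> and is therefore absent from
  \<open>submod\<close>.\<close>

locale coefficient_ring = cring R for R (structure) and C +
  assumes sub: "subring C R"
begin

lemma C_carrier: "c \<in> C \<Longrightarrow> c \<in> carrier R"
  using subringE(1)[OF sub] by auto

lemmas C_closed = subringE(2,3,5,6,7)[OF sub]

lemma submod_uminus:
  assumes "submod R C S" "x \<in> S" shows "\<ominus> x \<in> S"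
proof -
  have "\<ominus> \<one> \<otimes> x \<in> S" using assms C_closed by (auto intro: submodD)
  then show ?thesis using submodD(1)[OF assms] by (simp add: l_minus)
qed

lemma submod_minus:
  assumes "submod R C S" "x \<in> S" "y \<in> S" shows "x \<ominus> y \<in> S"
  using assms submod_uminus[OF assms(1,3)] submodD(3)[OF assms(1)] by (simp add: a_minus_def)

lemma submod_add_cancel:
  assumes "submod R C S" "x \<in> S" "y \<in> carrier R" "x \<oplus> y \<in> S" shows "y \<in> S"
proof -
  have "y = (x \<oplus> y) \<ominus> x" using assms submodD(1)[OF assms(1)] by algebra
  then show ?thesis using submod_minus[OF assms(1,4,2)] by simp
qed

lemma submod_C: "submod R C C"
  unfolding submod_def using C_closed C_carrier by auto

lemma submod_Int: "submod R C S \<Longrightarrow> submod R C Y \<Longrightarrow> submod R C (S \<inter> Y)"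
  unfolding submod_def by auto

lemma adjoinI: "y \<in> S \<Longrightarrow> c \<in> C \<Longrightarrow> y \<oplus> c \<otimes> x \<in> adjoin R C S x"
  unfolding adjoin_def by blast

lemma adjoin_submod:
  assumes "submod R C S" "x \<in> carrier R"
  shows "submod R C (adjoin R C S x)"
proof -
  note S = submodD[OF assms(1)]
  have "\<zero> = \<zero> \<oplus> \<zero> \<otimes> x" using assms by simp
  then have 0: "\<zero> \<in> adjoin R C S x" using S(2) C_closed(1) adjoinI by metis
  have 1: "(y \<oplus> c \<otimes> x) \<oplus> (y' \<oplus> c' \<otimes> x) \<in> adjoin R C S x"
    if "y \<in> S" "c \<in> C" "y' \<in> S" "c' \<in> C" for y c y' c'
  proof -
    have "(y \<oplus> c \<otimes> x) \<oplus> (y' \<oplus> c' \<otimes> x) = (y \<oplus> y') \<oplus> (c \<oplus> c') \<otimes> x"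
      using that S(1) C_carrier assms(2) by algebra
    then show ?thesis using that S C_closed adjoinI by metis
  qed
  have 2: "d \<otimes> (y \<oplus> c \<otimes> x) \<in> adjoin R C S x" if "d \<in> C" "y \<in> S" "c \<in> C" for y c d
  proof -
    have "d \<otimes> (y \<oplus> c \<otimes> x) = (d \<otimes> y) \<oplus> (d \<otimes> c) \<otimes> x"
      using that S(1) C_carrier assms(2) by algebra
    then show ?thesis using that S C_closed adjoinI by metis
  qed
  show ?thesis unfolding submod_def
    using 0 1 2 S(1) C_carrier assms(2) by (auto simp: adjoin_def)
qed

lemma adjoin_subset: "submod R C S \<Longrightarrow> x \<in> carrier R \<Longrightarrow> S \<subseteq> adjoin R C S x"
proof
  fix y assume "submod R C S" "x \<in> carrier R" "y \<in> S"
  then have "y = y \<oplus> \<zero> \<otimes> x" using submodD(1) by fastforce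
  then show "y \<in> adjoin R C S x" using \<open>y \<in> S\<close> C_closed(1) adjoinI by metis
qed

lemma adjoin_mem: "submod R C S \<Longrightarrow> x \<in> carrier R \<Longrightarrow> x \<in> adjoin R C S x"
proof -
  assume "submod R C S" "x \<in> carrier R"
  then have "x = \<zero> \<oplus> \<one> \<otimes> x" "\<zero> \<in> S" using submodD(2) by fastforce+
  then show "x \<in> adjoin R C S x" using C_closed(2) adjoinI by metis
qed

lemma adjoin_least:
  assumes "submod R C Y" "S \<subseteq> Y" "x \<in> Y" shows "adjoin R C S x \<subseteq> Y"
  using assms submodD[OF assms(1)] unfolding adjoin_def by blast

end

text \<open>\<open>lenle R C M B k X\<close>: \<open>X\<close> is reached from \<open>B\<close> by adjoining \<open>k\<close> elements, each of them killed by
  \<open>M\<close> modulo the previous ones, so that \<open>X/B\<close> has length at most \<open>k\<close> when \<open>C\<close> is local with maximal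
  ideal \<open>M\<close>. Dually, \<open>schain R C B k X\<close> says that the length is at least \<open>k\<close>.\<close>

inductive lenle :: "('a, 'm) ring_scheme \<Rightarrow> 'a set \<Rightarrow> 'a set \<Rightarrow> 'a set \<Rightarrow> nat \<Rightarrow> 'a set \<Rightarrow> bool"
  for R C M B where
  lenle_0: "submod R C B \<Longrightarrow> lenle R C M B 0 B"
| lenle_Suc: "lenle R C M B k S \<Longrightarrow> x \<in> carrier R \<Longrightarrow> (\<forall>r\<in>M. r \<otimes>\<^bsub>R\<^esub> x \<in> S) \<Longrightarrow>
    lenle R C M B (Suc k) (adjoin R C S x)"

inductive schain :: "('a, 'm) ring_scheme \<Rightarrow> 'a set \<Rightarrow> 'a set \<Rightarrow> nat \<Rightarrow> 'a set \<Rightarrow> bool"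
  for R C B where
  schain_0: "submod R C S \<Longrightarrow> B \<subseteq> S \<Longrightarrow> schain R C B 0 S"
| schain_Suc: "schain R C B k S \<Longrightarrow> S \<subset> Y \<Longrightarrow> submod R C Y \<Longrightarrow> schain R C B (Suc k) Y"

lemma schain_submod: "schain R C B k S \<Longrightarrow> submod R C S \<and> B \<subseteq> S"
  by (induction rule: schain.induct) auto

lemma schain_mono:
  assumes "schain R C B k S" "S \<subseteq> Y" "submod R C Y"
  shows "schain R C B k Y"
  using assms(1)
proof cases
  case schain_0
  then show ?thesis using schain.schain_0[OF assms(3), of B] assms(2) by blast
next
  case (schain_Suc k Z)
  then show ?thesis using schain.schain_Suc[of R C B k Z Y] assms by blast
qed

lemma schain_pred:
  assumes "schain R C B (Suc k) S" shows "schain R C B k S"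
  using assms
proof cases
  case (schain_Suc Z)
  then show ?thesis using schain_mono[of R C B k Z S] by blast
qed

lemma schain_self:
  assumes "schain R C B k S" "S \<subseteq> B" shows "k = 0"
  using assms(1)
proof cases
  case (schain_Suc k Z)
  then show ?thesis using schain_submod[of R C B k Z] assms(2) by blast
qed

lemma (in coefficient_ring) lenle_submod: "lenle R C M B k S \<Longrightarrow> submod R C S \<and> submod R C B \<and> B \<subseteq> S"
proof (induction rule: lenle.induct)
  case (lenle_Suc k S x)
  then show ?case using adjoin_submod adjoin_subset by blast
qed auto

lemma lenle_trans: "lenle R C M S l Y \<Longrightarrow> lenle R C M B k S \<Longrightarrow> lenle R C M B (k + l) Y"
  by (induction rule: lenle.induct) (auto intro: lenle.intros)

section \<open>Chains against adjunctions: half of the Jordan-Hoelder theorem\<close>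

locale local_coefficient_ring = coefficient_ring +
  fixes M
  assumes unit: "c \<in> C - M \<Longrightarrow> \<exists>d\<in>C. d \<otimes> c = \<one>"
begin

text \<open>Modulo \<open>S\<close> the module \<open>adjoin R C S x\<close> is simple or zero, so
  intersecting a chain with \<open>S\<close> makes at most one inclusion collapse: the one at which
  the chain leaves \<open>S\<close>.\<close>

lemma schain_adjoin:
  assumes S: "submod R C S" and B: "B \<subseteq> S" and x: "x \<in> carrier R" and Mx: "\<forall>r\<in>M. r \<otimes> x \<in> S"
    and "schain R C B l Y" "Y \<subseteq> adjoin R C S x"
  shows "Y \<subseteq> S \<or> schain R C B (l - 1) (Y \<inter> S)"
  using assms(5,6)
proof (induction rule: schain.induct)
  case (schain_0 Y)
  then have "schain R C B 0 (Y \<inter> S)" using submod_Int[OF _ S] B by (intro schain.schain_0) auto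
  then show ?case by simp
next
  case (schain_Suc k Y Z)
  have Z: "submod R C (Z \<inter> S)" by (rule submod_Int[OF schain_Suc.hyps(3) S])
  show ?case
  proof (cases "Y \<subseteq> S")
    case True
    then have "Y \<subseteq> Z \<inter> S" using schain_Suc.hyps(2) by blast
    then have "schain R C B k (Z \<inter> S)" by (rule schain_mono[OF schain_Suc.hyps(1) _ Z])
    then show ?thesis by simp
  next
    case False
    then have IH: "schain R C B (k - 1) (Y \<inter> S)"
      using schain_Suc.IH schain_Suc.prems schain_Suc.hyps(2) by (meson psubset_imp_subset subset_trans)
    obtain y where y: "y \<in> Y" "y \<notin> S" using False by blast
    then obtain a c where ac: "a \<in> S" "c \<in> C" "y = a \<oplus> c \<otimes> x"
      using schain_Suc.prems schain_Suc.hyps(2) unfolding adjoin_def by blast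
    \<comment> \<open>Otherwise \<open>c \<otimes> x\<close>, and with it \<open>y\<close>, would
      lie in \<open>S\<close>. So \<open>c\<close> is invertible and \<open>x\<close> is, modulo
      \<open>S\<close>, a multiple of \<open>y\<close>.\<close>
    have "c \<notin> M" using ac y submodD[OF S] Mx by blast
    then obtain d where d: "d \<in> C" "d \<otimes> c = \<one>" using unit ac by blast
    obtain w where w: "w \<in> Z" "w \<notin> Y" using schain_Suc.hyps(2) by blast
    then obtain b e where be: "b \<in> S" "e \<in> C" "w = b \<oplus> e \<otimes> x"
      using schain_Suc.prems unfolding adjoin_def by blast
    \<comment> \<open>The new element \<open>w\<close> is corrected by a multiple of
      \<open>y \<in> Y\<close> so as to fall into \<open>S\<close>. It stays outside
      \<open>Y\<close>, and thus the inclusion survives the intersection with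
      \<open>S\<close>.\<close>
    let ?u = "w \<ominus> (e \<otimes> d) \<otimes> y"
    have sY: "submod R C Y" using schain_submod[OF schain_Suc.hyps(1)] by blast
    have car: "a \<in> carrier R" "b \<in> carrier R" "c \<in> carrier R" "d \<in> carrier R" "e \<in> carrier R"
      using ac be d C_carrier submodD(1)[OF S] by auto
    have "(e \<otimes> d) \<otimes> y = (e \<otimes> d) \<otimes> a \<oplus> e \<otimes> (d \<otimes> c) \<otimes> x"
      unfolding ac(3) using car x by (simp add: r_distr m_assoc)
    then have "?u = b \<ominus> (e \<otimes> d) \<otimes> a"
      unfolding be(3) d(2) using car x by (simp add: a_minus_def minus_add a_ac r_neg2 r_neg)
    then have uX: "?u \<in> S" using submod_minus[OF S be(1)] submodD(4)[OF S] ac(1) be(2) d(1) C_closed by simp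
    have edy: "(e \<otimes> d) \<otimes> y \<in> Y" using submodD(4)[OF sY] C_closed be d y by simp
    then have uZ: "?u \<in> Z"
      using submod_minus[OF schain_Suc.hyps(3) w(1)] schain_Suc.hyps(2) by blast
    have yc: "y \<in> carrier R" "w \<in> carrier R"
      using submodD(1)[OF sY y(1)] submodD(1)[OF schain_Suc.hyps(3) w(1)] .
    have "w = ?u \<oplus> (e \<otimes> d) \<otimes> y"
      using yc car by (simp add: a_minus_def a_assoc l_neg)
    then have "?u \<notin> Y" using edy w submodD(3)[OF sY] by metis
    then have "Y \<inter> S \<subset> Z \<inter> S" using uX uZ schain_Suc.hyps(2) by blast
    then have "schain R C B (Suc (k - 1)) (Z \<inter> S)" by (rule schain.schain_Suc[OF IH _ Z])
    \<comment> \<open>\<open>Suc (k - 1)\<close> equals \<open>k\<close> except for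
      \<open>k = 0\<close>, where one link is dropped.\<close>
    then have "schain R C B k (Z \<inter> S)" by (cases k) (simp_all add: schain_pred)
    then show ?thesis by simp
  qed
qed

text \<open>Undoing the adjunctions one at a time shortens the chain by at most one each time, until
  it lies in \<open>B\<close>, where only length \<open>0\<close> is possible.\<close>

lemma schain_le_lenle:
  assumes "lenle R C M B k S" "schain R C B l Y" "Y \<subseteq> S"
  shows "l \<le> k"
  using assms
proof (induction arbitrary: l Y rule: lenle.induct)
  case (lenle_0)
  then show ?case using schain_self by blast
next
  case (lenle_Suc k S x)
  have S: "submod R C S" "B \<subseteq> S" using lenle_submod[OF lenle_Suc.hyps(1)] by auto
  from schain_adjoin[OF S lenle_Suc.hyps(2,3) lenle_Suc.prems]
  consider "Y \<subseteq> S" | "schain R C B (l - 1) (Y \<inter> S)" by blast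
  then show ?case
  proof cases
    case 1 then show ?thesis using lenle_Suc by fastforce
  next
    case 2 then have "l - 1 \<le> k" using lenle_Suc.IH by blast
    then show ?thesis by simp
  qed
qed

end

text \<open>Multiplication by \<open>x\<close> maps \<open>Y/V\<close> onto
  \<open>(B + h(Y) x)/B\<close> and takes adjunctions to adjunctions. The homomorphism
  \<open>h\<close> transports ideals of \<open>R\<close> to modules of polynomials over the
  constants; with the identity it serves inside \<open>R\<close>.\<close>

lemma lenle_translate:
  assumes "cring R" "cring U" "h \<in> ring_hom R U"
    and V: "lenle R (carrier R) M V l Y"
    and B: "submod U (h ` carrier R) B" and x: "x \<in> carrier U" and VB: "\<forall>v\<in>V. h v \<otimes>\<^bsub>U\<^esub> x \<in> B"
    and M: "M \<subseteq> carrier R" and N: "N \<subseteq> h ` M"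
  shows "lenle U (h ` carrier R) N B l {b \<oplus>\<^bsub>U\<^esub> h y \<otimes>\<^bsub>U\<^esub> x | b y. b \<in> B \<and> y \<in> Y}"
  using V
proof (induction rule: lenle.induct)
  case lenle_0
  interpret U: cring U by fact
  interpret R: cring R by fact
  have h: "h v \<in> carrier U" if "v \<in> carrier R" for v using assms(3) that by (simp add: ring_hom_closed)
  have "V \<subseteq> carrier R" "\<zero>\<^bsub>R\<^esub> \<in> V" using lenle_0 by (auto simp: submod_def)
  moreover have "h \<zero>\<^bsub>R\<^esub> = \<zero>\<^bsub>U\<^esub>" using assms(1-3) ring_hom_zero R.ring_axioms U.ring_axioms by blast
  moreover have "b = b \<oplus>\<^bsub>U\<^esub> h \<zero>\<^bsub>R\<^esub> \<otimes>\<^bsub>U\<^esub> x" if "b \<in> B" for b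
    using submodD(1)[OF B that] x calculation by simp
  ultimately have "{b \<oplus>\<^bsub>U\<^esub> h y \<otimes>\<^bsub>U\<^esub> x | b y. b \<in> B \<and> y \<in> V} = B"
    using VB submodD[OF B] by blast
  then show ?case using B lenle.lenle_0 by metis
next
  case (lenle_Suc k S w)
  interpret U: cring U by fact
  interpret R: cring R by fact
  have hc: "h v \<in> carrier U" if "v \<in> carrier R" for v using assms(3) that by (simp add: ring_hom_closed)
  interpret RR: coefficient_ring R "carrier R"
    by (intro coefficient_ring.intro coefficient_ring_axioms.intro R.carrier_is_subring assms(1))
  have S: "S \<subseteq> carrier R" using RR.lenle_submod[OF lenle_Suc.hyps(1)] by (auto simp: submod_def)
  let ?Z = "{b \<oplus>\<^bsub>U\<^esub> h y \<otimes>\<^bsub>U\<^esub> x | b y. b \<in> B \<and> y \<in> S}"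
  have hx: "h w \<otimes>\<^bsub>U\<^esub> x \<in> carrier U" using hc lenle_Suc x by simp
  have "r \<otimes>\<^bsub>U\<^esub> (h w \<otimes>\<^bsub>U\<^esub> x) \<in> ?Z" if rN: "r \<in> N" for r
  proof -
    obtain s where s: "r = h s" "s \<in> M" using rN N by blast
    have sw: "s \<otimes>\<^bsub>R\<^esub> w \<in> S" using lenle_Suc s by blast
    show ?thesis
    proof -
      have "r \<otimes>\<^bsub>U\<^esub> (h w \<otimes>\<^bsub>U\<^esub> x) = \<zero>\<^bsub>U\<^esub> \<oplus>\<^bsub>U\<^esub> h (s \<otimes>\<^bsub>R\<^esub> w) \<otimes>\<^bsub>U\<^esub> x"
        using s M hc lenle_Suc.hyps(2) x by (auto simp: ring_hom_mult[OF assms(3)] U.m_assoc subset_iff)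
      then show ?thesis using sw submodD(2)[OF B] by blast
    qed
  qed
  then have "lenle U (h ` carrier R) N B (Suc k) (adjoin U (h ` carrier R) ?Z (h w \<otimes>\<^bsub>U\<^esub> x))"
    using lenle.lenle_Suc[OF lenle_Suc.IH hx] by blast
  moreover have "adjoin U (h ` carrier R) ?Z (h w \<otimes>\<^bsub>U\<^esub> x) =
    {b \<oplus>\<^bsub>U\<^esub> h y \<otimes>\<^bsub>U\<^esub> x | b y. b \<in> B \<and> y \<in> adjoin R (carrier R) S w}" (is "?L = ?RR")
  proof -
    have eq: "(b \<oplus>\<^bsub>U\<^esub> h y \<otimes>\<^bsub>U\<^esub> x) \<oplus>\<^bsub>U\<^esub> h c \<otimes>\<^bsub>U\<^esub> (h w \<otimes>\<^bsub>U\<^esub> x)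
      = b \<oplus>\<^bsub>U\<^esub> h (y \<oplus>\<^bsub>R\<^esub> c \<otimes>\<^bsub>R\<^esub> w) \<otimes>\<^bsub>U\<^esub> x" if "b \<in> B" "y \<in> S" "c \<in> carrier R" for b y c
    proof -
      have c: "b \<in> carrier U" "y \<in> carrier R" "h y \<in> carrier U" "h c \<in> carrier U" "h w \<in> carrier U"
        using that submodD(1)[OF B] S hc lenle_Suc.hyps(2) by auto
      have "h (y \<oplus>\<^bsub>R\<^esub> c \<otimes>\<^bsub>R\<^esub> w) = h y \<oplus>\<^bsub>U\<^esub> h c \<otimes>\<^bsub>U\<^esub> h w"
        using c that lenle_Suc.hyps(2) by (simp add: ring_hom_mult[OF assms(3)] ring_hom_add[OF assms(3)])
      then show ?thesis using c x by (simp add: U.l_distr U.a_assoc U.m_assoc)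
    qed
    show ?thesis
    proof
      show "?L \<subseteq> ?RR" unfolding adjoin_def using eq by blast
      show "?RR \<subseteq> ?L"
      proof
        fix u assume "u \<in> ?RR"
        then obtain b y c where "b \<in> B" "y \<in> S" "c \<in> carrier R"
          "u = b \<oplus>\<^bsub>U\<^esub> h (y \<oplus>\<^bsub>R\<^esub> c \<otimes>\<^bsub>R\<^esub> w) \<otimes>\<^bsub>U\<^esub> x" unfolding adjoin_def by blast
        then show "u \<in> ?L" unfolding adjoin_def using eq[symmetric] by blast
      qed
    qed
  qed
  ultimately show ?case by simp
qed

section \<open>Parameters of Noetherian local rings\<close>

text \<open>The ascending chain condition for ideals of the subring \<open>C\<close>, stated in the
  ambient ring, so that it passes from \<open>C\<close> to \<open>C[x]\<close> without a change of
  ring or type.\<close>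

definition acc :: "('a, 'm) ring_scheme \<Rightarrow> 'a set \<Rightarrow> bool" where
  "acc R C \<longleftrightarrow> (\<forall>J::nat \<Rightarrow> 'a set. (\<forall>n. submod R C (J n) \<and> J n \<subseteq> C) \<and> (\<forall>n. J n \<subseteq> J (Suc n)) \<longrightarrow>
     (\<exists>k. \<forall>n\<ge>k. J n = J k))"

lemma acc_maximal:
  assumes "acc R C" "F \<noteq> {}" "\<And>J. J \<in> F \<Longrightarrow> submod R C J \<and> J \<subseteq> C"
  shows "\<exists>J\<in>F. \<forall>J'\<in>F. J \<subseteq> J' \<longrightarrow> J' = J"
proof (rule ccontr)
  assume "\<not> ?thesis"
  then have "\<forall>J\<in>F. \<exists>J'. J' \<in> F \<and> J \<subset> J'" by blast
  then obtain g where g: "\<And>J. J \<in> F \<Longrightarrow> g J \<in> F \<and> J \<subset> g J" by metis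
  obtain J0 where J0: "J0 \<in> F" using assms(2) by blast
  define J where "J n = (g ^^ n) J0" for n
  have JF: "J n \<in> F" for n unfolding J_def by (induction n) (auto simp: J0 g)
  have JS: "J n \<subset> J (Suc n)" for n using g[OF JF[of n]] unfolding J_def by simp
  have acc_n: "\<exists>k. \<forall>n\<ge>k. J n = J k"
  proof -
    have "(\<forall>n. submod R C (J n) \<and> J n \<subseteq> C) \<and> (\<forall>n. J n \<subseteq> J (Suc n))"
    proof (intro conjI allI)
      show "submod R C (J n)" "J n \<subseteq> C" for n using assms(3)[OF JF[of n]] by simp_all
      show "J n \<subseteq> J (Suc n)" for n by (rule psubset_imp_subset[OF JS])
    qed
    with assms(1)[unfolded acc_def, THEN spec[of _ J]] show ?thesis by (rule mp)
  qed
  from acc_n obtain k where "\<forall>n\<ge>k. J n = J k" ..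
  then have "J (Suc k) = J k" by (meson le_SucI le_refl)
  then show False using JS[of k] by simp
qed

lemma (in cring) submod_iff_ideal: "submod R (carrier R) J \<longleftrightarrow> ideal J R"
proof
  assume J: "submod R (carrier R) J"
  interpret coefficient_ring R "carrier R"
    by (intro coefficient_ring.intro coefficient_ring_axioms.intro carrier_is_subring cring_axioms)
  show "ideal J R"
  proof (intro idealI ring_axioms add.subgroupI)
    show "J \<subseteq> carrier R" "J \<noteq> {}" using J by (auto simp: submod_def)
    show "a \<in> J \<Longrightarrow> \<ominus> a \<in> J" for a using submod_uminus[OF J] .
    show "a \<in> J \<Longrightarrow> b \<in> J \<Longrightarrow> a \<oplus> b \<in> J" for a b using submodD(3)[OF J] .
    show "a \<in> J \<Longrightarrow> x \<in> carrier R \<Longrightarrow> x \<otimes> a \<in> J" for a x using submodD(4)[OF J] .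
    then show "a \<in> J \<Longrightarrow> x \<in> carrier R \<Longrightarrow> a \<otimes> x \<in> J" for a x
      using submodD(1)[OF J] m_comm by metis
  qed
next
  assume "ideal J R"
  then interpret J: ideal J R .
  show "submod R (carrier R) J" unfolding submod_def using J.I_l_closed J.a_closed J.zero_closed J.a_subset by auto
qed

lemma noetherian_acc:
  assumes "noetherian_ring R" "cring R" shows "acc R (carrier R)"
  unfolding acc_def
proof (intro allI impI, elim conjE)
  interpret noetherian_ring R by fact
  interpret cring R by fact
  fix J :: "nat \<Rightarrow> _" assume J: "\<forall>n. submod R (carrier R) (J n) \<and> J n \<subseteq> carrier R" "\<forall>n. J n \<subseteq> J (Suc n)"
  have mono: "i \<le> j \<Longrightarrow> J i \<subseteq> J j" for i j using J(2) by (simp add: lift_Suc_mono_le)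
  have "subset.chain {I. ideal I R} (range J)" unfolding subset_chain_def
  proof (intro conjI subsetI ballI)
    show "x \<in> {I. ideal I R}" if "x \<in> range J" for x using that J(1) submod_iff_ideal by auto
    show "x \<subseteq> y \<or> y \<subseteq> x" if xy: "x \<in> range J" "y \<in> range J" for x y
    proof -
      obtain i j where "x = J i" "y = J j" using xy by blast
      then show ?thesis using mono[of i j] mono[of j i] by (cases "i \<le> j") auto
    qed
  qed
  then have "\<Union>(range J) \<in> range J" using ideal_chain_is_trivial by blast
  then obtain k where "\<Union>(range J) = J k" by auto
  then have "\<forall>n\<ge>k. J n = J k" using mono by blast
  then show "\<exists>k. \<forall>n\<ge>k. J n = J k" by blast
qed

lemma prime_chain_extend:
  assumes Q: "prime_chain R Q n" and P: "primeideal P R" "P \<subset> Q 0"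
  shows "prime_chain R (case_nat P Q) (Suc n)"
  unfolding prime_chain_def
proof (intro conjI allI impI)
  show "primeideal (case_nat P Q i) R" if "i \<le> Suc n" for i
    using that Q P(1) unfolding prime_chain_def by (cases i) simp_all
  show "case_nat P Q i \<subset> case_nat P Q (Suc i)" if "i < Suc n" for i
    using that Q P(2) unfolding prime_chain_def by (cases i) simp_all
qed

definition adjoins :: "('a, 'm) ring_scheme \<Rightarrow> 'a set \<Rightarrow> 'a set \<Rightarrow> 'a list \<Rightarrow> 'a set" where
  "adjoins R C J xs = foldl (adjoin R C) J xs"

lemma adjoins_simps [simp]:
  "adjoins R C J [] = J" "adjoins R C J (x # xs) = adjoins R C (adjoin R C J x) xs"
  "adjoins R C J (xs @ [x]) = adjoin R C (adjoins R C J xs) x"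
  by (simp_all add: adjoins_def)

context coefficient_ring
begin

lemma adjoins_submod: "submod R C J \<Longrightarrow> set xs \<subseteq> carrier R \<Longrightarrow> submod R C (adjoins R C J xs)"
  by (induction xs arbitrary: J) (simp_all add: adjoin_submod)

lemma adjoins_least: "submod R C Y \<Longrightarrow> J \<subseteq> Y \<Longrightarrow> set xs \<subseteq> Y \<Longrightarrow> adjoins R C J xs \<subseteq> Y"
  by (induction xs arbitrary: J) (simp_all add: adjoin_least)

lemma adjoins_subset: "submod R C J \<Longrightarrow> set xs \<subseteq> carrier R \<Longrightarrow> J \<subseteq> adjoins R C J xs"
proof (induction xs arbitrary: J)
  case (Cons x xs)
  then have "submod R C (adjoin R C J x)" "J \<subseteq> adjoin R C J x"
    using adjoin_submod adjoin_subset by auto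
  then show ?case using Cons by fastforce
qed simp

lemma adjoin_swap:
  assumes "submod R C J" "x \<in> carrier R" "y \<in> carrier R"
  shows "adjoin R C (adjoin R C J x) y = adjoin R C (adjoin R C J y) x"
proof -
  have "adjoin R C (adjoin R C J x) y \<subseteq> adjoin R C (adjoin R C J y) x"
    if "x \<in> carrier R" "y \<in> carrier R" for x y
  proof -
    note s = adjoin_submod[OF assms(1) that(2)]
    have 1: "adjoin R C J y \<subseteq> adjoin R C (adjoin R C J y) x" by (rule adjoin_subset[OF s that(1)])
    show ?thesis
      using 1 adjoin_submod[OF s that(1)] adjoin_mem[OF s that(1)] adjoin_mem[OF assms(1) that(2)]
        adjoin_subset[OF assms(1) that(2)]
      by (intro adjoin_least) auto
  qed
  then show ?thesis using assms by blast
qed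

text \<open>The first generator can be moved to the last place, where its exponent can be changed
  without touching the others.\<close>

lemma adjoins_adjoin:
  assumes "submod R C J" "x \<in> carrier R" "set ys \<subseteq> carrier R"
  shows "adjoins R C (adjoin R C J x) ys = adjoin R C (adjoins R C J ys) x"
  using assms
proof (induction ys arbitrary: J)
  case (Cons y ys)
  then show ?case using adjoin_swap[of J x y] adjoin_submod[of J y] by simp
qed simp

end

section \<open>Colength, minimal primes and parameters over a Noetherian local ring\<close>

locale noetherian_local = cring +
  fixes m
  assumes acc: "acc R (carrier R)"
    and m: "submod R (carrier R) m" and one_notin_m: "\<one> \<notin> m"
    and m_unit: "c \<in> carrier R - m \<Longrightarrow> \<exists>d\<in>carrier R. d \<otimes> c = \<one>"

sublocale noetherian_local \<subseteq> local_coefficient_ring R "carrier R" m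
  by (intro local_coefficient_ring.intro coefficient_ring.intro coefficient_ring_axioms.intro
      carrier_is_subring cring_axioms local_coefficient_ring_axioms.intro m_unit)

context noetherian_local
begin

abbreviation idl :: "'a set \<Rightarrow> bool" where "idl \<equiv> submod R (carrier R)"

abbreviation colen :: "'a set \<Rightarrow> nat \<Rightarrow> bool" where
  "colen J l \<equiv> lenle R (carrier R) m J l (carrier R)"

abbreviation adj :: "'a set \<Rightarrow> 'a \<Rightarrow> 'a set" where "adj \<equiv> adjoin R (carrier R)"

abbreviation adjs :: "'a set \<Rightarrow> 'a list \<Rightarrow> 'a set" where "adjs \<equiv> adjoins R (carrier R)"

lemma m_carrier: "m \<subseteq> carrier R"
  using m by (auto simp: submod_def)

lemma submod_eq_carrier: "idl J \<Longrightarrow> \<one> \<in> J \<Longrightarrow> J = carrier R"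
  using submodD[of R "carrier R" J] r_one by (metis subset_antisym subsetI)

lemma proper_le_m:
  assumes "idl J" "J \<noteq> carrier R" shows "J \<subseteq> m"
proof
  fix c assume c: "c \<in> J"
  show "c \<in> m"
  proof (rule ccontr)
    assume "c \<notin> m"
    then obtain d where "d \<in> carrier R" "d \<otimes> c = \<one>" using m_unit c submodD(1)[OF assms(1)] by blast
    then have "\<one> \<in> J" using submodD(4)[OF assms(1)] c by metis
    then show False using submod_eq_carrier assms by blast
  qed
qed

lemma primeideal_submod: "primeideal P R \<Longrightarrow> idl P"
  using submod_iff_ideal primeideal.axioms(1) by blast

lemma primeideal_le_m: "primeideal P R \<Longrightarrow> P \<subseteq> m"
  using proper_le_m primeideal_submod primeideal.I_notcarr by metis

lemma m_prime: "primeideal m R"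
proof (rule primeidealI)
  show "ideal m R" using m submod_iff_ideal by blast
  show "carrier R \<noteq> m" using one_notin_m one_closed by blast
  fix a b assume ab: "a \<in> carrier R" "b \<in> carrier R" "a \<otimes> b \<in> m"
  show "a \<in> m \<or> b \<in> m"
  proof (rule ccontr)
    assume "\<not> ?thesis"
    then obtain d where d: "d \<in> carrier R" "d \<otimes> a = \<one>" and b: "b \<notin> m" using m_unit ab by blast
    have "b = d \<otimes> (a \<otimes> b)" using d ab by (simp add: m_assoc[symmetric])
    then show False using b submodD(4)[OF m d(1) ab(3)] by simp
  qed
qed (rule cring_axioms)

text \<open>If \<open>V x \<subseteq> B\<close>, then \<open>(B + Rx)/B\<close> is a quotient of
  \<open>R/V\<close>: this is \<open>lenle_translate\<close> for the identity map.\<close>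

lemma lenle_adj:
  assumes "colen V l" "idl B" "x \<in> carrier R" "\<forall>v\<in>V. v \<otimes> x \<in> B"
  shows "lenle R (carrier R) m B l (adj B x)"
proof -
  have id: "(\<lambda>x. x) \<in> ring_hom R R" by (simp add: ring_hom_def)
  have "lenle R ((\<lambda>x. x) ` carrier R) m B l {b \<oplus> y \<otimes> x | b y. b \<in> B \<and> y \<in> carrier R}"
    by (rule lenle_translate[OF cring_axioms cring_axioms id assms(1)])
       (use assms m_carrier in auto)
  then show ?thesis unfolding adjoin_def by simp
qed

lemma colen_m: "colen m 1"
proof -
  have "adj m \<one> = carrier R"
    by (rule submod_eq_carrier[OF adjoin_submod[OF m one_closed] adjoin_mem[OF m one_closed]])
  moreover have "lenle R (carrier R) m m (Suc 0) (adj m \<one>)"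
    using m m_carrier by (intro lenle.intros) (auto simp: subset_iff)
  ultimately show ?thesis by simp
qed

lemma prime_of_maximal:
  assumes J: "idl J" "J \<noteq> carrier R"
    and "\<And>a b. a \<in> carrier R \<Longrightarrow> b \<in> carrier R \<Longrightarrow> a \<otimes> b \<in> J \<Longrightarrow> a \<notin> J \<Longrightarrow> b \<notin> J \<Longrightarrow> False"
  shows "primeideal J R"
  using assms submod_iff_ideal cring_axioms by (intro primeidealI) auto

lemma adj_psubset: "idl J \<Longrightarrow> a \<in> carrier R \<Longrightarrow> a \<notin> J \<Longrightarrow> J \<subset> adj J a"
  using adjoin_subset adjoin_mem by blast

text \<open>Noetherian induction. Let \<open>J'\<close> be maximal among the ideals above
  \<open>J\<close> of infinite colength. If \<open>a b \<in> J'\<close> with neither factor in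
  \<open>J'\<close>, then \<open>(J' + Ra)/J'\<close> is a quotient of \<open>R/(J' + Rb)\<close>,
  so it has finite length, as has \<open>R/(J' + Ra)\<close>: a contradiction. Hence
  \<open>J'\<close> is prime, so it is \<open>m\<close>, of colength \<open>1\<close>.\<close>

lemma finite_colength:
  assumes J: "idl J" and P: "\<And>P. primeideal P R \<Longrightarrow> J \<subseteq> P \<Longrightarrow> P = m"
  shows "\<exists>l. colen J l"
proof (rule ccontr)
  assume no: "\<nexists>l. colen J l"
  define F where "F = {J'. idl J' \<and> J \<subseteq> J' \<and> (\<nexists>l. colen J' l)}"
  have "\<exists>J'\<in>F. \<forall>J''\<in>F. J' \<subseteq> J'' \<longrightarrow> J'' = J'"
  proof (rule acc_maximal[OF acc])
    show "F \<noteq> {}" using J no unfolding F_def by blast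
    show "idl J' \<and> J' \<subseteq> carrier R" if "J' \<in> F" for J'
      using that unfolding F_def submod_def by blast
  qed
  then obtain J' where J'F: "J' \<in> F"
    and max: "\<And>J''. J'' \<in> F \<Longrightarrow> J' \<subseteq> J'' \<Longrightarrow> J'' = J'" by blast
  then have J': "idl J'" "J \<subseteq> J'" "\<nexists>l. colen J' l" unfolding F_def by simp_all
  have big: "\<exists>l. colen (adj J' a) l" if "a \<in> carrier R" "a \<notin> J'" for a
  proof (rule ccontr)
    assume "\<nexists>l. colen (adj J' a) l"
    then have "adj J' a \<in> F" unfolding F_def
      using adjoin_submod[OF J'(1) that(1)] order_trans[OF J'(2) adjoin_subset[OF J'(1) that(1)]] by simp
    then have "adj J' a = J'" by (rule max) (rule adjoin_subset[OF J'(1) that(1)])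
    then show False using adj_psubset[OF J'(1) that] by simp
  qed
  have "primeideal J' R"
  proof (rule prime_of_maximal[OF J'(1)])
    have "colen (carrier R) 0" by (rule lenle.lenle_0) (rule submod_C)
    then show "J' \<noteq> carrier R" using J'(3) by auto
  next
    fix a b assume ab: "a \<in> carrier R" "b \<in> carrier R" "a \<otimes> b \<in> J'" "a \<notin> J'" "b \<notin> J'"
    obtain k where k: "colen (adj J' a) k" using big ab by blast
    obtain l where l: "colen (adj J' b) l" using big ab by blast
    have "v \<otimes> a \<in> J'" if "v \<in> adj J' b" for v
    proof -
      obtain y c where yc: "y \<in> J'" "c \<in> carrier R" "v = y \<oplus> c \<otimes> b" using \<open>v \<in> adj J' b\<close> unfolding adjoin_def by blast
      have y: "y \<in> carrier R" using submodD(1)[OF J'(1) yc(1)] .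
      have "v \<otimes> a = a \<otimes> y \<oplus> c \<otimes> (a \<otimes> b)" unfolding yc(3) using y yc(2) ab(1,2) by algebra
      then show ?thesis using submodD(3,4)[OF J'(1)] yc ab by simp
    qed
    then have "lenle R (carrier R) m J' l (adj J' a)" using lenle_adj[OF l J'(1) ab(1)] by blast
    then show False using lenle_trans[OF k] J'(3) by blast
  qed
  then show False using P J' colen_m by blast
qed

text \<open>Noetherian induction again. A maximal counterexample is prime, because a prime
  containing \<open>a b\<close> contains \<open>a\<close> or \<open>b\<close>, and the finite sets
  for \<open>J' + Ra\<close> and \<open>J' + Rb\<close> can be united. But for a prime ideal the
  ideal alone is such a set.\<close>

lemma finite_minimal_primes:
  assumes J: "idl J"
  shows "\<exists>PS. finite PS \<and> (\<forall>P\<in>PS. primeideal P R \<and> J \<subseteq> P) \<and> (\<forall>Q. primeideal Q R \<longrightarrow> J \<subseteq> Q \<longrightarrow> (\<exists>P\<in>PS. P \<subseteq> Q))"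
    (is "?good J")
proof (rule ccontr)
  assume no: "\<not> ?good J"
  define F where "F = {J. idl J \<and> \<not> ?good J}"
  have "\<exists>J'\<in>F. \<forall>J''\<in>F. J' \<subseteq> J'' \<longrightarrow> J'' = J'"
  proof (rule acc_maximal[OF acc])
    show "F \<noteq> {}" using J no unfolding F_def by blast
    show "idl J' \<and> J' \<subseteq> carrier R" if "J' \<in> F" for J'
      using that unfolding F_def submod_def by blast
  qed
  then obtain J' where J'F: "J' \<in> F"
    and max: "\<And>J''. J'' \<in> F \<Longrightarrow> J' \<subseteq> J'' \<Longrightarrow> J'' = J'" by blast
  then have J': "idl J'" and bad: "\<not> ?good J'" unfolding F_def by blast+
  have big: "?good (adj J' a)" if "a \<in> carrier R" "a \<notin> J'" for a
  proof (rule ccontr)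
    assume "\<not> ?good (adj J' a)"
    then have "adj J' a \<in> F" unfolding F_def using adjoin_submod[OF J' that(1)] by blast
    then have "adj J' a = J'" by (rule max) (rule adjoin_subset[OF J' that(1)])
    then show False using adj_psubset[OF J' that] by simp
  qed
  have "primeideal J' R"
  proof (rule prime_of_maximal[OF J'])
    show "J' \<noteq> carrier R"
    proof
      assume e: "J' = carrier R"
      have "\<not> primeideal Q R" if "carrier R \<subseteq> Q" for Q
        using that primeideal.I_notcarr[of Q R] submodD(1)[OF primeideal_submod] by blast
      then have "?good J'" unfolding e by (intro exI[of _ "{}"]) auto
      then show False using bad by blast
    qed
  next
    fix a b assume ab: "a \<in> carrier R" "b \<in> carrier R" "a \<otimes> b \<in> J'" "a \<notin> J'" "b \<notin> J'"
    obtain PS where PS: "finite PS" "\<forall>P\<in>PS. primeideal P R \<and> adj J' a \<subseteq> P"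
      "\<forall>Q. primeideal Q R \<longrightarrow> adj J' a \<subseteq> Q \<longrightarrow> (\<exists>P\<in>PS. P \<subseteq> Q)"
      using big[OF ab(1,4)] by blast
    obtain PT where PT: "finite PT" "\<forall>P\<in>PT. primeideal P R \<and> adj J' b \<subseteq> P"
      "\<forall>Q. primeideal Q R \<longrightarrow> adj J' b \<subseteq> Q \<longrightarrow> (\<exists>P\<in>PT. P \<subseteq> Q)"
      using big[OF ab(2,5)] by blast
    have "?good J'"
    proof (intro exI[of _ "PS \<union> PT"] conjI allI impI ballI)
      show "finite (PS \<union> PT)" using PS PT by blast
      show "primeideal P R" "J' \<subseteq> P" if "P \<in> PS \<union> PT" for P
        using that PS(2) PT(2) adjoin_subset[OF J' ab(1)] adjoin_subset[OF J' ab(2)] by blast+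
      fix Q assume Q: "primeideal Q R" "J' \<subseteq> Q"
      then have "a \<in> Q \<or> b \<in> Q" using primeideal.I_prime[OF Q(1) ab(1,2)] ab(3) by blast
      then have "adj J' a \<subseteq> Q \<or> adj J' b \<subseteq> Q" using adjoin_least[OF primeideal_submod[OF Q(1)] Q(2)] by blast
      then show "\<exists>P\<in>PS \<union> PT. P \<subseteq> Q" using PS(3) PT(3) Q(1) by blast
    qed
    then show False using bad by blast
  qed
  then have "?good J'" by (intro exI[of _ "{J'}"]) auto
  then show False using bad by blast
qed

text \<open>Multiplication by an element of \<open>Q - P\<close>, for one \<open>Q\<close> after the
  other, keeps the product outside the prime \<open>P\<close>.\<close>

lemma avoid_inter:
  assumes "finite F" "\<forall>Q\<in>F. idl Q \<and> \<not> Q \<subseteq> P" "primeideal P R"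
    "idl I" "\<not> I \<subseteq> P"
  shows "\<exists>w\<in>I. w \<notin> P \<and> (\<forall>Q\<in>F. w \<in> Q)"
  using assms(1,2)
proof (induction F rule: finite_induct)
  case empty
  then show ?case using assms(5) by auto
next
  case (insert Q F)
  then obtain w where w: "w \<in> I" "w \<notin> P" "\<forall>Q\<in>F. w \<in> Q" by blast
  obtain b where b: "b \<in> Q" "b \<notin> P" using insert by blast
  have c: "w \<in> carrier R" "b \<in> carrier R"
    using submodD(1)[OF assms(4) w(1)] submodD(1)[of R "carrier R" Q b] b insert.prems by auto
  have "b \<otimes> w \<notin> P" using primeideal.I_prime[OF assms(3)] c w b by blast
  moreover have "b \<otimes> w \<in> I" using submodD(4)[OF assms(4)] c w by blast
  moreover have "b \<otimes> w \<in> Q'" if "Q' \<in> F" for Q' using submodD(4)[of R "carrier R" Q'] insert.prems w that c by blast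
  moreover have "b \<otimes> w \<in> Q" using submodD(4)[of R "carrier R" Q w b] insert.prems b c by (simp add: m_comm)
  ultimately show ?case by blast
qed

text \<open>Induction on the set of primes, after discarding any prime contained in another. If the
  \<open>x\<close> that avoids all primes but \<open>P\<close> lies in \<open>P\<close>, it is
  corrected by an element of \<open>I\<close> that lies in all the other primes and not in
  \<open>P\<close>.\<close>

lemma prime_avoidance:
  assumes "finite PS" "\<forall>P\<in>PS. primeideal P R \<and> \<not> I \<subseteq> P" "idl I"
  shows "\<exists>x\<in>I. \<forall>P\<in>PS. x \<notin> P"
  using assms(1,2)
proof (induction PS rule: finite_psubset_induct)
  case (psubset PS)
  show ?case
  proof (cases "\<exists>P\<in>PS. \<exists>Q\<in>PS. P \<noteq> Q \<and> P \<subseteq> Q")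
    case True
    then obtain P Q where PQ: "P \<in> PS" "Q \<in> PS" "P \<noteq> Q" "P \<subseteq> Q" by blast
    have "PS - {P} \<subset> PS" using PQ by blast
    then obtain x where "x \<in> I" "\<forall>P\<in>PS - {P}. x \<notin> P"
      using psubset.IH[of "PS - {P}"] psubset.prems by blast
    then show ?thesis using PQ by blast
  next
    case inc: False
    show ?thesis
    proof (cases "PS = {}")
      case True then show ?thesis using submodD(2)[OF assms(3)] by auto
    next
      case False
      then obtain P where P: "P \<in> PS" by blast
      then have "PS - {P} \<subset> PS" by blast
      then obtain x where x: "x \<in> I" "\<forall>P\<in>PS - {P}. x \<notin> P"
        using psubset.IH[of "PS - {P}"] psubset.prems by blast
      show ?thesis
      proof (cases "x \<in> P")
        case False then show ?thesis using x by blast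
      next
        case True
        have "\<exists>w\<in>I. w \<notin> P \<and> (\<forall>Q\<in>PS - {P}. w \<in> Q)"
        proof (rule avoid_inter)
          show "finite (PS - {P})" using psubset.hyps by simp
          show "\<forall>Q\<in>PS - {P}. idl Q \<and> \<not> Q \<subseteq> P"
            using psubset.prems P inc primeideal_submod by blast
          show "primeideal P R" "\<not> I \<subseteq> P" using psubset.prems P by simp_all
        qed (rule assms(3))
        then obtain w where w: "w \<in> I" "w \<notin> P" "\<forall>Q\<in>PS - {P}. w \<in> Q" by blast
        have c: "x \<in> carrier R" "w \<in> carrier R" using submodD(1)[OF assms(3)] x w by blast+
        have "x \<oplus> w \<notin> P"
          using submod_add_cancel[OF primeideal_submod True c(2)] w psubset.prems P by blast
        moreover have "x \<oplus> w \<notin> Q" if "Q \<in> PS - {P}" for Q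
          using submod_add_cancel[OF primeideal_submod, of Q w x] c w x that psubset.prems a_comm[OF c] by auto
        ultimately show ?thesis using submodD(3)[OF assms(3) x(1) w(1)] by blast
      qed
    qed
  qed
qed

text \<open>The second premise says \<open>dim R/J \<le> d\<close> in terms of chains that start
  above \<open>J\<close>. A parameter \<open>x\<close> is chosen outside the finitely many primes of
  \<open>finite_minimal_primes\<close> other than \<open>m\<close>. A chain above
  \<open>J + Rx\<close> can then be prolonged downward by one of these primes, so the bound drops by
  one.\<close>

lemma system_of_parameters:
  assumes "idl J" "\<And>n P. prime_chain R P n \<Longrightarrow> J \<subseteq> P 0 \<Longrightarrow> n \<le> d"
  shows "\<exists>xs l. length xs = d \<and> set xs \<subseteq> m \<and> colen (adjs J xs) l"
  using assms
proof (induction d arbitrary: J)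
  case 0
  have "P = m" if P: "primeideal P R" "J \<subseteq> P" for P
  proof (rule ccontr)
    assume "P \<noteq> m"
    define Q where "Q i = (if i = (0::nat) then P else m)" for i
    have "prime_chain R Q 1" unfolding prime_chain_def
    proof (intro conjI allI impI)
      show "primeideal (Q i) R" for i unfolding Q_def using P(1) m_prime by simp
      show "Q i \<subset> Q (Suc i)" if "i < 1" for i
        unfolding Q_def using that primeideal_le_m[OF P(1)] \<open>P \<noteq> m\<close> by auto
    qed
    moreover have "J \<subseteq> Q 0" using P(2) by (simp add: Q_def)
    ultimately have "1 \<le> (0::nat)" by (rule 0(2))
    then show False by simp
  qed
  then have "\<exists>l. colen J l" by (rule finite_colength[OF 0(1)])
  then show ?case by (intro exI[of _ "[]"]) auto
next
  case (Suc d)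
  obtain PS where PS: "finite PS" "\<forall>P\<in>PS. primeideal P R \<and> J \<subseteq> P"
      "\<forall>Q. primeideal Q R \<longrightarrow> J \<subseteq> Q \<longrightarrow> (\<exists>P\<in>PS. P \<subseteq> Q)"
    using finite_minimal_primes[OF Suc.prems(1)] by blast
  have av: "\<forall>P\<in>PS - {m}. primeideal P R \<and> \<not> m \<subseteq> P" using PS(2) primeideal_le_m by blast
  have "\<exists>x\<in>m. \<forall>P\<in>PS - {m}. x \<notin> P"
    by (rule prime_avoidance[OF finite_Diff[OF PS(1)] av m])
  then obtain x where x: "x \<in> m" "\<forall>P\<in>PS - {m}. x \<notin> P" by blast
  have xc: "x \<in> carrier R" using x m_carrier by blast
  have "n \<le> d" if Q: "prime_chain R Q n" "adj J x \<subseteq> Q 0" for Q n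
  proof -
    have Q0: "primeideal (Q 0) R" and Qs: "\<And>i. i < n \<Longrightarrow> Q i \<subset> Q (Suc i)" "\<And>i. i \<le> n \<Longrightarrow> primeideal (Q i) R"
      using Q by (auto simp: prime_chain_def)
    have JQ: "J \<subseteq> Q 0" "x \<in> Q 0"
      using Q(2) adjoin_subset[OF Suc.prems(1) xc] adjoin_mem[OF Suc.prems(1) xc] by auto
    then obtain P where P: "P \<in> PS" "P \<subseteq> Q 0" using PS Q0 by blast
    show ?thesis
    proof (cases "P = m")
      case True
      \<comment> \<open>Here the chain starts at \<open>m\<close>, above which there is no further
        prime.\<close>
      have "\<not> 0 < n"
      proof
        assume "0 < n"
        then show False using P(2) True Qs(1)[of 0] primeideal_le_m[OF Qs(2)[of "Suc 0"]] by simp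
      qed
      then show ?thesis by simp
    next
      case False
      then have "P \<noteq> Q 0" using x JQ P by blast
      then have "P \<subset> Q 0" using P(2) by blast
      then have "prime_chain R (case_nat P Q) (Suc n)" using prime_chain_extend[OF Q(1)] PS(2) P(1) by blast
      moreover have "J \<subseteq> case_nat P Q 0" using P(1) PS(2) by simp
      ultimately have "Suc n \<le> Suc d" by (rule Suc.prems(2))
      then show ?thesis by simp
    qed
  qed
  then have "\<exists>xs l. length xs = d \<and> set xs \<subseteq> m \<and> colen (adjs (adj J x) xs) l"
    by (rule Suc.IH[OF adjoin_submod[OF Suc.prems(1) xc]])
  then obtain xs l where "length xs = d" "set xs \<subseteq> m" "colen (adjs (adj J x) xs) l"
    by (elim exE conjE)
  then show ?case using x(1) by (intro exI[of _ "x # xs"] exI[of _ l]) simp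
qed

lemma m_finitely_generated:
  assumes "idl J" "J \<subseteq> m"
  shows "\<exists>xs. set xs \<subseteq> m \<and> adjs J xs = m"
proof -
  define F where "F = {adjs J xs | xs. set xs \<subseteq> m}"
  have sm: "idl (adjs J xs)" if "set xs \<subseteq> m" for xs
    using adjoins_submod[OF assms(1)] that m_carrier by blast
  have "\<exists>J'\<in>F. \<forall>J''\<in>F. J' \<subseteq> J'' \<longrightarrow> J'' = J'"
  proof (rule acc_maximal[OF acc])
    have "adjs J [] \<in> F" unfolding F_def by (intro CollectI exI[of _ "[]"]) simp
    then show "F \<noteq> {}" by blast
    fix J' assume "J' \<in> F"
    then obtain xs where "J' = adjs J xs" "set xs \<subseteq> m" unfolding F_def by blast
    then show "idl J' \<and> J' \<subseteq> carrier R"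
      using sm[of xs] submodD(1)[OF sm[of xs]] by blast
  qed
  then obtain xs where xs: "set xs \<subseteq> m"
    and max: "\<And>J''. J'' \<in> F \<Longrightarrow> adjs J xs \<subseteq> J'' \<Longrightarrow> J'' = adjs J xs"
  proof -
    obtain J' where J': "J' \<in> F" "\<And>J''. J'' \<in> F \<Longrightarrow> J' \<subseteq> J'' \<Longrightarrow> J'' = J'"
      using \<open>\<exists>J'\<in>F. \<forall>J''\<in>F. J' \<subseteq> J'' \<longrightarrow> J'' = J'\<close> by blast
    then obtain xs where "set xs \<subseteq> m" "J' = adjs J xs" unfolding F_def by blast
    then show ?thesis using J'(2) by (intro that[of xs]) simp_all
  qed
  have "m \<subseteq> adjs J xs"
  proof
    fix x assume x: "x \<in> m"
    have "adj (adjs J xs) x = adjs J (xs @ [x])" by simp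
    then have "adj (adjs J xs) x \<in> F" unfolding F_def using x xs
      by (intro CollectI exI[of _ "xs @ [x]"]) auto
    then have "adj (adjs J xs) x = adjs J xs"
      by (rule max) (rule adjoin_subset[OF sm[OF xs]], use x m_carrier in blast)
    then show "x \<in> adjs J xs" using adjoin_mem[OF sm[OF xs], of x] x m_carrier by blast
  qed
  moreover have "adjs J xs \<subseteq> m" by (rule adjoins_least[OF m assms(2) xs])
  ultimately show ?thesis using xs by blast
qed

text \<open>Multiplication by \<open>x^k\<close> maps \<open>R/(J + Rx)\<close> onto
  \<open>(J + Rx^k)/(J + Rx^(k+1))\<close>, so each further power adds at most
  \<open>l\<close>.\<close>

lemma colen_pow1:
  assumes "idl J" "x \<in> carrier R" "colen (adj J x) l"
  shows "colen (adj J (x [^] k)) (k * l)"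
proof (induction k)
  case 0
  have "adj J \<one> = carrier R"
    by (rule submod_eq_carrier[OF adjoin_submod[OF assms(1) one_closed] adjoin_mem[OF assms(1) one_closed]])
  then show ?case using lenle.lenle_0[OF submod_C] by simp
next
  case (Suc k)
  let ?B = "adj J (x [^] Suc k)"
  have xk: "x [^] k \<in> carrier R" "x [^] Suc k \<in> carrier R" using assms by auto
  note s = adjoin_submod[OF assms(1) xk(1)] adjoin_submod[OF assms(1) xk(2)]
  have "v \<otimes> x [^] k \<in> ?B" if v: "v \<in> adj J x" for v
  proof -
    obtain y c where yc: "y \<in> J" "c \<in> carrier R" "v = y \<oplus> c \<otimes> x" using v unfolding adjoin_def by blast
    have y: "y \<in> carrier R" using submodD(1)[OF assms(1) yc(1)] .
    have "v \<otimes> x [^] k = x [^] k \<otimes> y \<oplus> c \<otimes> (x [^] Suc k)"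
      unfolding yc(3) using y yc(2) assms(2) by (simp add: l_distr r_distr m_ac)
    then show ?thesis using adjoinI[of "x [^] k \<otimes> y" J c "x [^] Suc k"] submodD(4)[OF assms(1) xk(1) yc(1)] yc by simp
  qed
  then have 1: "lenle R (carrier R) m ?B l (adj ?B (x [^] k))"
    using lenle_adj[OF assms(3) s(2) xk(1)] by blast
  have "x [^] Suc k \<in> adj J (x [^] k)"
    using submodD(4)[OF s(1) assms(2) adjoin_mem[OF assms(1) xk(1)]] xk assms(2) by (simp add: m_comm)
  then have "adj ?B (x [^] k) = adj J (x [^] k)"
    using adjoin_least[OF s(1) adjoin_least[OF s(1) adjoin_subset[OF assms(1) xk(1)]]
        adjoin_mem[OF assms(1) xk(1)]]
      adjoin_least[OF adjoin_submod[OF s(2) xk(1)]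
        order_trans[OF adjoin_subset[OF assms(1) xk(2)] adjoin_subset[OF s(2) xk(1)]]
        adjoin_mem[OF s(2) xk(1)]] by blast
  then show ?case using lenle_trans[OF Suc 1[unfolded \<open>adj ?B (x [^] k) = adj J (x [^] k)\<close>]]
    by (simp add: add.commute)
qed

text \<open>The parameters are raised to \<open>k\<close>-th powers one after another, each at the
  cost of a factor \<open>k\<close>. This is the source of the factor \<open>M^d\<close> in the
  length bound.\<close>

lemma colen_pow:
  assumes "idl J" "set xs \<subseteq> carrier R" "colen (adjs J xs) l"
  shows "colen (adjs J (map (\<lambda>x. x [^] (k::nat)) xs)) (k ^ length xs * l)"
  using assms
proof (induction xs arbitrary: J)
  case (Cons x xs)
  let ?ys = "map (\<lambda>x. x [^] k) xs"
  have c: "x \<in> carrier R" "set xs \<subseteq> carrier R" "set ?ys \<subseteq> carrier R" using Cons.prems by auto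
  have "colen (adjs (adj J x) ?ys) (k ^ length xs * l)"
    using Cons.IH[OF adjoin_submod[OF Cons.prems(1) c(1)] c(2)] Cons.prems(3) by simp
  then have "colen (adj (adjs J ?ys) x) (k ^ length xs * l)"
    using adjoins_adjoin[OF Cons.prems(1) c(1,3)] by simp
  then have "colen (adj (adjs J ?ys) (x [^] k)) (k * (k ^ length xs * l))"
    using colen_pow1[OF adjoins_submod[OF Cons.prems(1) c(3)] c(1)] by blast
  then show ?case using adjoins_adjoin[OF Cons.prems(1) _ c(3), of "x [^] k"] c(1) by (simp add: mult.assoc)
qed simp

end

section \<open>Finitely generated algebras and an Artin-Rees lemma\<close>

text \<open>The values at \<open>x\<close> of polynomials of degree \<open>< n\<close> over
  \<open>D\<close>. They are values and not formal polynomials, so an element does not determine a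
  leading coefficient. The recursion splits off the top term, which is the one that the basis
  theorem cancels.\<close>

primrec lower_pols :: "('a, 'm) ring_scheme \<Rightarrow> 'a set \<Rightarrow> 'a \<Rightarrow> nat \<Rightarrow> 'a set" where
  "lower_pols R D x 0 = {\<zero>\<^bsub>R\<^esub>}"
| "lower_pols R D x (Suc n) = {a \<otimes>\<^bsub>R\<^esub> x [^]\<^bsub>R\<^esub> n \<oplus>\<^bsub>R\<^esub> f | a f. a \<in> D \<and> f \<in> lower_pols R D x n}"

context coefficient_ring
begin

abbreviation "LP \<equiv> lower_pols R C"

lemma LP_SucI: "a \<in> C \<Longrightarrow> f \<in> LP x n \<Longrightarrow> a \<otimes> x [^] n \<oplus> f \<in> LP x (Suc n)"
  by auto

lemma LP_submod:
  assumes x: "x \<in> carrier R" shows "submod R C (LP x n)"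
proof (induction n)
  case 0
  show ?case using C_carrier unfolding submod_def by simp
next
  case (Suc n)
  have xn: "x [^] n \<in> carrier R" using x by simp
  have "LP x (Suc n) = adjoin R C (LP x n) (x [^] n)"
  proof -
    have "a \<otimes> x [^] n \<oplus> f = f \<oplus> a \<otimes> x [^] n" if "a \<in> C" "f \<in> LP x n" for a f
      using that C_carrier xn submodD(1)[OF Suc] a_comm by simp
    then show ?thesis unfolding adjoin_def lower_pols.simps by (intro Collect_cong) (metis (no_types, lifting))
  qed
  then show ?case using adjoin_submod[OF Suc xn] by simp
qed

lemma LP_Suc_subset: "x \<in> carrier R \<Longrightarrow> LP x n \<subseteq> LP x (Suc n)"
proof
  fix f assume "x \<in> carrier R" "f \<in> LP x n"
  then have "f = \<zero> \<otimes> x [^] n \<oplus> f" "\<zero> \<in> C" using submodD(1)[OF LP_submod] C_closed(1) by auto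
  then show "f \<in> LP x (Suc n)" using LP_SucI[OF \<open>\<zero> \<in> C\<close> \<open>f \<in> LP x n\<close>] by simp
qed

lemma LP_mono: "x \<in> carrier R \<Longrightarrow> i \<le> j \<Longrightarrow> LP x i \<subseteq> LP x j"
  using LP_Suc_subset lift_Suc_mono_le[of "LP x" i j] by blast

lemma LP_mult_x: "x \<in> carrier R \<Longrightarrow> f \<in> LP x n \<Longrightarrow> x \<otimes> f \<in> LP x (Suc n)"
proof (induction n arbitrary: f)
  case 0
  then have "x \<otimes> f = \<zero>" by simp
  then show ?case using submodD(2)[OF LP_submod[OF 0(1)], of "Suc 0"] by simp
next
  case (Suc n)
  then obtain a g where ag: "a \<in> C" "g \<in> LP x n" "f = a \<otimes> x [^] n \<oplus> g" by auto
  have c: "a \<in> carrier R" "g \<in> carrier R" using ag C_carrier submodD(1)[OF LP_submod[OF Suc.prems(1)]] by auto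
  have "x \<otimes> f = a \<otimes> x [^] Suc n \<oplus> x \<otimes> g"
    unfolding ag(3) using c Suc.prems(1) by (simp add: r_distr m_ac)
  then show ?case using LP_SucI[OF ag(1) Suc.IH[OF Suc.prems(1) ag(2)]] by simp
qed

definition adjoin_ring :: "'a \<Rightarrow> 'a set" where
  "adjoin_ring x = (\<Union>n. LP x n)"

lemma adjoin_ring_submod:
  assumes x: "x \<in> carrier R" shows "submod R C (adjoin_ring x)"
proof -
  have "f \<oplus> g \<in> adjoin_ring x" if fg: "f \<in> LP x i" "g \<in> LP x j" for f g i j
  proof -
    have "f \<in> LP x (max i j)" "g \<in> LP x (max i j)" using fg LP_mono[OF x, of i "max i j"] LP_mono[OF x, of j "max i j"] by auto
    then show ?thesis unfolding adjoin_ring_def using submodD(3)[OF LP_submod[OF x]] by blast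
  qed
  moreover have "\<zero> \<in> adjoin_ring x" "adjoin_ring x \<subseteq> carrier R"
    using submodD(1,2)[OF LP_submod[OF x]] unfolding adjoin_ring_def by blast+
  moreover have "c \<otimes> f \<in> adjoin_ring x" if "c \<in> C" "f \<in> adjoin_ring x" for c f
    using that submodD(4)[OF LP_submod[OF x] that(1)] unfolding adjoin_ring_def by blast
  ultimately show ?thesis unfolding submod_def by (auto simp: adjoin_ring_def)
qed

lemma adjoin_ring_mult:
  assumes x: "x \<in> carrier R" and "f \<in> adjoin_ring x" "g \<in> adjoin_ring x"
  shows "f \<otimes> g \<in> adjoin_ring x"
proof -
  note E = submodD[OF adjoin_ring_submod[OF x]]
  have gc: "g \<in> carrier R" using E(1) assms(3) by blast
  have p: "x [^] k \<otimes> g \<in> adjoin_ring x" for k :: nat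
  proof (induction k)
    case (Suc k)
    then obtain n where "x [^] k \<otimes> g \<in> LP x n" unfolding adjoin_ring_def by blast
    then have "x \<otimes> (x [^] k \<otimes> g) \<in> adjoin_ring x" using LP_mult_x[OF x] unfolding adjoin_ring_def by blast
    then show ?case using x gc by (simp add: m_ac)
  qed (use assms gc in simp)
  have "f \<in> LP x n \<Longrightarrow> f \<otimes> g \<in> adjoin_ring x" for n
  proof (induction n arbitrary: f)
    case 0
    then show ?case using gc E(2) by simp
  next
    case (Suc n)
    then obtain a h where ah: "a \<in> C" "h \<in> LP x n" "f = a \<otimes> x [^] n \<oplus> h" by auto
    have "a \<in> carrier R" "h \<in> carrier R" using ah C_carrier submodD(1)[OF LP_submod[OF x]] by auto
    then have "f \<otimes> g = a \<otimes> (x [^] n \<otimes> g) \<oplus> h \<otimes> g"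
      unfolding ah(3) using x gc by (simp add: l_distr m_assoc)
    then show ?case using E(3)[OF E(4)[OF ah(1) p] Suc.IH[OF ah(2)]] by simp
  qed
  then show ?thesis using assms(2) unfolding adjoin_ring_def by blast
qed

lemma C_subset_adjoin_ring: "x \<in> carrier R \<Longrightarrow> C \<subseteq> adjoin_ring x"
proof
  fix c assume "x \<in> carrier R" "c \<in> C"
  then have "c = c \<otimes> x [^] (0::nat) \<oplus> \<zero>" using C_carrier by simp
  then have "c \<in> LP x (Suc 0)" using \<open>c \<in> C\<close> LP_SucI[of c \<zero> x 0] by simp
  then show "c \<in> adjoin_ring x" unfolding adjoin_ring_def by blast
qed

lemma adjoin_ring_self: "x \<in> carrier R \<Longrightarrow> x \<in> adjoin_ring x"
proof -
  assume x: "x \<in> carrier R"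
  have "x = \<one> \<otimes> x [^] (1::nat) \<oplus> \<zero>" using x by simp
  moreover have "\<zero> \<in> LP x 1" using submodD(2)[OF LP_submod[OF x]] .
  ultimately have "x \<in> LP x (Suc 1)" using LP_SucI[OF C_closed(2), of \<zero> x 1] by simp
  then show "x \<in> adjoin_ring x" unfolding adjoin_ring_def by blast
qed

lemma adjoin_ring_subring:
  assumes x: "x \<in> carrier R" shows "subring (adjoin_ring x) R"
proof (rule subringI)
  note S = adjoin_ring_submod[OF x]
  show "adjoin_ring x \<subseteq> carrier R" using S by (auto simp: submod_def)
  show "\<one> \<in> adjoin_ring x" using C_subset_adjoin_ring[OF x] C_closed(2) by blast
  show "h \<in> adjoin_ring x \<Longrightarrow> \<ominus> h \<in> adjoin_ring x" for h using submod_uminus[OF S] .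
  show "g \<in> adjoin_ring x \<Longrightarrow> h \<in> adjoin_ring x \<Longrightarrow> g \<otimes> h \<in> adjoin_ring x" for g h using adjoin_ring_mult[OF x] .
  show "g \<in> adjoin_ring x \<Longrightarrow> h \<in> adjoin_ring x \<Longrightarrow> g \<oplus> h \<in> adjoin_ring x" for g h using submodD(3)[OF S] .
qed

lemma adjoin_ring_least:
  assumes "subring E R" "C \<subseteq> E" "x \<in> E" shows "adjoin_ring x \<subseteq> E"
proof -
  have xp: "x [^] k \<in> E" for k :: nat
    using assms by (induction k) (auto simp: subringE(3,6)[OF assms(1)])
  have "LP x n \<subseteq> E" for n
  proof (induction n)
    case 0
    then show ?case using subringE(2)[OF assms(1)] by simp
  next
    case (Suc n)
    have "a \<otimes> x [^] n \<oplus> f \<in> E" if "a \<in> C" "f \<in> LP x n" for a f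
      using subringE(6)[OF assms(1) _ xp[of n], of a] subringE(7)[OF assms(1), of "a \<otimes> x [^] n" f] that assms(2) Suc by blast
    then show ?case by auto
  qed
  then show ?thesis unfolding adjoin_ring_def by blast
qed

text \<open>The ideals of leading coefficients in degree \<open>n\<close> of the \<open>k\<close>-th ideal increase in both
  \<open>k\<close> and \<open>n\<close>, so the diagonal and finitely many columns control all of them.\<close>

lemma hilbert_basis:
  assumes acc: "acc R C" and x: "x \<in> carrier R"
  shows "acc R (adjoin_ring x)"
  unfolding acc_def
proof (intro allI impI, elim conjE)
  let ?E = "adjoin_ring x"
  fix J :: "nat \<Rightarrow> 'a set"
  assume J0: "\<forall>n. submod R ?E (J n) \<and> J n \<subseteq> ?E" and Jmono: "\<forall>n. J n \<subseteq> J (Suc n)"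
  have J: "submod R ?E (J n)" "J n \<subseteq> ?E" for n using J0 by auto
  have Jm: "i \<le> j \<Longrightarrow> J i \<subseteq> J j" for i j using Jmono lift_Suc_mono_le by blast
  interpret E: coefficient_ring R ?E
    by (intro coefficient_ring.intro coefficient_ring_axioms.intro adjoin_ring_subring x cring_axioms)
  have CE: "C \<subseteq> ?E" by (rule C_subset_adjoin_ring[OF x])
  \<comment> \<open>All coefficients of \<open>x^n\<close> in expressions of degree at most
    \<open>n\<close> for elements of \<open>J k\<close>, zero included. Different expressions of one
    element may contribute different coefficients.\<close>
  define L where "L k n = {a \<in> C. \<exists>f\<in>LP x n. a \<otimes> x [^] n \<oplus> f \<in> J k}" for k n
  have L1: "L k n \<subseteq> L (Suc k) n" for k n unfolding L_def using Jmono by blast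
  have L2: "L k n \<subseteq> L k (Suc n)" for k n
  proof
    fix a assume "a \<in> L k n"
    then obtain f where f: "a \<in> C" "f \<in> LP x n" "a \<otimes> x [^] n \<oplus> f \<in> J k" unfolding L_def by blast
    have c: "a \<in> carrier R" "f \<in> carrier R" using f C_carrier submodD(1)[OF LP_submod[OF x]] by auto
    have "x \<otimes> (a \<otimes> x [^] n \<oplus> f) = a \<otimes> x [^] Suc n \<oplus> x \<otimes> f"
      using c x by (simp add: r_distr m_ac)
    then have "a \<otimes> x [^] Suc n \<oplus> x \<otimes> f \<in> J k"
      using submodD(4)[OF J(1) adjoin_ring_self[OF x] f(3)] by simp
    then show "a \<in> L k (Suc n)" unfolding L_def using f(1) LP_mult_x[OF x f(2)] by blast
  qed
  have Lm: "L k n \<subseteq> L k' n'" if "k \<le> k'" "n \<le> n'" for k k' n n'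
  proof -
    have "L k n \<subseteq> L k' n" using lift_Suc_mono_le[of "\<lambda>k. L k n"] L1 that by blast
    also have "\<dots> \<subseteq> L k' n'" using lift_Suc_mono_le[of "L k'"] L2 that by blast
    finally show ?thesis .
  qed
  have Ls: "submod R C (L k n) \<and> L k n \<subseteq> C" for k n
  proof -
    have xn: "x [^] n \<in> carrier R" using x by simp
    note P = submodD[OF LP_submod[OF x]]
    have 0: "\<zero> \<otimes> x [^] n \<oplus> \<zero> \<in> J k" using submodD(2)[OF J(1)] xn by simp
    have 1: "a \<oplus> b \<in> L k n" if a: "a \<in> L k n" and b: "b \<in> L k n" for a b
    proof -
      obtain f where f: "a \<in> C" "f \<in> LP x n" "a \<otimes> x [^] n \<oplus> f \<in> J k" using a unfolding L_def by blast
      obtain g where g: "b \<in> C" "g \<in> LP x n" "b \<otimes> x [^] n \<oplus> g \<in> J k" using b unfolding L_def by blast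
      have "(a \<otimes> x [^] n \<oplus> f) \<oplus> (b \<otimes> x [^] n \<oplus> g) = (a \<oplus> b) \<otimes> x [^] n \<oplus> (f \<oplus> g)"
        using f g C_carrier P(1) xn by (simp add: l_distr a_ac)
      then have "(a \<oplus> b) \<otimes> x [^] n \<oplus> (f \<oplus> g) \<in> J k" using submodD(3)[OF J(1) f(3) g(3)] by simp
      then show ?thesis unfolding L_def using f g P(3) C_closed by blast
    qed
    have 2: "d \<otimes> a \<in> L k n" if a: "a \<in> L k n" and d: "d \<in> C" for a d
    proof -
      obtain f where f: "a \<in> C" "f \<in> LP x n" "a \<otimes> x [^] n \<oplus> f \<in> J k" using a unfolding L_def by blast
      have "d \<otimes> (a \<otimes> x [^] n \<oplus> f) = (d \<otimes> a) \<otimes> x [^] n \<oplus> (d \<otimes> f)"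
        using f d C_carrier P(1) xn by (simp add: r_distr m_assoc)
      then have "(d \<otimes> a) \<otimes> x [^] n \<oplus> (d \<otimes> f) \<in> J k" using submodD(4)[OF J(1) _ f(3), of d] d CE by auto
      then show ?thesis unfolding L_def using f d P(4) C_closed by blast
    qed
    have "\<zero> \<in> L k n" unfolding L_def using 0 P(2) C_closed(1) by blast
    then show ?thesis using 1 2 C_carrier unfolding submod_def by (auto simp: L_def)
  qed
  \<comment> \<open>The diagonal is an ascending chain of ideals of \<open>C\<close>. Once it is
    stable, \<open>L s s\<close> contains every \<open>L k n\<close> with
    \<open>n \<ge> s\<close>.\<close>
  have "\<exists>s. \<forall>n\<ge>s. L n n = L s s"
    using acc Ls Lm[of n "Suc n" n "Suc n" for n] unfolding acc_def by simp
  then obtain s where s: "\<And>n. n \<ge> s \<Longrightarrow> L n n = L s s" by blast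
  have "\<exists>r. \<forall>k\<ge>r. L k n = L r n" for n
    using acc Ls L1 unfolding acc_def by simp
  then obtain r where r: "\<And>n k. k \<ge> r n \<Longrightarrow> L k n = L (r n) n" by metis
  \<comment> \<open>Past the diagonal index, and past the stabilization of each of the finitely many
    columns \<open>n < s\<close>.\<close>
  define K where "K = Max (insert s (r ` {..<s}))"
  have K: "K \<ge> s" "\<And>n. n < s \<Longrightarrow> K \<ge> r n" unfolding K_def by auto
  have LK: "L k n = L K n" if "k \<ge> K" for k n
  proof (cases "n < s")
    case True
    then show ?thesis using r[of n k] r[of n K] K that by fastforce
  next
    case False
    have "L k n \<subseteq> L (max k n) (max k n)" by (rule Lm) auto
    also have "\<dots> = L s s" using s[of "max k n"] False by simp
    also have "\<dots> \<subseteq> L K n" using Lm[of s K s n] K False by simp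
    finally show ?thesis using Lm[of K k n n] that by blast
  qed
  \<comment> \<open>\<open>J k\<close> and \<open>J K\<close> have the same leading coefficients in
    every degree, so an element of \<open>J K\<close> cancels the top term of \<open>f\<close> and
    the degree goes down.\<close>
  have main: "f \<in> J K" if k: "k \<ge> K" and f: "f \<in> LP x n" "f \<in> J k" for k n f
    using f
  proof (induction n arbitrary: f)
    case 0
    then show ?case using submodD(2)[OF J(1)] by simp
  next
    case (Suc n)
    then obtain a g where ag: "a \<in> C" "g \<in> LP x n" "f = a \<otimes> x [^] n \<oplus> g" by auto
    then have "a \<in> L k n" unfolding L_def using Suc.prems by blast
    then have "a \<in> L K n" using LK[OF k] by simp
    then obtain h where h: "h \<in> LP x n" "a \<otimes> x [^] n \<oplus> h \<in> J K" unfolding L_def by blast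
    have c: "a \<in> carrier R" "g \<in> carrier R" "h \<in> carrier R" "x [^] n \<in> carrier R"
      using ag h x C_carrier submodD(1)[OF LP_submod[OF x]] by auto
    have e: "f \<ominus> (a \<otimes> x [^] n \<oplus> h) = g \<ominus> h"
      unfolding ag(3) using c by algebra
    have 1: "g \<ominus> h \<in> LP x n" using submod_minus[OF LP_submod[OF x]] ag h by blast
    have "f \<ominus> (a \<otimes> x [^] n \<oplus> h) \<in> J k" using E.submod_minus[OF J(1) Suc.prems(2)] h Jm[OF k] by blast
    then have "g \<ominus> h \<in> J K" using Suc.IH[OF 1] e by simp
    then have "(a \<otimes> x [^] n \<oplus> h) \<oplus> (g \<ominus> h) \<in> J K" using submodD(3)[OF J(1) h(2)] by blast
    moreover have "f = (a \<otimes> x [^] n \<oplus> h) \<oplus> (g \<ominus> h)" unfolding ag(3) using c by algebra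
    ultimately show ?case by simp
  qed
  have "J k = J K" if "k \<ge> K" for k
    using main[OF that] J(2)[of k] Jm[OF that] unfolding adjoin_ring_def by blast
  then show "\<exists>k. \<forall>n\<ge>k. J n = J k" by blast
qed

end

text \<open>The basis theorem is applied to one generator at a time. The last clause pins
  \<open>E\<close> down as \<open>C[F]\<close>, so that properties of its elements can be checked on
  generators.\<close>

lemma (in cring) finitely_generated_acc:
  assumes "finite F" "F \<subseteq> carrier R" "subring C R" "acc R C"
  shows "\<exists>E. subring E R \<and> C \<union> F \<subseteq> E \<and> acc R E \<and> (\<forall>E'. subring E' R \<longrightarrow> C \<union> F \<subseteq> E' \<longrightarrow> E \<subseteq> E')"
  using assms(1,2)
proof (induction F rule: finite_induct)
  case empty
  then show ?case using assms(3,4) by auto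
next
  case (insert x F)
  then obtain E where E: "subring E R" "C \<union> F \<subseteq> E" "acc R E"
    "\<forall>E'. subring E' R \<longrightarrow> C \<union> F \<subseteq> E' \<longrightarrow> E \<subseteq> E'" by auto
  interpret E: coefficient_ring R E
    by (intro coefficient_ring.intro coefficient_ring_axioms.intro E(1) cring_axioms)
  have x: "x \<in> carrier R" using insert by simp
  show ?case
  proof (intro exI[of _ "E.adjoin_ring x"] conjI allI impI)
    show "subring (E.adjoin_ring x) R" "acc R (E.adjoin_ring x)"
      using E.adjoin_ring_subring[OF x] E.hilbert_basis[OF E(3) x] .
    show "C \<union> insert x F \<subseteq> E.adjoin_ring x"
      using E.C_subset_adjoin_ring[OF x] E.adjoin_ring_self[OF x] E(2) by blast
    fix E' assume "subring E' R" "C \<union> insert x F \<subseteq> E'"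
    then show "E.adjoin_ring x \<subseteq> E'" using E(4) by (intro E.adjoin_ring_least) auto
  qed
qed

text \<open>The preimages in \<open>C\<close> of an ascending chain of ideals of the image ascend as
  well, and each ideal is the image of its preimage.\<close>

lemma acc_image:
  assumes "cring R" "cring W" "h \<in> ring_hom R W" "subring C R" "acc R C"
  shows "acc W (h ` C)"
  unfolding acc_def
proof (intro allI impI, elim conjE)
  interpret R: cring R by fact
  interpret W: cring W by fact
  fix J :: "nat \<Rightarrow> _" assume J: "\<forall>n. submod W (h ` C) (J n) \<and> J n \<subseteq> h ` C" "\<forall>n. J n \<subseteq> J (Suc n)"
  have Cc: "c \<in> carrier R" if "c \<in> C" for c using subringE(1)[OF assms(4)] that by blast
  have h0: "h \<zero>\<^bsub>R\<^esub> = \<zero>\<^bsub>W\<^esub>" using ring_hom_zero[OF assms(3)] R.ring_axioms W.ring_axioms by blast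
  define L where "L n = {c \<in> C. h c \<in> J n}" for n
  have Js: "submod W (h ` C) (J n)" for n using J by blast
  have "submod R C (L n) \<and> L n \<subseteq> C" for n
    using submodD[OF Js[of n]] subringE[OF assms(4)] Cc
    unfolding submod_def L_def
    by (auto simp: h0 ring_hom_mult[OF assms(3)] ring_hom_add[OF assms(3)])
  moreover have "L n \<subseteq> L (Suc n)" for n using J(2) unfolding L_def by blast
  ultimately obtain k where k: "\<forall>n\<ge>k. L n = L k" using assms(5) unfolding acc_def by metis
  have "J n = h ` L n" for n using J(1) unfolding L_def by blast
  then have "\<forall>n\<ge>k. J n = J k" using k by metis
  then show "\<exists>k. \<forall>n\<ge>k. J n = J k" by blast
qed

lemma (in abelian_monoid) finsum_mem:
  assumes "finite A" "\<And>i. i \<in> A \<Longrightarrow> f i \<in> S" "S \<subseteq> carrier G" "\<zero> \<in> S" "\<And>x y. x \<in> S \<Longrightarrow> y \<in> S \<Longrightarrow> x \<oplus> y \<in> S"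
  shows "finsum G f A \<in> S"
  using assms(1,2)
proof (induction A rule: finite_induct)
  case (insert a A)
  then have "finsum G f (insert a A) = f a \<oplus> finsum G f A"
    using assms(3) by (intro finsum_insert) auto
  then show ?case using insert assms(5) by simp
qed (simp add: assms(4))

section \<open>The Artin-Rees lemma through the Rees algebra of a finitely generated algebra\<close>

context UP_cring
begin

abbreviation mon :: "'a \<Rightarrow> nat \<Rightarrow> nat \<Rightarrow> 'a" where "mon \<equiv> up_ring.monom P"
abbreviation cf :: "(nat \<Rightarrow> 'a) \<Rightarrow> nat \<Rightarrow> 'a" where "cf \<equiv> up_ring.coeff P"
abbreviation cst :: "'a \<Rightarrow> nat \<Rightarrow> 'a" where "cst \<equiv> \<lambda>a. up_ring.monom P a 0"

text \<open>\<open>n j\<close> is the degree-\<open>j\<close> part of the Rees ring of the ideal generated by \<open>I\<close> in the algebra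
  \<open>n 0\<close> generated by \<open>F\<close> and \<open>I\<close>. The Rees ring is Noetherian, so its ideals \<open>H c\<close> of polynomials with
  \<open>k\<close>-th coefficient in \<open>z n\<^sub>k\<^sub>-\<^sub>c + Q\<close> stabilize. Truncated subtraction in \<open>k - c\<close> is intended.\<close>

lemma artin_rees_filtration:
  assumes C: "subring C R" and acc: "acc R C" and F: "finite F" "F \<subseteq> carrier R" and I: "finite I" "I \<subseteq> carrier R"
  obtains n :: "nat \<Rightarrow> 'a set" where
    "subring (n 0) R" "C \<subseteq> n 0" "F \<subseteq> n 0" "I \<subseteq> n 1"
    "\<And>j. submod R (n 0) (n j)"
    "\<And>i j a b. a \<in> n i \<Longrightarrow> b \<in> n j \<Longrightarrow> a \<otimes> b \<in> n (i + j)"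
    "\<And>B S j. subring B R \<Longrightarrow> C \<union> F \<union> I \<subseteq> B \<Longrightarrow> submod R B S \<Longrightarrow> S \<subseteq> B \<Longrightarrow> I \<subseteq> S \<Longrightarrow>
      n 0 \<subseteq> B \<and> n (Suc j) \<subseteq> S"
    "\<And>z Q. z \<in> n 0 \<Longrightarrow> submod R (n 0) Q \<Longrightarrow> Q \<subseteq> n 0 \<Longrightarrow> (\<And>a. a \<in> n 0 \<Longrightarrow> z \<otimes> a \<in> Q \<Longrightarrow> a \<in> Q) \<Longrightarrow>
      \<exists>c. \<forall>k a b q. a \<in> n 0 \<longrightarrow> b \<in> n k \<longrightarrow> q \<in> Q \<longrightarrow> z \<otimes> a = b \<oplus> q \<longrightarrow>
        (\<exists>b'\<in>n (k - c). \<exists>q'\<in>Q. a = b' \<oplus> q')"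
proof -
  let ?G = "cst ` F \<union> cst ` I \<union> (\<lambda>a. mon a 1) ` I"
  have Cc: "\<And>c. c \<in> C \<Longrightarrow> c \<in> carrier R" using subringE(1)[OF C] by blast
  have G: "finite ?G" "?G \<subseteq> carrier P" using F I by auto
  interpret const: ring_hom_ring R P cst
    using const_ring_hom by (intro ring_hom_ringI2) unfold_locales
  have subC: "subring (cst ` C) P" by (rule const.img_is_subring[OF C])
  have accC: "acc P (cst ` C)"
    by (rule acc_image[OF R.is_cring UP_cring const_ring_hom C acc])
  obtain E where E: "subring E P" "cst ` C \<union> ?G \<subseteq> E" "acc P E"
    and Emin: "\<And>E'. subring E' P \<Longrightarrow> cst ` C \<union> ?G \<subseteq> E' \<Longrightarrow> E \<subseteq> E'"
  proof -
    from P.finitely_generated_acc[OF G subC accC] obtain E where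
      "subring E P \<and> cst ` C \<union> ?G \<subseteq> E \<and> acc P E \<and>
        (\<forall>E'. subring E' P \<longrightarrow> cst ` C \<union> ?G \<subseteq> E' \<longrightarrow> E \<subseteq> E')" ..
    then show thesis by (intro that[of E]) simp_all
  qed
  note Ec = subringE[OF E(1)]
  interpret EE: coefficient_ring P E
    by (intro coefficient_ring.intro coefficient_ring_axioms.intro E(1) UP_cring)
  define n where "n j = {a \<in> carrier R. mon a j \<in> E}" for j
  have nc: "a \<in> n j \<Longrightarrow> a \<in> carrier R" for a j unfolding n_def by simp
  have nE: "a \<in> n j \<Longrightarrow> mon a j \<in> E" for a j unfolding n_def by simp
  have n0: "\<zero> \<in> n j" for j unfolding n_def using Ec(2) by simp
  have nadd: "a \<in> n j \<Longrightarrow> b \<in> n j \<Longrightarrow> a \<oplus> b \<in> n j" for a b j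
    unfolding n_def using Ec(7) by simp
  have nneg: "a \<in> n j \<Longrightarrow> \<ominus> a \<in> n j" for a j
    unfolding n_def using Ec(5)[of "mon a j"] by simp
  have nmult: "a \<otimes> b \<in> n (i + j)" if "a \<in> n i" "b \<in> n j" for a b i j
    using that Ec(6)[of "mon a i" "mon b j"] monom_mult[of a b i j] unfolding n_def by simp
  have nsub: "submod R (n 0) (n j)" for j
    unfolding submod_def using nc n0 nadd nmult[of _ 0 _ j] by auto
  have n1: "\<one> \<in> n 0" unfolding n_def using Ec(3) monom_one by simp
  have subn: "subring (n 0) R"
  proof (rule R.subringI)
    show "n 0 \<subseteq> carrier R" "\<one> \<in> n 0" using nc n1 by auto
    show "g \<otimes> h \<in> n 0" if "g \<in> n 0" "h \<in> n 0" for g h using nmult[OF that] by simp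
  qed (use nadd nneg in auto)
  have CF: "C \<subseteq> n 0" "F \<subseteq> n 0" "I \<subseteq> n 0" "I \<subseteq> n 1"
    unfolding n_def using E(2) Cc F(2) I(2) by blast+
  \<comment> \<open>Two facts in one: homogeneous components of elements of \<open>E\<close> belong
    to \<open>E\<close> (\<open>i = j\<close>), and \<open>n\<close> is decreasing
    (\<open>i < j\<close>). Both are tested on generators; for \<open>a t\<close> with
    \<open>a \<in> I\<close> the test needs \<open>a \<in> n 0\<close>, which holds because the
    constants of \<open>I\<close> are generators too.\<close>
  have deg: "cf p j \<in> n i" if "p \<in> E" "i \<le> j" for p i j
  proof -
    define S where "S = {p \<in> carrier P. \<forall>j. \<forall>i\<le>j. cf p j \<in> n i}"
    have "subring S P"
    proof (rule P.subringI)
      show "S \<subseteq> carrier P" unfolding S_def by blast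
      show "\<one>\<^bsub>P\<^esub> \<in> S" unfolding S_def using n0 n1 by simp
      show "\<ominus>\<^bsub>P\<^esub> h \<in> S" if "h \<in> S" for h using that nneg unfolding S_def by simp
      fix g h assume "g \<in> S" "h \<in> S"
      then have gh: "g \<in> carrier P" "h \<in> carrier P" "\<And>i j. i \<le> j \<Longrightarrow> cf g j \<in> n i" "\<And>i j. i \<le> j \<Longrightarrow> cf h j \<in> n i"
        unfolding S_def by auto
      show "g \<oplus>\<^bsub>P\<^esub> h \<in> S" unfolding S_def using gh nadd by simp
      have "(\<Oplus>a\<in>{..j}. cf g a \<otimes> cf h (j - a)) \<in> n i" if "i \<le> j" for i j
      proof (rule R.finsum_mem)
        fix a assume "a \<in> {..j}"
        \<comment> \<open>The degree \<open>i\<close> is split into \<open>min i a\<close> and a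
          remainder, which is at most \<open>j - a\<close>.\<close>
        then have "cf g a \<in> n (min i a)" "cf h (j - a) \<in> n (i - min i a)"
          using gh(3,4) that by auto
        then show "cf g a \<otimes> cf h (j - a) \<in> n i" using nmult by fastforce
      qed (use nc n0 nadd in auto)
      then show "g \<otimes>\<^bsub>P\<^esub> h \<in> S" unfolding S_def using gh by simp
    qed
    moreover have "cst ` C \<union> ?G \<subseteq> S"
    proof -
      have "mon a 0 \<in> S" if "a \<in> n 0" for a
        unfolding S_def using that nc n0 by auto
      moreover have "mon a 1 \<in> S" if "a \<in> n 0" "a \<in> n 1" for a
      proof -
        have "i \<le> 1 \<Longrightarrow> a \<in> n i" for i using that by (cases i) auto
        moreover have "a \<in> carrier R" using nc[OF that(1)] .
        ultimately show ?thesis unfolding S_def using n0 by auto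
      qed
      ultimately show ?thesis using CF by blast
    qed
    ultimately have "E \<subseteq> S" by (rule Emin)
    then show ?thesis using that unfolding S_def by blast
  qed
  have least: "n 0 \<subseteq> B \<and> n (Suc j) \<subseteq> S"
    if B: "subring B R" and CB: "C \<union> F \<union> I \<subseteq> B" and S: "submod R B S" "S \<subseteq> B" "I \<subseteq> S" for B S j
  proof -
    note Bc = subringE[OF B] and Sc = submodD[OF S(1)]
    interpret B: coefficient_ring R B
      by (intro coefficient_ring.intro coefficient_ring_axioms.intro B R.is_cring)
    \<comment> \<open>Polynomials with constant term in \<open>B\<close> and all other coefficients
      in the \<open>B\<close>-module \<open>S\<close> form a ring that contains the generators,
      hence \<open>E\<close>.\<close>
    define T where "T = {p \<in> carrier P. cf p 0 \<in> B \<and> (\<forall>j. cf p (Suc j) \<in> S)}"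
    have "subring T P"
    proof (rule P.subringI)
      show "T \<subseteq> carrier P" unfolding T_def by blast
      show "\<one>\<^bsub>P\<^esub> \<in> T" unfolding T_def using Bc(3) Sc(2) by simp
      show "\<ominus>\<^bsub>P\<^esub> h \<in> T" if "h \<in> T" for h using that Bc(5) B.submod_uminus[OF S(1)] unfolding T_def by simp
      fix g h assume "g \<in> T" "h \<in> T"
      then have gh: "g \<in> carrier P" "h \<in> carrier P" "cf g 0 \<in> B" "cf h 0 \<in> B"
         "\<And>j. cf g (Suc j) \<in> S" "\<And>j. cf h (Suc j) \<in> S"
        unfolding T_def by auto
      show "g \<oplus>\<^bsub>P\<^esub> h \<in> T" unfolding T_def using gh Bc(7) Sc(3) by simp
      have gB: "cf g j \<in> B" "cf h j \<in> B" for j using gh S(2) by (cases j, auto)+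
      have "(\<Oplus>a\<in>{..Suc j}. cf g a \<otimes> cf h (Suc j - a)) \<in> S" for j
      proof (rule R.finsum_mem)
        fix a assume "a \<in> {..Suc j}"
        show "cf g a \<otimes> cf h (Suc j - a) \<in> S"
        proof (cases a)
          case 0
          then show ?thesis using Sc(4)[OF gB(1) gh(6)] by simp
        next
          case (Suc b)
          have "cf h (Suc j - a) \<otimes> cf g a \<in> S" using Sc(4)[OF gB(2) gh(5)] Suc by simp
          then show ?thesis using R.m_comm gh(1,2) by simp
        qed
      qed (use Sc in auto)
      then show "g \<otimes>\<^bsub>P\<^esub> h \<in> T" unfolding T_def using gh Bc(6) by simp
    qed
    moreover have "cst ` C \<union> ?G \<subseteq> T"
    proof -
      have "mon a 0 \<in> T" if "a \<in> B" for a
        unfolding T_def using that Bc(1) Sc(2) by auto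
      moreover have "mon a 1 \<in> T" if "a \<in> S" for a
        unfolding T_def using that Sc(1,2) Bc(2) by auto
      ultimately show ?thesis using CB S(3) by blast
    qed
    ultimately have ET: "E \<subseteq> T" by (rule Emin)
    have "a \<in> B" if "a \<in> n 0" for a
      using ET nE[OF that] nc[OF that] unfolding T_def by auto
    moreover have "a \<in> S" if "a \<in> n (Suc j)" for a
    proof -
      have "mon a (Suc j) \<in> T" using ET nE[OF that] by blast
      then have "cf (mon a (Suc j)) (Suc j) \<in> S" unfolding T_def by blast
      then show ?thesis using nc[OF that] by simp
    qed
    ultimately show ?thesis by blast
  qed
  have ndec: "n j \<subseteq> n i" if "i \<le> j" for i j
    using deg[OF nE that] nc by fastforce
  have AR: "\<exists>c. \<forall>k a b q. a \<in> n 0 \<longrightarrow> b \<in> n k \<longrightarrow> q \<in> Q \<longrightarrow> z \<otimes> a = b \<oplus> q \<longrightarrow>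
        (\<exists>b'\<in>n (k - c). \<exists>q'\<in>Q. a = b' \<oplus> q')"
    if z: "z \<in> n 0" and Q: "submod R (n 0) Q" "Q \<subseteq> n 0" and Qz: "\<And>a. a \<in> n 0 \<Longrightarrow> z \<otimes> a \<in> Q \<Longrightarrow> a \<in> Q" for z Q
  proof -
    interpret N: coefficient_ring R "n 0"
      by (intro coefficient_ring.intro coefficient_ring_axioms.intro subn R.is_cring)
    note Qc = submodD[OF Q(1)]
    have zc: "z \<in> carrier R" using nc[OF z] .
    define K where "K j = {z \<otimes> b \<oplus> q | b q. b \<in> n j \<and> q \<in> Q}" for j
    have KI: "z \<otimes> b \<oplus> q \<in> K j" if "b \<in> n j" "q \<in> Q" for b q j using that unfolding K_def by blast
    have Kc: "K j \<subseteq> carrier R" for j unfolding K_def using zc nc Qc(1) by auto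
    have K0: "\<zero> \<in> K j" for j using KI[OF n0 Qc(2)] zc by simp
    have Kadd: "x \<oplus> y \<in> K j" if xy: "x \<in> K j" "y \<in> K j" for x y j
    proof -
      obtain b q where e1: "x = z \<otimes> b \<oplus> q" "b \<in> n j" "q \<in> Q"
        using xy(1) unfolding K_def by blast
      obtain b' q' where e2: "y = z \<otimes> b' \<oplus> q'" "b' \<in> n j" "q' \<in> Q"
        using xy(2) unfolding K_def by blast
      note e = e1 e2
      have "x \<oplus> y = z \<otimes> (b \<oplus> b') \<oplus> (q \<oplus> q')"
        unfolding e(1,4) using e nc Qc(1) zc by (simp add: R.r_distr R.a_ac)
      then show ?thesis using KI[OF nadd[OF e(2,5)] Qc(3)[OF e(3,6)]] by simp
    qed
    have Kmult: "x \<otimes> y \<in> K (i + j)" if xy: "x \<in> n i" "y \<in> K j" for x y i j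
    proof -
      obtain b q where e: "y = z \<otimes> b \<oplus> q" "b \<in> n j" "q \<in> Q"
        using xy(2) unfolding K_def by blast
      have "x \<otimes> y = z \<otimes> (x \<otimes> b) \<oplus> (x \<otimes> q)"
        unfolding e(1) using e nc xy Qc(1) zc by (simp add: R.r_distr R.m_lcomm)
      moreover have "x \<otimes> q \<in> Q" using Qc(4)[OF _ e(3)] ndec[of 0 i] xy(1) by blast
      ultimately show ?thesis using KI[OF nmult[OF xy(1) e(2)]] by simp
    qed
    have KNAT: "k - c \<le> a + ((k - a) - c)" for k a c :: nat by arith
    have Kdec: "K j \<subseteq> K i" if "i \<le> j" for i j unfolding K_def using ndec[OF that] by blast
    define H where "H c = {p \<in> E. \<forall>k. cf p k \<in> K (k - c)}" for c
    have Hs: "submod P E (H c) \<and> H c \<subseteq> E" for c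
    proof -
      have "e \<otimes>\<^bsub>P\<^esub> p \<in> H c" if e: "e \<in> E" and p: "p \<in> H c" for e p
      proof -
        have pc: "p \<in> E" "e \<in> carrier P" "p \<in> carrier P" using e p Ec(1) unfolding H_def by auto
        have pK: "cf p k \<in> K (k - c)" for k using p unfolding H_def by blast
        have "(\<Oplus>a\<in>{..k}. cf e a \<otimes> cf p (k - a)) \<in> K (k - c)" for k
        proof (rule R.finsum_mem)
          fix a assume "a \<in> {..k}"
          have "cf e a \<otimes> cf p (k - a) \<in> K (a + ((k - a) - c))"
            by (rule Kmult[OF deg[OF e order_refl] pK])
          then show "cf e a \<otimes> cf p (k - a) \<in> K (k - c)"
            using Kdec[of "k - c" "a + ((k - a) - c)"] \<open>a \<in> {..k}\<close> KNAT by blast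
        qed (use Kc K0 Kadd in auto)
        then show ?thesis unfolding H_def using Ec(6)[OF e pc(1)] pc by simp
      qed
      moreover have "p \<oplus>\<^bsub>P\<^esub> p' \<in> H c" if "p \<in> H c" "p' \<in> H c" for p p'
      proof -
        have "p \<in> carrier P" "p' \<in> carrier P" using that Ec(1) unfolding H_def by auto
        then show ?thesis using that Kadd Ec(7) unfolding H_def by simp
      qed
      moreover have "\<zero>\<^bsub>P\<^esub> \<in> H c" unfolding H_def using Ec(2) K0 by simp
      ultimately show ?thesis using Ec(1) unfolding submod_def by (auto simp: H_def)
    qed
    have Hmono: "H c \<subseteq> H (Suc c)" for c
      unfolding H_def using Kdec[of "k - Suc c" "k - c" for k] by (auto simp: subset_iff)
    have "\<exists>c. \<forall>d\<ge>c. H d = H c"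
      using E(3)[unfolded acc_def, THEN spec[of _ H]] Hs Hmono by (intro mp[of _ "\<exists>c. \<forall>d\<ge>c. H d = H c"]) simp_all
    then obtain c where c: "\<And>d. d \<ge> c \<Longrightarrow> H d = H c" by blast
    have "\<exists>b'\<in>n (k - c). \<exists>q'\<in>Q. a = b' \<oplus> q'"
      if a: "a \<in> n 0" and b: "b \<in> n k" and q: "q \<in> Q" and e: "z \<otimes> a = b \<oplus> q" for k a b q
    proof -
      have cc: "a \<in> carrier R" "b \<in> carrier R" "q \<in> carrier R" using nc[OF a] nc[OF b] Qc(1)[OF q] by auto
      have "b = z \<otimes> a \<oplus> \<ominus> q" unfolding e using cc by (simp add: R.a_assoc R.r_neg)
      then have "b \<in> K 0" using KI[OF a N.submod_uminus[OF Q(1) q]] by simp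
      \<comment> \<open>At an index of at least \<open>k\<close>, the condition in degree
        \<open>k\<close> is only \<open>b \<in> K 0\<close>. Stability brings the index down to
        \<open>c\<close>, which is the constant sought.\<close>
      then have "mon b k \<in> H (max k c)" unfolding H_def using nE[OF b] cc K0 by auto
      then have "mon b k \<in> H c" using c[of "max k c"] by simp
      then have "cf (mon b k) k \<in> K (k - c)" unfolding H_def by blast
      then obtain b' q' where b': "b = z \<otimes> b' \<oplus> q'" "b' \<in> n (k - c)" "q' \<in> Q" using cc unfolding K_def by auto
      have cc': "b' \<in> carrier R" "q' \<in> carrier R" using nc[OF b'(2)] Qc(1)[OF b'(3)] by auto
      have b'0: "b' \<in> n 0" using ndec[of 0 "k - c"] b'(2) by auto
      have "z \<otimes> (a \<ominus> b') = (z \<otimes> a) \<ominus> (z \<otimes> b')"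
        using cc cc' zc by (simp add: a_minus_def R.r_distr R.r_minus)
      also have "\<dots> = q' \<oplus> q" unfolding e b'(1) using cc cc' zc
        by (simp add: a_minus_def R.a_ac R.r_neg2 R.r_neg)
      finally have "z \<otimes> (a \<ominus> b') \<in> Q" using Qc(3)[OF b'(3) q] by simp
      then have "a \<ominus> b' \<in> Q" using Qz N.submod_minus[OF nsub a b'0] by blast
      moreover have "a = b' \<oplus> (a \<ominus> b')" using cc cc' by (simp add: a_minus_def R.a_lcomm R.r_neg)
      ultimately show ?thesis using b'(2) by blast
    qed
    then show ?thesis by blast
  qed
  show thesis by (rule that[OF subn CF(1,2,4) nsub nmult least AR])
qed

end

section \<open>Monomials along a chain of primes\<close>

text \<open>The sum of \<open>S i y^i\<close> over \<open>i < N\<close>, nested so that the constant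
  term splits off modulo a prime containing \<open>y\<close>.\<close>

primrec horner :: "('a, 'm) ring_scheme \<Rightarrow> 'a \<Rightarrow> nat \<Rightarrow> (nat \<Rightarrow> 'a) \<Rightarrow> 'a" where
  "horner R y 0 S = \<zero>\<^bsub>R\<^esub>"
| "horner R y (Suc N) S = S 0 \<oplus>\<^bsub>R\<^esub> y \<otimes>\<^bsub>R\<^esub> horner R y N (\<lambda>i. S (Suc i))"

text \<open>The value at \<open>ys\<close> of the polynomial with all exponents \<open>< N\<close>, where \<open>u i\<close> is the coefficient
  of the monomial whose exponents are the base-\<open>N\<close> digits of \<open>i\<close>.\<close>

primrec box_eval :: "('a, 'm) ring_scheme \<Rightarrow> nat \<Rightarrow> 'a list \<Rightarrow> (nat \<Rightarrow> 'a) \<Rightarrow> 'a" where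
  "box_eval R N [] u = u 0"
| "box_eval R N (y # ys) u = horner R y N (\<lambda>a. box_eval R N ys (\<lambda>b. u (a + N * b)))"

text \<open>Prime ideals of the subring \<open>B\<close>, expressed in the ambient ring, so that the
  Rees ring and \<open>R[t]\<close> share one set of operations.\<close>

definition prime_in :: "('a, 'm) ring_scheme \<Rightarrow> 'a set \<Rightarrow> 'a set \<Rightarrow> bool" where
  "prime_in R B P \<longleftrightarrow> submod R B P \<and> P \<subseteq> B \<and> \<one>\<^bsub>R\<^esub> \<notin> P \<and>
     (\<forall>a\<in>B. \<forall>b\<in>B. a \<otimes>\<^bsub>R\<^esub> b \<in> P \<longrightarrow> a \<in> P \<or> b \<in> P)"

context cring
begin

lemma horner_closed: "y \<in> carrier R \<Longrightarrow> (\<And>i. S i \<in> carrier R) \<Longrightarrow> horner R y N S \<in> carrier R"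
  by (induction N arbitrary: S) auto

lemma box_eval_closed: "set ys \<subseteq> carrier R \<Longrightarrow> (\<And>i. u i \<in> carrier R) \<Longrightarrow> box_eval R N ys u \<in> carrier R"
  by (induction ys arbitrary: u) (auto intro: horner_closed)

lemma horner_add:
  assumes y: "y \<in> carrier R"
  shows "(\<And>i. S i \<in> carrier R) \<Longrightarrow> (\<And>i. T i \<in> carrier R) \<Longrightarrow>
    horner R y N (\<lambda>i. S i \<oplus> T i) = horner R y N S \<oplus> horner R y N T"
proof (induction N arbitrary: S T)
  case (Suc N)
  have c: "horner R y N (\<lambda>i. S (Suc i)) \<in> carrier R" "horner R y N (\<lambda>i. T (Suc i)) \<in> carrier R"
    using horner_closed[OF y] Suc.prems by auto
  show ?case using Suc.IH[of "\<lambda>i. S (Suc i)" "\<lambda>i. T (Suc i)"] Suc.prems y c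
    by (simp add: r_distr a_ac)
qed simp

lemma horner_smult:
  assumes y: "y \<in> carrier R" and c: "c \<in> carrier R"
  shows "(\<And>i. S i \<in> carrier R) \<Longrightarrow> horner R y N (\<lambda>i. c \<otimes> S i) = c \<otimes> horner R y N S"
proof (induction N arbitrary: S)
  case (Suc N)
  have "horner R y N (\<lambda>i. S (Suc i)) \<in> carrier R"
    using horner_closed[OF y] Suc.prems by auto
  then show ?case using Suc.IH[of "\<lambda>i. S (Suc i)"] Suc.prems y c
    by (simp add: r_distr m_lcomm)
qed (use c in simp)

lemma box_eval_add:
  assumes "set ys \<subseteq> carrier R"
  shows "(\<And>i. u i \<in> carrier R) \<Longrightarrow> (\<And>i. v i \<in> carrier R) \<Longrightarrow>
    box_eval R N ys (\<lambda>i. u i \<oplus> v i) = box_eval R N ys u \<oplus> box_eval R N ys v"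
  using assms
proof (induction ys arbitrary: u v)
  case (Cons y ys)
  then show ?case by (simp add: horner_add box_eval_closed)
qed simp

lemma box_eval_smult:
  assumes "set ys \<subseteq> carrier R" "c \<in> carrier R"
  shows "(\<And>i. u i \<in> carrier R) \<Longrightarrow> box_eval R N ys (\<lambda>i. c \<otimes> u i) = c \<otimes> box_eval R N ys u"
  using assms
proof (induction ys arbitrary: u)
  case (Cons y ys)
  then show ?case by (simp add: horner_smult box_eval_closed)
qed simp

lemma horner_mem:
  assumes "submod R B S" "y \<in> B" "\<And>i. T i \<in> S"
  shows "horner R y N T \<in> S"
  using assms(3) by (induction N arbitrary: T) (simp_all add: submodD[OF assms(1)] assms(2))

lemma box_eval_mem:
  assumes "submod R B S" "set ys \<subseteq> B" "\<And>i. u i \<in> S"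
  shows "box_eval R N ys u \<in> S"
  using assms(2,3)
proof (induction ys arbitrary: u)
  case (Cons y ys)
  have "box_eval R N ys (\<lambda>b. u (a + N * b)) \<in> S" for a
    using Cons.prems by (intro Cons.IH) auto
  then show ?case unfolding box_eval.simps using Cons.prems(1) by (intro horner_mem[OF assms(1)]) auto
qed simp

lemma box_eval_cong:
  "(\<And>i. i < N ^ length ys \<Longrightarrow> u i = v i) \<Longrightarrow> box_eval R N ys u = box_eval R N ys v"
proof (induction ys arbitrary: u v)
  case (Cons y ys)
  have *: "horner R y n S = horner R y n T" if "\<And>i. i < n \<Longrightarrow> S i = T i" for n S T
    using that
  proof (induction n arbitrary: S T)
    case (Suc n)
    then have "horner R y n (\<lambda>i. S (Suc i)) = horner R y n (\<lambda>i. T (Suc i))" by (intro Suc.IH) simp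
    then show ?case using Suc.prems[of 0] by simp
  qed simp
  show ?case unfolding box_eval.simps
  proof (rule *, rule Cons.IH, rule Cons.prems)
    fix a b assume "a < N" "b < N ^ length ys"
    then have "a + N * b < N + N * b" by simp
    also have "\<dots> = N * Suc b" by simp
    also have "\<dots> \<le> N * N ^ length ys" using \<open>b < N ^ length ys\<close> by (intro mult_le_mono2) simp
    finally show "a + N * b < N ^ length (y # ys)" by simp
  qed
qed simp

end

lemma prime_inD:
  assumes "prime_in R B P"
  shows "submod R B P" "P \<subseteq> B" "\<one>\<^bsub>R\<^esub> \<notin> P"
    "a \<in> B \<Longrightarrow> b \<in> B \<Longrightarrow> a \<otimes>\<^bsub>R\<^esub> b \<in> P \<Longrightarrow> a \<in> P \<or> b \<in> P"
  using assms unfolding prime_in_def by auto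

text \<open>Modulo \<open>P'\<close> the value reduces to \<open>S 0\<close>, so \<open>S 0\<close>
  lies in \<open>P'\<close> and by assumption in \<open>P\<close>. What remains is \<open>y\<close>
  times a shorter sum, and \<open>y \<notin> P\<close> cancels.\<close>

lemma (in coefficient_ring) horner_in_prime:
  assumes P: "prime_in R C P" and P': "prime_in R C P'" "P \<subseteq> P'"
    and y: "y \<in> C" "y \<notin> P" "y \<in> P'"
  shows "(\<And>a. S a \<in> C) \<Longrightarrow> (\<And>a. a < N \<Longrightarrow> S a \<in> P' \<Longrightarrow> S a \<in> P) \<Longrightarrow> horner R y N S \<in> P \<Longrightarrow> a < N \<Longrightarrow> S a \<in> P"
proof (induction N arbitrary: S a)
  case (Suc N)
  let ?h = "horner R y N (\<lambda>i. S (Suc i))"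
  have hC: "?h \<in> C" by (rule horner_mem[OF submod_C y(1) Suc.prems(1)])
  have c: "S 0 \<in> carrier R" "?h \<in> carrier R" "y \<in> carrier R" using hC Suc.prems(1) C_carrier y by auto
  have yh: "y \<otimes> ?h \<in> P'" using submodD(4)[OF prime_inD(1)[OF P'(1)] hC y(3)] c by (simp add: m_comm)
  have "y \<otimes> ?h \<oplus> S 0 \<in> P'" using Suc.prems(3) P'(2) c by (auto simp: a_comm)
  then have "S 0 \<in> P'" using submod_add_cancel[OF prime_inD(1)[OF P'(1)] yh c(1)] by simp
  then have S0: "S 0 \<in> P" using Suc.prems(2) by simp
  have "S 0 \<oplus> y \<otimes> ?h \<in> P" using Suc.prems(3) by simp
  then have "y \<otimes> ?h \<in> P" using submod_add_cancel[OF prime_inD(1)[OF P] S0] c by simp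
  then have h: "?h \<in> P" using prime_inD(4)[OF P y(1) hC] y(2) by blast
  show ?case
  proof (cases a)
    case 0
    then show ?thesis using S0 by simp
  next
    case (Suc b)
    then show ?thesis using Suc.IH[of "\<lambda>i. S (Suc i)" b] Suc.prems(1,2,4) h by simp
  qed
qed simp

text \<open>The elements \<open>y\<^sub>1, \<dots>, y\<^sub>e\<close> picked along a chain of primes containing \<open>M\<close> are algebraically
  independent over \<open>C/M\<close>: look at the lexicographically smallest monomial with coefficient outside \<open>M\<close>.\<close>

lemma (in coefficient_ring) box_eval_in_prime:
  assumes "D \<subseteq> C" "M \<subseteq> D" "submod R D M"
    and "\<And>i. i \<le> length ys \<Longrightarrow> prime_in R C (P i)" "\<And>i. i \<le> length ys \<Longrightarrow> P i \<inter> D \<subseteq> M"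
    and "M \<subseteq> P 0" "\<And>i. i < length ys \<Longrightarrow> P i \<subseteq> P (Suc i) \<and> ys ! i \<in> P (Suc i) - P i"
    and "\<And>i. u i \<in> D" "box_eval R N ys u \<in> P 0" "i < N ^ length ys"
  shows "u i \<in> M"
  using assms(4-)
proof (induction ys arbitrary: P u i)
  case Nil
  then show ?case by auto
next
  case (Cons y ys)
  let ?S = "\<lambda>a. box_eval R N ys (\<lambda>b. u (a + N * b))"
  have P0: "prime_in R C (P 0)" "prime_in R C (P 1)" "P 0 \<subseteq> P 1" "y \<in> P 1" "y \<notin> P 0"
    using Cons.prems(1)[of 0] Cons.prems(1)[of 1] Cons.prems(4)[of 0] by auto
  have yC: "y \<in> C" using P0 prime_inD(2) by blast
  have ysC: "set ys \<subseteq> C"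
  proof
    fix x assume "x \<in> set ys"
    then obtain i where "i < length ys" "x = ys ! i" by (auto simp: in_set_conv_nth)
    then show "x \<in> C" using Cons.prems(4)[of "Suc i"] prime_inD(2)[OF Cons.prems(1)[of "Suc (Suc i)"]] by auto
  qed
  have SC: "?S a \<in> C" for a
    by (rule box_eval_mem[OF submod_C ysC subsetD[OF assms(1) Cons.prems(5)]])
  \<comment> \<open>The induction hypothesis is applied to the chain of primes shifted by one, which
    starts at \<open>P 1\<close>.\<close>
  have coeffs: "u (a + N * b) \<in> M" if "?S a \<in> P 1" "b < N ^ length ys" for a b
  proof (rule Cons.IH[of "\<lambda>i. P (Suc i)" "\<lambda>b. u (a + N * b)" b])
    show "prime_in R C (P (Suc i))" "P (Suc i) \<inter> D \<subseteq> M" if "i \<le> length ys" for i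
      using Cons.prems(1)[of "Suc i"] Cons.prems(2)[of "Suc i"] that by auto
    show "M \<subseteq> P (Suc 0)" using Cons.prems(3) P0(3) by auto
    show "P (Suc i) \<subseteq> P (Suc (Suc i)) \<and> ys ! i \<in> P (Suc (Suc i)) - P (Suc i)" if "i < length ys" for i
      using Cons.prems(4)[of "Suc i"] that by auto
    show "u (a + N * b) \<in> D" for b using Cons.prems(5) .
    show "?S a \<in> P (Suc 0)" using that(1) by simp
    show "b < N ^ length ys" using that(2) .
  qed
  \<comment> \<open>An inner value in \<open>P 1\<close> has its coefficients in \<open>M\<close>,
    hence lies already in \<open>P 0\<close>. This is the condition that
    \<open>horner_in_prime\<close> asks for.\<close>
  have up: "?S a \<in> P 0" if "?S a \<in> P 1" for a
  proof -
    let ?v = "\<lambda>b. if b < N ^ length ys then u (a + N * b) else \<zero>"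
    have "?S a = box_eval R N ys ?v" by (rule box_eval_cong) simp
    moreover have "?v b \<in> P 0" for b
      using coeffs[OF that, of b] Cons.prems(3) submodD(2)[OF prime_inD(1)[OF P0(1)]] by auto
    ultimately show ?thesis using box_eval_mem[OF prime_inD(1)[OF P0(1)] ysC, of ?v] by simp
  qed
  have h: "horner R y N ?S \<in> P 0" using Cons.prems(6) by simp
  have i: "i mod N < N" "i div N < N ^ length ys" "i = i mod N + N * (i div N)"
    using Cons.prems(7) by (cases "N = 0"; simp add: less_mult_imp_div_less mult.commute)+
  have "?S (i mod N) \<in> P 0"
    by (rule horner_in_prime[OF P0(1,2,3) yC P0(5,4) SC _ h i(1)]) (rule up)
  then have "?S (i mod N) \<in> P 1" using P0(3) by blast
  then have "u (i mod N + N * (i div N)) \<in> M" by (rule coeffs) (rule i(2))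
  then show ?case using i(3) by simp
qed

section \<open>A strict chain from monomials and powers of \<open>z\<close>\<close>

context local_coefficient_ring
begin

text \<open>The chain is ordered first by the power of \<open>z\<close>, from \<open>N - 1\<close>
  down to \<open>0\<close>, and then by the number \<open>k\<close> of coefficients allowed outside
  \<open>M\<close>. Steps within a row are strict by \<open>KC\<close>. A row with one more factor
  \<open>z\<close> lies inside the start of the next row, because \<open>z \<in> M\<close> moves all
  coefficients into \<open>M\<close>. So there are \<open>N\<close> rows of
  \<open>N ^ length ys\<close> steps.\<close>

lemma box_chain:
  assumes M: "submod R C M" "M \<subseteq> C" "\<one> \<notin> M" and S: "submod R C S" and ys: "set ys \<subseteq> carrier R"
    and z: "z \<in> M" and N: "0 < N"
    and KC: "\<And>j u i. j < N \<Longrightarrow> (\<And>i. u i \<in> C) \<Longrightarrow> z [^] j \<otimes> box_eval R N ys u \<in> S \<Longrightarrow>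
      i < N ^ length ys \<Longrightarrow> u i \<in> M"
  shows "schain R C S (N * N ^ length ys) {b \<oplus> box_eval R N ys u | b u. b \<in> S \<and> (\<forall>i. u i \<in> C)}"
proof -
  define T where "T j k = {b \<oplus> z [^] (j::nat) \<otimes> box_eval R N ys u | b u. b \<in> S \<and> (\<forall>i. u i \<in> C) \<and> (\<forall>i\<ge>k. u i \<in> M)}" for j k :: nat
  note Sc = submodD[OF S] and Mc = submodD[OF M(1)]
  have zC: "z \<in> C" "z \<in> carrier R" using z M(2) C_carrier by auto
  have zj: "z [^] j \<in> carrier R" for j :: nat using zC by simp
  have ev: "box_eval R N ys u \<in> carrier R" if "\<forall>i. u i \<in> C" for u
    using box_eval_closed[OF ys] that C_carrier by blast
  have TI: "b \<oplus> z [^] j \<otimes> box_eval R N ys u \<in> T j k" if "b \<in> S" "\<forall>i. u i \<in> C" "\<forall>i\<ge>k. u i \<in> M" for b u j k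
    using that unfolding T_def by blast
  have ST: "S \<subseteq> T j k" for j k
  proof
    fix b assume b: "b \<in> S"
    have "box_eval R N ys (\<lambda>_. \<zero>) = \<zero>"
      using box_eval_smult[OF ys zero_closed, of "\<lambda>_. \<zero>"] box_eval_closed[OF ys, of "\<lambda>_. \<zero>"] by simp
    then have "b = b \<oplus> z [^] j \<otimes> box_eval R N ys (\<lambda>_. \<zero>)" using Sc(1)[OF b] zj by simp
    then show "b \<in> T j k" using TI[OF b, of "\<lambda>_. \<zero>" k j] C_closed(1) Mc(2) by simp
  qed
  have Ts: "submod R C (T j k)" for j k
  proof -
    have "x \<oplus> y \<in> T j k" if x: "x \<in> T j k" and y: "y \<in> T j k" for x y
    proof -
      obtain b u where bu: "x = b \<oplus> z [^] j \<otimes> box_eval R N ys u" "b \<in> S" "\<forall>i. u i \<in> C" "\<forall>i\<ge>k. u i \<in> M"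
        using x unfolding T_def by blast
      obtain c v where cv: "y = c \<oplus> z [^] j \<otimes> box_eval R N ys v" "c \<in> S" "\<forall>i. v i \<in> C" "\<forall>i\<ge>k. v i \<in> M"
        using y unfolding T_def by blast
      have "box_eval R N ys (\<lambda>i. u i \<oplus> v i) = box_eval R N ys u \<oplus> box_eval R N ys v"
        using bu(3) cv(3) C_carrier by (intro box_eval_add[OF ys]) auto
      then have "x \<oplus> y = (b \<oplus> c) \<oplus> z [^] j \<otimes> box_eval R N ys (\<lambda>i. u i \<oplus> v i)"
        unfolding bu(1) cv(1) using Sc(1)[OF bu(2)] Sc(1)[OF cv(2)] ev[OF bu(3)] ev[OF cv(3)] zj
        by (simp add: r_distr a_ac)
      then show ?thesis using TI[OF Sc(3)[OF bu(2) cv(2)], of "\<lambda>i. u i \<oplus> v i" k j] bu cv C_closed Mc(3) by simp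
    qed
    moreover have "c \<otimes> x \<in> T j k" if c: "c \<in> C" and x: "x \<in> T j k" for c x
    proof -
      obtain b u where bu: "x = b \<oplus> z [^] j \<otimes> box_eval R N ys u" "b \<in> S" "\<forall>i. u i \<in> C" "\<forall>i\<ge>k. u i \<in> M"
        using x unfolding T_def by blast
      have "box_eval R N ys (\<lambda>i. c \<otimes> u i) = c \<otimes> box_eval R N ys u"
        using bu(3) c C_carrier by (intro box_eval_smult[OF ys]) auto
      then have "c \<otimes> x = c \<otimes> b \<oplus> z [^] j \<otimes> box_eval R N ys (\<lambda>i. c \<otimes> u i)"
        unfolding bu(1) using Sc(1)[OF bu(2)] ev[OF bu(3)] zj C_carrier[OF c]
        by (simp add: r_distr m_lcomm)
      then show ?thesis using TI[OF Sc(4)[OF c bu(2)], of "\<lambda>i. c \<otimes> u i" k j] bu c C_closed Mc(4) by simp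
    qed
    moreover have "T j k \<subseteq> carrier R" unfolding T_def using Sc(1) ev zj by auto
    ultimately show ?thesis unfolding submod_def using ST[of j k] Sc(2) by blast
  qed
  have strict: "T j k \<subset> T j (Suc k)" if j: "j < N" and k: "k < N ^ length ys" for j k
  proof -
    \<comment> \<open>The monomial of index \<open>k\<close>, with coefficient
      \<open>\<one>\<close>. If it were already in \<open>T j k\<close>, then \<open>KC\<close>,
      applied to its difference from an element with \<open>k\<close>-th coefficient in
      \<open>M\<close>, would put \<open>\<one>\<close> into \<open>M\<close>.\<close>
    define d where "d i = (if i = k then \<one> else \<zero>)" for i
    have d: "\<forall>i. d i \<in> C" "\<forall>i\<ge>Suc k. d i \<in> M" unfolding d_def using C_closed Mc(2) by auto
    have "\<zero> \<oplus> z [^] j \<otimes> box_eval R N ys d \<in> T j (Suc k)" by (rule TI[OF Sc(2) d])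
    moreover have "\<zero> \<oplus> z [^] j \<otimes> box_eval R N ys d \<notin> T j k"
    proof
      assume "\<zero> \<oplus> z [^] j \<otimes> box_eval R N ys d \<in> T j k"
      then obtain b u where bu: "\<zero> \<oplus> z [^] j \<otimes> box_eval R N ys d = b \<oplus> z [^] j \<otimes> box_eval R N ys u" "b \<in> S"
        "\<forall>i. u i \<in> C" "\<forall>i\<ge>k. u i \<in> M" unfolding T_def by blast
      let ?w = "\<lambda>i. d i \<oplus> (\<ominus> \<one>) \<otimes> u i"
      have m1: "\<ominus> \<one> \<in> carrier R" "\<ominus> \<one> \<in> C" using C_closed by auto
      have uc: "\<And>i. u i \<in> carrier R" "\<And>i. d i \<in> carrier R" using bu(3) d C_carrier by auto
      have "box_eval R N ys ?w = box_eval R N ys d \<oplus> (\<ominus> \<one>) \<otimes> box_eval R N ys u"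
        using box_eval_add[OF ys, of d "\<lambda>i. (\<ominus> \<one>) \<otimes> u i"] box_eval_smult[OF ys m1(1), of u] uc m1 by simp
      then have "z [^] j \<otimes> box_eval R N ys ?w = z [^] j \<otimes> box_eval R N ys d \<ominus> z [^] j \<otimes> box_eval R N ys u"
        using ev[OF d(1)] ev[OF bu(3)] zj by (simp add: r_distr l_minus r_minus a_minus_def)
      also have "\<dots> = b" using bu(1) ev[OF d(1)] ev[OF bu(3)] zj Sc(1)[OF bu(2)]
        by (simp add: a_minus_def a_assoc r_neg)
      finally have "z [^] j \<otimes> box_eval R N ys ?w \<in> S" using bu(2) by simp
      then have "?w k \<in> M" by (rule KC[OF j _ _ k, rotated]) (use d bu(3) C_closed m1 in simp)
      moreover have "u k \<in> M" using bu(4) by simp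
      ultimately have "?w k \<oplus> u k \<in> M" by (rule Mc(3))
      moreover have "?w k \<oplus> u k = \<one>" unfolding d_def using uc by (simp add: l_minus a_assoc l_neg)
      ultimately show False using M(3) by simp
    qed
    moreover have "T j k \<subseteq> T j (Suc k)" unfolding T_def using Suc_leD by blast
    ultimately show ?thesis by blast
  qed
  have row: "schain R C S (l + k) (T j k)" if "j < N" "k \<le> N ^ length ys" "schain R C S l (T j 0)" for j k l
    using that(2)
  proof (induction k)
    case 0
    then show ?case using that(3) by simp
  next
    case (Suc k)
    then have "schain R C S (l + k) (T j k)" by simp
    then have "schain R C S (Suc (l + k)) (T j (Suc k))"
      by (rule schain_Suc) (use strict[OF that(1)] Suc.prems Ts in auto)
    then show ?case by simp
  qed
  have down: "T (Suc j) k \<subseteq> T j 0" for j k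
  proof
    fix x assume "x \<in> T (Suc j) k"
    then obtain b u where bu: "x = b \<oplus> z [^] Suc j \<otimes> box_eval R N ys u" "b \<in> S" "\<forall>i. u i \<in> C"
      unfolding T_def by blast
    have uc: "\<And>i. u i \<in> carrier R" using bu(3) C_carrier by auto
    have "x = b \<oplus> z [^] j \<otimes> box_eval R N ys (\<lambda>i. z \<otimes> u i)"
      unfolding bu(1) using box_eval_smult[OF ys zC(2), of u] uc ev[OF bu(3)] zC by (simp add: m_assoc)
    moreover have "z \<otimes> u i \<in> M" for i using Mc(4)[OF _ z, of "u i"] bu(3) uc zC by (simp add: m_comm)
    ultimately show "x \<in> T j 0" using TI[OF bu(2), of "\<lambda>i. z \<otimes> u i" 0 j] M(2) by auto
  qed
  let ?E = "N ^ length ys"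
  have "schain R C S (k * ?E) (T (N - 1 - k) 0)" if "k < N" for k
    using that
  proof (induction k)
    case 0
    then show ?case using schain_0[OF Ts ST] by simp
  next
    case (Suc k)
    then have "schain R C S (k * ?E) (T (N - 1 - k) 0)" by simp
    then have "schain R C S (k * ?E + ?E) (T (N - 1 - k) ?E)" by (rule row[rotated 2]) (use Suc.prems in simp_all)
    moreover have "N - 1 - k = Suc (N - 1 - Suc k)" using Suc.prems by simp
    ultimately have "schain R C S (k * ?E + ?E) (T (Suc (N - 1 - Suc k)) ?E)" by simp
    then have "schain R C S (k * ?E + ?E) (T (N - 1 - Suc k) 0)" by (rule schain_mono[OF _ down Ts])
    then show ?case by (simp add: add.commute)
  qed
  from this[of "N - 1"] have "schain R C S ((N - 1) * ?E) (T 0 0)" using N by simp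
  then have "schain R C S ((N - 1) * ?E + ?E) (T 0 ?E)" by (rule row[rotated 2]) (use N in simp_all)
  moreover have "(N - 1) * ?E + ?E = N * ?E" using N by (cases N) simp_all
  ultimately have ch: "schain R C S (N * ?E) (T 0 ?E)" by simp
  let ?X = "{b \<oplus> box_eval R N ys u | b u. b \<in> S \<and> (\<forall>i. u i \<in> C)}"
  have "T 0 ?E = ?X"
  proof
    show "T 0 ?E \<subseteq> ?X"
    proof
      fix x assume "x \<in> T 0 ?E"
      then obtain b u where bu: "x = b \<oplus> z [^] (0::nat) \<otimes> box_eval R N ys u" "b \<in> S" "\<forall>i. u i \<in> C"
        unfolding T_def by blast
      then have "x = b \<oplus> box_eval R N ys u" using ev[OF bu(3)] by simp
      then show "x \<in> ?X" using bu(2,3) by blast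
    qed
    show "?X \<subseteq> T 0 ?E"
    proof
      fix x assume "x \<in> ?X"
      then obtain b u where bu: "x = b \<oplus> box_eval R N ys u" "b \<in> S" "\<forall>i. u i \<in> C" by blast
      \<comment> \<open>Coefficients of index \<open>?E\<close> or more do not enter the value, so
        they may be set to zero, which lies in \<open>M\<close>.\<close>
      let ?v = "\<lambda>i. if i < ?E then u i else \<zero>"
      have "box_eval R N ys u = box_eval R N ys ?v" by (rule box_eval_cong) simp
      then have "x = b \<oplus> z [^] (0::nat) \<otimes> box_eval R N ys ?v" using bu(1) ev[OF bu(3)] by simp
      then show "x \<in> T 0 ?E" using TI[OF bu(2), of ?v ?E 0] bu(3) C_closed(1) Mc(2) by simp
    qed
  qed
  then show ?thesis using ch by simp
qed

end

section \<open>The bound on prime chains in the fiber ring\<close>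

locale polys_over_local = UP_cring R P + noetherian_local R m for R (structure) and P (structure) and m
begin

abbreviation K :: "(nat \<Rightarrow> 'a) set" where "K \<equiv> cst ` carrier R"

lemma subring_K: "subring K P"
proof -
  interpret h: ring_hom_ring R P cst
    using const_ring_hom by (intro ring_hom_ringI2) unfold_locales
  show ?thesis by (rule h.img_is_subring[OF R.carrier_is_subring])
qed

lemma cst_one: "cst \<one> = \<one>\<^bsub>P\<^esub>" by (rule monom_one)

lemma monom_times: "a \<in> carrier R \<Longrightarrow> b \<in> carrier R \<Longrightarrow> mon a i \<otimes>\<^bsub>P\<^esub> mon b j = mon (a \<otimes> b) (i + j)"
  using monom_mult[of a b i j] by simp

lemma cst_times_coeff:
  assumes "a \<in> carrier R" "p \<in> carrier P" shows "cf (cst a \<otimes>\<^bsub>P\<^esub> p) i = a \<otimes> cf p i"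
  using assms monom_mult_is_smult[OF assms] by simp

sublocale KP: local_coefficient_ring P K "cst ` m"
proof (intro local_coefficient_ring.intro coefficient_ring.intro coefficient_ring_axioms.intro
    local_coefficient_ring_axioms.intro subring_K UP_cring)
  fix c assume "c \<in> K - cst ` m"
  then obtain a where a: "a \<in> carrier R - m" "c = cst a" by blast
  then obtain b where b: "b \<in> carrier R" "b \<otimes> a = \<one>" using m_unit by blast
  then have "cst b \<otimes>\<^bsub>P\<^esub> c = \<one>\<^bsub>P\<^esub>" using monom_times[of b a 0 0] a cst_one by simp
  then show "\<exists>d\<in>K. d \<otimes>\<^bsub>P\<^esub> c = \<one>\<^bsub>P\<^esub>" using b by blast
qed

definition bounded_pols :: "'a set \<Rightarrow> nat \<Rightarrow> (nat \<Rightarrow> 'a) set" where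
  "bounded_pols V d = {p \<in> carrier P. (\<forall>i. cf p i \<in> V) \<and> (\<forall>i\<ge>d. cf p i = \<zero>)}"

text \<open>The coefficients are released from \<open>V\<close> one degree at a time. Each release
  has length at most that of \<open>R/V\<close>, through multiplication by
  \<open>t^k\<close>.\<close>

lemma lenle_bounded_pols:
  assumes V: "idl V" and l: "colen V l"
  shows "lenle P K (cst ` m) (bounded_pols V d) (d * l) (bounded_pols (carrier R) d)"
proof -
  note Vc = submodD[OF V]
  define S where "S k = {p \<in> carrier P. (\<forall>i\<ge>d. cf p i = \<zero>) \<and> (\<forall>i\<ge>k. cf p i \<in> V)}" for k
  have Ss: "submod P K (S k)" for k
    unfolding submod_def
  proof (intro conjI ballI)
    show "S k \<subseteq> carrier P" unfolding S_def by blast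
    show "\<zero>\<^bsub>P\<^esub> \<in> S k" unfolding S_def using Vc(2) by simp
    show "p \<oplus>\<^bsub>P\<^esub> q \<in> S k" if "p \<in> S k" "q \<in> S k" for p q using that Vc(3) unfolding S_def by simp
    fix c p assume "c \<in> K" "p \<in> S k"
    then show "c \<otimes>\<^bsub>P\<^esub> p \<in> S k" using Vc(4) unfolding S_def by (auto simp: cst_times_coeff simp del: coeff_mult)
  qed
  have step: "lenle P K (cst ` m) (S k) l (S (Suc k))" if k: "k < d" for k
  proof -
    have mul: "cst y \<otimes>\<^bsub>P\<^esub> mon \<one> k = mon y k" if "y \<in> carrier R" for y
      using monom_times[of y \<one> 0 k] that by simp
    have "{b \<oplus>\<^bsub>P\<^esub> cst y \<otimes>\<^bsub>P\<^esub> mon \<one> k | b y. b \<in> S k \<and> y \<in> carrier R} = S (Suc k)" (is "?L = _")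
    proof
      show "?L \<subseteq> S (Suc k)"
      proof
        fix q assume "q \<in> ?L"
        then obtain b y where "b \<in> S k" "y \<in> carrier R" "q = b \<oplus>\<^bsub>P\<^esub> mon y k" using mul by auto
        then show "q \<in> S (Suc k)" using k Vc(1) unfolding S_def by (auto simp: Suc_le_eq)
      qed
      show "S (Suc k) \<subseteq> ?L"
      proof
        fix q assume "q \<in> S (Suc k)"
        then have q: "q \<in> carrier P" "\<And>i. i \<ge> d \<Longrightarrow> cf q i = \<zero>" "\<And>i. i \<ge> Suc k \<Longrightarrow> cf q i \<in> V" unfolding S_def by auto
        have qc: "cf q i \<in> carrier R" for i using q(1) by simp
        let ?b = "q \<oplus>\<^bsub>P\<^esub> mon (\<ominus> cf q k) k"
        have bc: "cf ?b i = (if i = k then \<zero> else cf q i)" for i using q(1) qc by (auto simp: R.r_neg)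
        have "?b \<in> S k" unfolding S_def
        proof (intro CollectI conjI allI impI)
          show "?b \<in> carrier P" using q(1) qc by simp
          show "cf ?b i = \<zero>" if "i \<ge> d" for i unfolding bc using q(2)[OF that] by simp
          show "cf ?b i \<in> V" if "i \<ge> k" for i unfolding bc using q(3)[of i] Vc(2) that by auto
        qed
        moreover have "q = ?b \<oplus>\<^bsub>P\<^esub> mon (cf q k) k"
        proof (rule up_eqI)
          show "cf q i = cf (?b \<oplus>\<^bsub>P\<^esub> mon (cf q k) k) i" for i
            using q(1) qc bc[of i] by (auto simp: R.l_neg R.a_assoc)
        qed (use q(1) qc in simp_all)
        ultimately show "q \<in> ?L" using mul[OF qc[of k]] qc[of k] by (intro CollectI exI[of _ ?b] exI[of _ "cf q k"]) simp
      qed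
    qed
    moreover have "lenle P K (cst ` m) (S k) l {b \<oplus>\<^bsub>P\<^esub> cst y \<otimes>\<^bsub>P\<^esub> mon \<one> k | b y. b \<in> S k \<and> y \<in> carrier R}"
    proof (rule lenle_translate[OF R.is_cring UP_cring const_ring_hom l Ss _ _ m_carrier order_refl])
      show "mon \<one> k \<in> carrier P" by simp
      show "\<forall>v\<in>V. cst v \<otimes>\<^bsub>P\<^esub> mon \<one> k \<in> S k"
      proof
        fix v assume "v \<in> V"
        then have "cst v \<otimes>\<^bsub>P\<^esub> mon \<one> k = mon v k" using mul Vc(1) by simp
        then show "cst v \<otimes>\<^bsub>P\<^esub> mon \<one> k \<in> S k" using \<open>v \<in> V\<close> Vc(1,2) k unfolding S_def by auto
      qed
    qed
    ultimately show ?thesis by simp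
  qed
  have "lenle P K (cst ` m) (S 0) (k * l) (S k)" if "k \<le> d" for k
    using that
  proof (induction k)
    case 0
    then show ?case using lenle.lenle_0[OF Ss] by simp
  next
    case (Suc k)
    then have "lenle P K (cst ` m) (S 0) (k * l + l) (S (Suc k))"
      by (intro lenle_trans[OF step]) simp_all
    then show ?case by (simp add: add.commute)
  qed
  from this[of d] have "lenle P K (cst ` m) (S 0) (d * l) (S d)" by simp
  moreover have "S 0 = bounded_pols V d" unfolding S_def bounded_pols_def by auto
  moreover have "S d = bounded_pols (carrier R) d" unfolding S_def bounded_pols_def using Vc(2) by auto
  ultimately show ?thesis by simp
qed

abbreviation W :: "nat \<Rightarrow> (nat \<Rightarrow> 'a) set" where "W d \<equiv> bounded_pols (carrier R) d"

lemma W_mult: "p \<in> W a \<Longrightarrow> q \<in> W b \<Longrightarrow> p \<otimes>\<^bsub>P\<^esub> q \<in> W (a + b)"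
proof -
  assume p: "p \<in> W a" and q: "q \<in> W b"
  have c: "p \<in> carrier P" "q \<in> carrier P" using p q unfolding bounded_pols_def by auto
  have "(\<Oplus>j\<in>{..i}. cf p j \<otimes> cf q (i - j)) \<in> {\<zero>}" if i: "a + b \<le> i" for i
  proof (rule R.finsum_mem)
    fix j assume "j \<in> {..i}"
    then have "a \<le> j \<or> b \<le> i - j" using i by auto
    then show "cf p j \<otimes> cf q (i - j) \<in> {\<zero>}" using p q c unfolding bounded_pols_def by auto
  qed auto
  then show ?thesis unfolding bounded_pols_def using c by simp
qed

lemma W_mono: "a \<le> b \<Longrightarrow> W a \<subseteq> W b"
  unfolding bounded_pols_def by auto

lemma W_add: "p \<in> W a \<Longrightarrow> q \<in> W a \<Longrightarrow> p \<oplus>\<^bsub>P\<^esub> q \<in> W a"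
  unfolding bounded_pols_def by auto

lemma W_horner:
  assumes "y \<in> W d" "\<And>i. S i \<in> W e" shows "horner P y N S \<in> W (e + N * d)"
  using assms(2)
proof (induction N arbitrary: S)
  case 0
  show ?case unfolding bounded_pols_def by simp
next
  case (Suc N)
  have "horner P y N (\<lambda>i. S (Suc i)) \<in> W (e + N * d)" by (rule Suc.IH) (rule Suc.prems)
  then have "y \<otimes>\<^bsub>P\<^esub> horner P y N (\<lambda>i. S (Suc i)) \<in> W (e + Suc N * d)"
    using W_mult[OF assms(1)] by (simp add: add.left_commute)
  moreover have "S 0 \<in> W (e + Suc N * d)" using W_mono[of e "e + Suc N * d"] Suc.prems by auto
  ultimately show ?case using W_add by simp
qed

text \<open>Degree bounds are strict, so a constant needs \<open>1\<close>. Each variable occurs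
  with exponents below \<open>N\<close> and adds at most \<open>N * d\<close>.\<close>

lemma W_box_eval:
  assumes "set ys \<subseteq> W d" "\<And>i. u i \<in> K"
  shows "box_eval P N ys u \<in> W (length ys * (N * d) + 1)"
  using assms
proof (induction ys arbitrary: u)
  case Nil
  then obtain a where "a \<in> carrier R" "u 0 = cst a" by blast
  then show ?case unfolding bounded_pols_def by simp
next
  case (Cons y ys)
  have IH: "box_eval P N ys (\<lambda>b. u (a + N * b)) \<in> W (length ys * (N * d) + 1)" for a
    using Cons.prems by (intro Cons.IH) auto
  have "y \<in> W d" using Cons.prems(1) by simp
  then have "box_eval P N (y # ys) u \<in> W (length ys * (N * d) + 1 + N * d)"
    unfolding box_eval.simps by (rule W_horner) (rule IH)
  then show ?case by (simp add: add.commute add.left_commute)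
qed

lemma W_ex: "p \<in> carrier P \<Longrightarrow> \<exists>d. p \<in> W d"
proof -
  assume p: "p \<in> carrier P"
  then have "p \<in> W (Suc (deg R p))" unfolding bounded_pols_def using deg_aboveD[OF _ p] by auto
  then show ?thesis by blast
qed

lemma W_ex_list: "set ys \<subseteq> carrier P \<Longrightarrow> \<exists>d. set ys \<subseteq> W d"
proof (induction ys)
  case (Cons y ys)
  then obtain a b where "y \<in> W a" "set ys \<subseteq> W b" using W_ex[of y] by auto
  then have "set (y # ys) \<subseteq> W (max a b)" using W_mono[of a "max a b"] W_mono[of b "max a b"] by auto
  then show ?case by blast
qed simp

lemma bounded_pols_submod: "idl V \<Longrightarrow> submod P K (bounded_pols V d)"
  unfolding submod_def bounded_pols_def by (auto simp: cst_times_coeff simp del: coeff_mult)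

lemma submod_cst_m: "submod P K (cst ` m)"
  unfolding submod_def
proof (intro conjI ballI)
  note mc = submodD[OF m]
  show "cst ` m \<subseteq> carrier P" using m_carrier by auto
  show "\<zero>\<^bsub>P\<^esub> \<in> cst ` m" using mc(2) by (metis image_eqI monom_zero)
  fix x assume "x \<in> cst ` m"
  then obtain a where a: "a \<in> m" "x = cst a" by blast
  show "x \<oplus>\<^bsub>P\<^esub> w \<in> cst ` m" if w: "w \<in> cst ` m" for w
  proof -
    obtain b where b: "b \<in> m" "w = cst b" using w by blast
    have "x \<oplus>\<^bsub>P\<^esub> w = cst (a \<oplus> b)" unfolding a b using mc(1) a b by simp
    then show ?thesis using mc(3)[OF a(1) b(1)] by blast
  qed
  show "c \<otimes>\<^bsub>P\<^esub> x \<in> cst ` m" if c: "c \<in> K" for c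
  proof -
    obtain b where b: "b \<in> carrier R" "c = cst b" using c by blast
    have "c \<otimes>\<^bsub>P\<^esub> x = cst (b \<otimes> a)" unfolding a b using monom_times[of b a 0 0] mc(1) a b by simp
    then show ?thesis using mc(4)[OF b(1) a(1)] by blast
  qed
qed

lemmas box_eval_mem_P = cring.box_eval_mem[OF UP_cring]

text \<open>The left side has degree \<open>d + 2\<close> in \<open>N\<close>, the right side
  \<open>d + 1\<close>; one more than the product of the constants is a large enough
  \<open>N\<close>.\<close>

lemma growth_contradiction:
  fixes a b l d :: nat
  assumes "\<And>N. 0 < N \<Longrightarrow> N * N ^ Suc d \<le> (a * N) * ((b * N) ^ d * l)"
  shows False
proof -
  let ?N = "Suc (a * b ^ d * l)"
  have "?N * ?N ^ Suc d \<le> (a * ?N) * ((b * ?N) ^ d * l)" by (rule assms) simp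
  also have "\<dots> = (a * b ^ d * l) * ?N ^ Suc d"
    unfolding power_mult_distrib power_Suc by (simp only: mult_ac)
  also have "\<dots> < ?N * ?N ^ Suc d" by (intro mult_strict_right_mono) simp_all
  finally show False by simp
qed

text \<open>The chain has length \<open>d + 1\<close>, one more than the number of parameters for
  \<open>R/q\<close>. The elements \<open>z t^r\<close> bring polynomials of bounded degree into
  \<open>B\<close> after multiplication by a power of \<open>z\<close>, and
  \<open>z \<notin> q\<close> makes that multiplication cancellable modulo \<open>q\<close>.\<close>

lemma no_long_prime_chain:
  assumes B: "subring B P" "K \<subseteq> B"
    and Ps: "\<And>i. i \<le> Suc d \<Longrightarrow> prime_in P B (Ps i)" "\<And>i. i < Suc d \<Longrightarrow> Ps i \<subset> Ps (Suc i)"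
    and mP: "cst ` m \<subseteq> Ps 0"
    and q: "primeideal q R" "\<And>f. f \<in> B \<Longrightarrow> (\<And>i. cf f i \<in> q) \<Longrightarrow> f \<in> Ps 0"
    and z: "z \<in> m" "z \<notin> q" and n1: "0 < n1" "\<And>r. r \<le> n1 \<Longrightarrow> mon z r \<in> B"
    and xs: "set xs \<subseteq> m" "length xs = d" "colen (adjs q xs) l"
  shows False
proof -
  have qs: "idl q" by (rule primeideal_submod[OF q(1)])
  note qc = submodD[OF qs]
  have zc: "z \<in> carrier R" using z m_carrier by blast
  have xc: "set xs \<subseteq> carrier R" using xs m_carrier by blast
  have Bc: "B \<subseteq> carrier P" using subringE(1)[OF B(1)] .
  define y where "y i = (SOME y. y \<in> Ps (Suc i) - Ps i)" for i
  have y: "y i \<in> Ps (Suc i) - Ps i" if "i < Suc d" for i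
    unfolding y_def by (rule someI_ex[OF psubset_imp_ex_mem[OF Ps(2)[OF that]]])
  define ys where "ys = map y [0..<Suc d]"
  have ly: "length ys = Suc d" unfolding ys_def by simp
  have yB: "set ys \<subseteq> B"
  proof
    fix x assume "x \<in> set ys"
    then obtain i where "i < Suc d" "x = y i" unfolding ys_def by (auto simp del: upt_Suc)
    then show "x \<in> B" using y[of i] prime_inD(2)[OF Ps(1)[of "Suc i"]] by auto
  qed
  have yc: "set ys \<subseteq> carrier P" using yB Bc by blast
  obtain d0 where d0: "set ys \<subseteq> W d0" using W_ex_list[OF yc] by blast
  \<comment> \<open>The ambient ring for Artin-Rees is \<open>R[t]\<close> now, so the Rees variable
    is a second one, in \<open>UP P\<close>.\<close>
  interpret PP: UP_cring P "UP P" by unfold_locales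
  \<comment> \<open>Over the constants, \<open>?F\<close> generates a subalgebra of \<open>B\<close>
    that is Noetherian, whereas \<open>B\<close> may fail to be. The Artin-Rees ideal is generated
    by the parameters.\<close>
  let ?F = "set ys \<union> mon z ` {..n1}"
  let ?I = "cst ` set xs"
  have accK: "acc P K"
    by (rule acc_image[OF R.is_cring UP_cring const_ring_hom R.carrier_is_subring acc])
  obtain n where n: "subring (n 0) P" "K \<subseteq> n 0" "?F \<subseteq> n 0" "?I \<subseteq> n 1"
    "\<And>j. submod P (n 0) (n j)"
    "\<And>i j a b. a \<in> n i \<Longrightarrow> b \<in> n j \<Longrightarrow> a \<otimes>\<^bsub>P\<^esub> b \<in> n (i + j)"
    "\<And>B S j. subring B P \<Longrightarrow> K \<union> ?F \<union> ?I \<subseteq> B \<Longrightarrow> submod P B S \<Longrightarrow> S \<subseteq> B \<Longrightarrow> ?I \<subseteq> S \<Longrightarrow>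
      n 0 \<subseteq> B \<and> n (Suc j) \<subseteq> S"
    and AR: "\<And>z Q. z \<in> n 0 \<Longrightarrow> submod P (n 0) Q \<Longrightarrow> Q \<subseteq> n 0 \<Longrightarrow> (\<And>a. a \<in> n 0 \<Longrightarrow> z \<otimes>\<^bsub>P\<^esub> a \<in> Q \<Longrightarrow> a \<in> Q) \<Longrightarrow>
      \<exists>c. \<forall>k a b q. a \<in> n 0 \<longrightarrow> b \<in> n k \<longrightarrow> q \<in> Q \<longrightarrow> z \<otimes>\<^bsub>P\<^esub> a = b \<oplus>\<^bsub>P\<^esub> q \<longrightarrow>
        (\<exists>b'\<in>n (k - c). \<exists>q'\<in>Q. a = b' \<oplus>\<^bsub>P\<^esub> q')"
    by (rule PP.artin_rees_filtration[OF subring_K accK, of ?F ?I]) (use yc zc xc in auto)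
  interpret A: coefficient_ring P "n 0"
    by (intro coefficient_ring.intro coefficient_ring_axioms.intro n(1) UP_cring)
  note Ac = subringE[OF n(1)]
  \<comment> \<open>The generators of the ideal come from \<open>m\<close>, so its positive powers
    lie in \<open>Ps 0\<close>.\<close>
  have nB: "n 0 \<subseteq> B" "n (Suc j) \<subseteq> Ps 0" for j
  proof -
    have P0: "prime_in P B (Ps 0)" using Ps(1)[of 0] by simp
    have "?I \<subseteq> K" using xc by blast
    then have "K \<union> ?F \<union> ?I \<subseteq> B" using B(2) yB n1(2) by auto
    moreover have "?I \<subseteq> Ps 0" using mP xs(1) by blast
    ultimately show "n 0 \<subseteq> B" "n (Suc j) \<subseteq> Ps 0"
      using n(7)[OF B(1) _ prime_inD(1,2)[OF P0], of j] by auto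
  qed
  define Q where "Q = {f \<in> n 0. \<forall>i. cf f i \<in> q}"
  have Qs: "submod P (n 0) Q"
    unfolding submod_def
  proof (intro conjI ballI)
    show "Q \<subseteq> carrier P" unfolding Q_def using Ac(1) by blast
    show "\<zero>\<^bsub>P\<^esub> \<in> Q" unfolding Q_def using Ac(2) qc(2) by simp
    show "f \<oplus>\<^bsub>P\<^esub> g \<in> Q" if "f \<in> Q" "g \<in> Q" for f g
    proof -
      have "f \<in> carrier P" "g \<in> carrier P" using that Ac(1) unfolding Q_def by auto
      then show ?thesis using that Ac(7) qc(3) unfolding Q_def by simp
    qed
    fix c f assume c: "c \<in> n 0" and f: "f \<in> Q"
    have fc: "c \<in> carrier P" "f \<in> carrier P" using c f Ac(1) unfolding Q_def by auto
    have "(\<Oplus>j\<in>{..i}. cf c j \<otimes> cf f (i - j)) \<in> q" for i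
    proof (rule R.finsum_mem)
      show "cf c j \<otimes> cf f (i - j) \<in> q" for j using f fc qc(4) unfolding Q_def by simp
    qed (use qc in auto)
    then show "c \<otimes>\<^bsub>P\<^esub> f \<in> Q" using f c Ac(6) fc unfolding Q_def by simp
  qed
  have QP: "Q \<subseteq> Ps 0" unfolding Q_def using q(2) nB(1) by blast
  have zA: "cst z \<in> n 0" using n(2) zc by blast
  have Qz: "f \<in> Q" if "f \<in> n 0" "cst z \<otimes>\<^bsub>P\<^esub> f \<in> Q" for f
  proof -
    have fc: "f \<in> carrier P" using that Ac(1) by blast
    have "z \<otimes> cf f i \<in> q" for i
    proof -
      have "cf (cst z \<otimes>\<^bsub>P\<^esub> f) i \<in> q" using that(2) unfolding Q_def by blast
      then show ?thesis using cst_times_coeff[OF zc fc, of i] by simp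
    qed
    then have "cf f i \<in> q" for i using primeideal.I_prime[OF q(1) zc] z(2) fc by auto
    then show ?thesis using that(1) unfolding Q_def by blast
  qed
  have QA: "Q \<subseteq> n 0" unfolding Q_def by blast
  obtain c where c: "\<And>k a b q. a \<in> n 0 \<Longrightarrow> b \<in> n k \<Longrightarrow> q \<in> Q \<Longrightarrow> cst z \<otimes>\<^bsub>P\<^esub> a = b \<oplus>\<^bsub>P\<^esub> q \<Longrightarrow>
        (\<exists>b'\<in>n (k - c). \<exists>q'\<in>Q. a = b' \<oplus>\<^bsub>P\<^esub> q')"
    using AR[OF zA Qs QA Qz] by blast
  define Y where "Y k = {b \<oplus>\<^bsub>P\<^esub> f | b f. b \<in> n k \<and> f \<in> Q}" for k
  note nc = submodD[OF n(5)] and Qc = submodD[OF Qs]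
  have YI: "b \<oplus>\<^bsub>P\<^esub> f \<in> Y k" if "b \<in> n k" "f \<in> Q" for b f k using that unfolding Y_def by blast
  have Ys: "submod P (n 0) (Y k)" for k
    unfolding submod_def
  proof (intro conjI ballI)
    show "Y k \<subseteq> carrier P" unfolding Y_def using nc(1) Qc(1) by auto
    show "\<zero>\<^bsub>P\<^esub> \<in> Y k" using YI[OF nc(2) Qc(2)] by simp
    fix x assume "x \<in> Y k"
    then obtain b f where bf: "b \<in> n k" "f \<in> Q" "x = b \<oplus>\<^bsub>P\<^esub> f" unfolding Y_def by blast
    have bfc: "b \<in> carrier P" "f \<in> carrier P" using nc(1)[OF bf(1)] Qc(1)[OF bf(2)] .
    show "x \<oplus>\<^bsub>P\<^esub> w \<in> Y k" if w: "w \<in> Y k" for w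
    proof -
      obtain b' f' where bf': "b' \<in> n k" "f' \<in> Q" "w = b' \<oplus>\<^bsub>P\<^esub> f'" using w unfolding Y_def by blast
      have "b' \<in> carrier P" "f' \<in> carrier P" using nc(1)[OF bf'(1)] Qc(1)[OF bf'(2)] .
      then have "x \<oplus>\<^bsub>P\<^esub> w = (b \<oplus>\<^bsub>P\<^esub> b') \<oplus>\<^bsub>P\<^esub> (f \<oplus>\<^bsub>P\<^esub> f')"
        unfolding bf(3) bf'(3) using bfc by (simp add: P.a_ac)
      then show ?thesis using YI[OF nc(3)[OF bf(1) bf'(1)] Qc(3)[OF bf(2) bf'(2)]] by simp
    qed
    show "a \<otimes>\<^bsub>P\<^esub> x \<in> Y k" if a: "a \<in> n 0" for a
    proof -
      have "a \<otimes>\<^bsub>P\<^esub> x = a \<otimes>\<^bsub>P\<^esub> b \<oplus>\<^bsub>P\<^esub> a \<otimes>\<^bsub>P\<^esub> f"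
        unfolding bf(3) using bfc subsetD[OF Ac(1) a] by (simp add: P.r_distr)
      then show ?thesis using YI[OF nc(4)[OF a bf(1)] Qc(4)[OF a bf(2)]] by simp
    qed
  qed
  note Yc = submodD[OF Ys]
  \<comment> \<open>Artin-Rees iterated: each cancelled factor \<open>z\<close> lowers the index by
    \<open>c\<close>, so the loss is linear in \<open>L\<close>.\<close>
  have descend: "a \<in> Y (k - c * L)" if "a \<in> n 0" "cst (z [^] L) \<otimes>\<^bsub>P\<^esub> a \<in> Y k" for a k L
    using that
  proof (induction L arbitrary: k)
    case 0
    then have "a \<in> carrier P" using Ac(1) by blast
    then show ?case using 0 cst_one by simp
  next
    case (Suc L)
    have aA: "a \<in> carrier P" using Suc.prems(1) Ac(1) by blast
    have zL: "z [^] L \<in> carrier R" using zc by simp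
    let ?a = "cst (z [^] L) \<otimes>\<^bsub>P\<^esub> a"
    have a0: "?a \<in> n 0" by (rule Ac(6)[OF subsetD[OF n(2) imageI[OF zL]] Suc.prems(1)])
    have "cst z \<otimes>\<^bsub>P\<^esub> ?a = cst (z [^] Suc L) \<otimes>\<^bsub>P\<^esub> a"
      using monom_times[OF zc zL, of 0 0] zc zL aA by (simp add: P.m_assoc[symmetric] R.m_comm)
    then have "cst z \<otimes>\<^bsub>P\<^esub> ?a \<in> Y k" using Suc.prems(2) by simp
    then obtain b f where bf: "b \<in> n k" "f \<in> Q" "cst z \<otimes>\<^bsub>P\<^esub> ?a = b \<oplus>\<^bsub>P\<^esub> f" unfolding Y_def by blast
    have "?a \<in> Y (k - c)" using c[OF a0 bf] unfolding Y_def by blast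
    then have "a \<in> Y ((k - c) - c * L)" by (rule Suc.IH[OF Suc.prems(1)])
    then show ?case by simp
  qed
  have YP: "Y (Suc k) \<subseteq> Ps 0" for k
  proof
    fix x assume "x \<in> Y (Suc k)"
    then obtain b f where "b \<in> n (Suc k)" "f \<in> Q" "x = b \<oplus>\<^bsub>P\<^esub> f" unfolding Y_def by blast
    then show "x \<in> Ps 0" using nB(2)[of k] QP submodD(3)[OF prime_inD(1)[OF Ps(1)[of 0]]] by blast
  qed
  have zpA: "cst (z [^] k) \<in> n 0" for k :: nat
    by (rule subsetD[OF n(2)], rule imageI) (simp add: zc)
  \<comment> \<open>Induction in steps of \<open>n1\<close>. With \<open>j = i - n1\<close>, the
    product of \<open>z^(n1 - 1)\<close>, \<open>z t^n1\<close> and \<open>z^(j+1) t^j\<close> has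
    degree \<open>i\<close> in \<open>t\<close> and exponent \<open>n1 + j + 1 = i + 1\<close> of
    \<open>z\<close>.\<close>
  have zt: "mon (z [^] Suc i) i \<in> n 0" for i
  proof (induction i rule: less_induct)
    case (less i)
    show ?case
    proof (cases "i \<le> n1")
      case True
      then have "mon z i \<in> n 0" using n(3) by blast
      then have "cst (z [^] i) \<otimes>\<^bsub>P\<^esub> mon z i \<in> n 0" by (rule Ac(6)[OF zpA])
      then show ?thesis using monom_times[of "z [^] i" z 0 i] zc by simp
    next
      case False
      let ?j = "i - n1"
      have "mon (z [^] Suc ?j) ?j \<in> n 0" using less[of ?j] False n1(1) by simp
      moreover have "mon z n1 \<in> n 0" using n(3) by blast
      ultimately have "cst (z [^] (n1 - 1)) \<otimes>\<^bsub>P\<^esub> (mon z n1 \<otimes>\<^bsub>P\<^esub> mon (z [^] Suc ?j) ?j) \<in> n 0"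
        by (intro Ac(6)[OF zpA] Ac(6))
      moreover have "cst (z [^] (n1 - 1)) \<otimes>\<^bsub>P\<^esub> (mon z n1 \<otimes>\<^bsub>P\<^esub> mon (z [^] Suc ?j) ?j) =
        mon (z [^] (n1 - 1) \<otimes> (z \<otimes> z [^] Suc ?j)) (0 + (n1 + ?j))"
        using zc by (subst monom_times, simp, simp)+ simp
      moreover have "z [^] (n1 - 1) \<otimes> (z \<otimes> z [^] Suc ?j) = z [^] Suc i"
      proof -
        have "z \<otimes> z [^] Suc ?j = z [^] Suc (Suc ?j)" using zc R.nat_pow_Suc2[OF zc, of "Suc ?j"] by simp
        then have "z [^] (n1 - 1) \<otimes> (z \<otimes> z [^] Suc ?j) = z [^] ((n1 - 1) + Suc (Suc ?j))"
          using R.nat_pow_mult[OF zc, of "n1 - 1" "Suc (Suc ?j)"] by simp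
        moreover have "(n1 - 1) + Suc (Suc ?j) = Suc i" using False n1(1) by simp
        ultimately show ?thesis by simp
      qed
      moreover have "0 + (n1 + ?j) = i" using False by simp
      ultimately show ?thesis by simp
    qed
  qed
  have ztD: "mon (z [^] D) i \<in> n 0" if "i < D" for i D :: nat
  proof -
    have "cst (z [^] (D - Suc i)) \<otimes>\<^bsub>P\<^esub> mon (z [^] Suc i) i \<in> n 0"
      by (rule Ac(6)[OF zpA zt])
    moreover have "cst (z [^] (D - Suc i)) \<otimes>\<^bsub>P\<^esub> mon (z [^] Suc i) i = mon (z [^] D) i"
      using monom_times[of "z [^] (D - Suc i)" "z [^] Suc i" 0 i] zc that
        R.nat_pow_mult[OF zc, of "D - Suc i" "Suc i"] by simp
    ultimately show ?thesis by simp
  qed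
  define V where "V k = adjs q (map (\<lambda>x. x [^] k) xs)" for k :: nat
  have xkc: "set (map (\<lambda>x. x [^] k) xs) \<subseteq> carrier R" for k :: nat using xc by auto
  have Vs: "idl (V k)" for k unfolding V_def by (rule adjoins_submod[OF qs xkc])
  have Vl: "colen (V k) (k ^ d * l)" for k unfolding V_def using colen_pow[OF qs xc xs(3), of k] xs(2) by simp
  have Vmem: "cst (z [^] D) \<otimes>\<^bsub>P\<^esub> mon v i \<in> Y k" if v: "v \<in> V k" and i: "i < D" for v i D k
  proof -
    \<comment> \<open>For fixed \<open>D\<close> and \<open>i\<close> the admissible
      \<open>v\<close> form an ideal of \<open>R\<close>, so it is enough to test \<open>q\<close>
      and the powers of the parameters.\<close>
    define T where "T = {v \<in> carrier R. mon (z [^] D \<otimes> v) i \<in> Y k}"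
    have zD: "z [^] D \<in> carrier R" using zc by simp
    have Ts: "idl T"
      unfolding submod_def
    proof (intro conjI ballI)
      show "T \<subseteq> carrier R" unfolding T_def by blast
      show "\<zero> \<in> T" unfolding T_def using zD Yc(2) by simp
      show "v \<oplus> w \<in> T" if "v \<in> T" "w \<in> T" for v w
      proof -
        have "mon (z [^] D \<otimes> (v \<oplus> w)) i = mon (z [^] D \<otimes> v) i \<oplus>\<^bsub>P\<^esub> mon (z [^] D \<otimes> w) i"
          using that zD unfolding T_def by (simp add: R.r_distr)
        then show ?thesis using that Yc(3) unfolding T_def by simp
      qed
      show "r \<otimes> v \<in> T" if "r \<in> carrier R" "v \<in> T" for r v
      proof -
        have vc: "v \<in> carrier R" "mon (z [^] D \<otimes> v) i \<in> Y k" using that(2) unfolding T_def by auto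
        have "mon (z [^] D \<otimes> (r \<otimes> v)) i = cst r \<otimes>\<^bsub>P\<^esub> mon (z [^] D \<otimes> v) i"
          using monom_times[of r "z [^] D \<otimes> v" 0 i] that(1) vc(1) zD by (simp add: R.m_lcomm)
        moreover have "cst r \<in> n 0" using n(2) that(1) by blast
        ultimately show ?thesis using Yc(4) vc that(1) unfolding T_def by simp
      qed
    qed
    have zDA: "mon (z [^] D) i \<in> n 0" by (rule ztD[OF i])
    have "q \<subseteq> T"
    proof
      fix v assume v: "v \<in> q"
      have vc: "v \<in> carrier R" using qc(1)[OF v] .
      have "cst v \<otimes>\<^bsub>P\<^esub> mon (z [^] D) i \<in> n 0" using Ac(6)[OF _ zDA] n(2) vc by blast
      then have "mon (z [^] D \<otimes> v) i \<in> n 0" using monom_times[OF vc zD, of 0 i] vc zD by (simp add: R.m_comm)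
      moreover have "cf (mon (z [^] D \<otimes> v) i) j \<in> q" for j
        using qc(2) qc(4)[OF zD v] vc zD by simp
      ultimately have "mon (z [^] D \<otimes> v) i \<in> Q" unfolding Q_def by blast
      then have "\<zero>\<^bsub>P\<^esub> \<oplus>\<^bsub>P\<^esub> mon (z [^] D \<otimes> v) i \<in> Y k" by (rule YI[OF nc(2)])
      then show "v \<in> T" unfolding T_def using vc zD by simp
    qed
    moreover have "set (map (\<lambda>x. x [^] k) xs) \<subseteq> T"
    proof
      fix w assume "w \<in> set (map (\<lambda>x. x [^] k) xs)"
      then obtain x where x: "x \<in> set xs" "w = x [^] k" by auto
      have xR: "x \<in> carrier R" using x xc by blast
      have x1: "cst x \<in> n 1" using n(4) x by blast
      have xk: "cst (x [^] j) \<in> n j" for j :: nat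
      proof (induction j)
        case 0
        then show ?case using Ac(3) cst_one by simp
      next
        case (Suc j)
        then have "cst (x [^] j) \<otimes>\<^bsub>P\<^esub> cst x \<in> n (j + 1)" by (rule n(6)) (rule x1)
        then show ?case using monom_times[of "x [^] j" x 0 0] xR by simp
      qed
      have "mon (z [^] D) i \<otimes>\<^bsub>P\<^esub> cst w \<in> n k" unfolding x(2) by (rule nc(4)[OF zDA xk])
      then have "mon (z [^] D \<otimes> w) i \<in> n k" using monom_times[of "z [^] D" w i 0] zD x xR by simp
      then have "mon (z [^] D \<otimes> w) i \<oplus>\<^bsub>P\<^esub> \<zero>\<^bsub>P\<^esub> \<in> Y k" by (rule YI[OF _ Qc(2)])
      then show "w \<in> T" unfolding T_def using x xR zD by simp
    qed
    ultimately have "V k \<subseteq> T" unfolding V_def by (rule adjoins_least[OF Ts])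
    then have "v \<in> T" using v by blast
    then show ?thesis unfolding T_def using monom_times[of "z [^] D" v 0 i] zD by simp
  qed
  \<comment> \<open>Since every term has degree below \<open>D\<close>, the single power
    \<open>z^D\<close> works for all of them.\<close>
  have clear: "cst (z [^] D) \<otimes>\<^bsub>P\<^esub> f \<in> Y k" if f: "f \<in> bounded_pols (V k) D" for f D k
  proof -
    have fc: "f \<in> carrier P" and fV: "\<And>i. cf f i \<in> V k" and fD: "\<And>i. i \<ge> D \<Longrightarrow> cf f i = \<zero>"
      using f unfolding bounded_pols_def by auto
    have zD: "cst (z [^] D) \<in> carrier P" using zc by simp
    have "cst (z [^] D) \<otimes>\<^bsub>P\<^esub> f = cst (z [^] D) \<otimes>\<^bsub>P\<^esub> (\<Oplus>\<^bsub>P\<^esub> i \<in> {..deg R f}. mon (cf f i) i)"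
      using up_repr[OF fc] by simp
    also have "\<dots> = (\<Oplus>\<^bsub>P\<^esub> i \<in> {..deg R f}. cst (z [^] D) \<otimes>\<^bsub>P\<^esub> mon (cf f i) i)"
      using zD fc by (intro P.finsum_rdistr) auto
    also have "\<dots> \<in> Y k"
    proof (rule P.finsum_mem)
      fix i
      show "cst (z [^] D) \<otimes>\<^bsub>P\<^esub> mon (cf f i) i \<in> Y k"
      proof (cases "i < D")
        case True
        then show ?thesis by (rule Vmem[OF fV])
      next
        case False
        then show ?thesis using fD[of i] zD Yc(2) by simp
      qed
    qed (use Yc in auto)
    finally show ?thesis .
  qed
  \<comment> \<open>\<open>D\<close> is the bound of \<open>W_box_eval\<close> for
    \<open>d + 1\<close> variables. The index \<open>k\<close> exceeds \<open>c * (D + N)\<close> by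
    one, so that a positive index is left when \<open>z^(D+j)\<close> is cancelled, for every
    \<open>j < N\<close>.\<close>
  have bound: "N * N ^ Suc d \<le> D * (k ^ d * l)"
    if N: "0 < N" and D: "D = Suc d * (N * d0) + 1" and k: "k = Suc (c * (D + N))" for N D k :: nat
  proof -
    let ?S = "bounded_pols (V k) D"
    have KC: "u i \<in> cst ` m" if j: "j < N" and u: "\<And>i. u i \<in> K"
      and S: "cst z [^]\<^bsub>P\<^esub> j \<otimes>\<^bsub>P\<^esub> box_eval P N ys u \<in> ?S" and i: "i < N ^ length ys" for j u i
    proof -
      let ?g = "box_eval P N ys u"
      have uA: "\<And>i. u i \<in> n 0" using u n(2) by blast
      have "set ys \<subseteq> n 0" using n(3) by blast
      then have gA: "?g \<in> n 0" by (rule box_eval_mem_P[OF A.submod_C _ uA])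
      have gc: "?g \<in> carrier P" using gA Ac(1) by blast
      have pw: "cst z [^]\<^bsub>P\<^esub> j = cst (z [^] j)" using monom_pow[OF zc, of 0 j] by simp
      have "cst (z [^] D) \<otimes>\<^bsub>P\<^esub> (cst (z [^] j) \<otimes>\<^bsub>P\<^esub> ?g) \<in> Y k" using clear[OF S] unfolding pw .
      moreover have "cst (z [^] D) \<otimes>\<^bsub>P\<^esub> (cst (z [^] j) \<otimes>\<^bsub>P\<^esub> ?g) = cst (z [^] (D + j)) \<otimes>\<^bsub>P\<^esub> ?g"
        using monom_times[of "z [^] D" "z [^] j" 0 0] zc gc R.nat_pow_mult[OF zc, of D j]
        by (simp add: P.m_assoc[symmetric])
      ultimately have "cst (z [^] (D + j)) \<otimes>\<^bsub>P\<^esub> ?g \<in> Y k" by simp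
      then have g: "?g \<in> Y (k - c * (D + j))" by (rule descend[OF gA])
      have "c * (D + j) \<le> c * (D + N)" using j by (intro mult_le_mono2) simp
      then have "k - c * (D + j) = Suc (c * (D + N) - c * (D + j))" unfolding k by (rule Suc_diff_le)
      then have g0: "?g \<in> Ps 0" using g YP by auto
      interpret B: coefficient_ring P B
        by (intro coefficient_ring.intro coefficient_ring_axioms.intro B(1) UP_cring)
      show ?thesis
      proof (rule B.box_eval_in_prime[of K "cst ` m" ys Ps u N i])
        show "submod P K (cst ` m)" by (rule submod_cst_m)
        show "cst ` m \<subseteq> K" using m_carrier by blast
        show "prime_in P B (Ps i)" if "i \<le> length ys" for i using Ps(1) that ly by simp
        show "Ps i \<inter> K \<subseteq> cst ` m" if "i \<le> length ys" for i
        proof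
          fix x assume x: "x \<in> Ps i \<inter> K"
          note pi = Ps(1)[OF that[unfolded ly]]
          show "x \<in> cst ` m"
          proof (rule ccontr)
            assume "x \<notin> cst ` m"
            then obtain w where w: "w \<in> K" "w \<otimes>\<^bsub>P\<^esub> x = \<one>\<^bsub>P\<^esub>" using KP.unit x by blast
            then have "\<one>\<^bsub>P\<^esub> \<in> Ps i" using submodD(4)[OF prime_inD(1)[OF pi], of w x] x B(2) by auto
            then show False using prime_inD(3)[OF pi] by blast
          qed
        qed
        show "Ps i \<subseteq> Ps (Suc i) \<and> ys ! i \<in> Ps (Suc i) - Ps i" if "i < length ys" for i
        proof -
          have i: "i < Suc d" using that ly by simp
          then have "ys ! i = y i" unfolding ys_def by (simp del: upt_Suc)
          then show ?thesis using y[OF i] Ps(2)[OF i] by auto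
        qed
      qed (use B(2) mP u g0 i in auto)
    qed
    have ch: "schain P K ?S (N * N ^ length ys) {b \<oplus>\<^bsub>P\<^esub> box_eval P N ys u | b u. b \<in> ?S \<and> (\<forall>i. u i \<in> K)}"
    proof (rule KP.box_chain[OF submod_cst_m _ _ bounded_pols_submod[OF Vs] yc _ N])
      show "cst ` m \<subseteq> K" using m_carrier by blast
      show "\<one>\<^bsub>P\<^esub> \<notin> cst ` m"
      proof
        assume "\<one>\<^bsub>P\<^esub> \<in> cst ` m"
        then obtain a where a: "a \<in> m" "cst a = \<one>\<^bsub>P\<^esub>" by auto
        then have "cf (cst a) 0 = cf \<one>\<^bsub>P\<^esub> 0" by simp
        then have "a = \<one>" using a(1) m_carrier by auto
        then show False using a one_notin_m by simp
      qed
      show "cst z \<in> cst ` m" using z by blast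
    qed (rule KC)
    have len: "lenle P K (cst ` m) ?S (D * (k ^ d * l)) (W D)" by (rule lenle_bounded_pols[OF Vs Vl])
    have sub: "{b \<oplus>\<^bsub>P\<^esub> box_eval P N ys u | b u. b \<in> ?S \<and> (\<forall>i. u i \<in> K)} \<subseteq> W D"
    proof
      fix x assume "x \<in> {b \<oplus>\<^bsub>P\<^esub> box_eval P N ys u | b u. b \<in> ?S \<and> (\<forall>i. u i \<in> K)}"
      then obtain b u where bu: "x = b \<oplus>\<^bsub>P\<^esub> box_eval P N ys u" "b \<in> ?S" "\<And>i. u i \<in> K" by blast
      have "box_eval P N ys u \<in> W D" using W_box_eval[OF d0 bu(3), of N] unfolding D ly .
      moreover have "b \<in> W D" using bu(2) unfolding bounded_pols_def by auto
      ultimately show "x \<in> W D" unfolding bu(1) using W_add by blast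
    qed
    have "N * N ^ length ys \<le> D * (k ^ d * l)" by (rule KP.schain_le_lenle[OF len ch sub])
    then show ?thesis unfolding ly .
  qed
  \<comment> \<open>For \<open>N \<ge> 1\<close> these coefficients absorb the additive constants,
    so that \<open>D\<close> and \<open>k\<close> are bounded by fixed multiples of
    \<open>N\<close>.\<close>
  let ?a = "Suc d * d0 + 1"
  let ?b = "Suc (c * (?a + 1))"
  show False
  proof (rule growth_contradiction[of d ?a ?b l])
    fix N :: nat assume N: "0 < N"
    define D where "D = Suc d * (N * d0) + 1"
    define k where "k = Suc (c * (D + N))"
    have D: "D \<le> ?a * N" unfolding D_def using N by (simp add: algebra_simps)
    have "D + N \<le> (?a + 1) * N" using D by simp
    then have "c * (D + N) \<le> c * ((?a + 1) * N)" by (rule mult_le_mono2)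
    then have k: "k \<le> ?b * N" unfolding k_def using N by (simp add: algebra_simps)
    have "N * N ^ Suc d \<le> D * (k ^ d * l)" by (rule bound[OF N D_def k_def])
    also have "\<dots> \<le> (?a * N) * ((?b * N) ^ d * l)"
      by (intro mult_le_mono D power_mono k) simp_all
    finally show "N * N ^ Suc d \<le> (?a * N) * ((?b * N) ^ d * l)" .
  qed
qed

end

section \<open>From local domains to the chain condition and invertibility outside
  \<open>m\<close>\<close>

lemma local_domain_noetherian_local:
  assumes "local_domain R m" shows "noetherian_local R m" "domain R"
proof -
  have nd: "noetherian_domain R" and mm: "maximalideal m R" and un: "\<And>n. maximalideal n R \<Longrightarrow> n = m"
    using assms unfolding local_domain_def by auto
  interpret noetherian_domain R by (rule nd)
  interpret coefficient_ring R "carrier R"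
    by (intro coefficient_ring.intro coefficient_ring_axioms.intro carrier_is_subring cring_axioms)
  have acc: "acc R (carrier R)" by (rule noetherian_acc[OF noetherian_ring_axioms is_cring])
  have mi: "ideal m R" by (rule maximalideal.axioms(1)[OF mm])
  have top: "\<one>\<^bsub>R\<^esub> \<notin> J" if "ideal J R" "J \<noteq> carrier R" for J
    using ideal.one_imp_carrier[OF that(1)] that(2) by blast
  show "domain R" by (rule domain_axioms)
  show "noetherian_local R m"
  proof (intro noetherian_local.intro noetherian_local_axioms.intro cring_axioms acc)
    show "submod R (carrier R) m" using mi submod_iff_ideal by blast
    show "\<one>\<^bsub>R\<^esub> \<notin> m" using top[OF mi] maximalideal.I_notcarr[OF mm] by blast
    fix c assume c: "c \<in> carrier R - m"
    show "\<exists>d\<in>carrier R. d \<otimes>\<^bsub>R\<^esub> c = \<one>\<^bsub>R\<^esub>"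
    proof (rule ccontr)
      assume no: "\<not> ?thesis"
      \<comment> \<open>A non-unit generates a proper ideal. The chain condition puts it into a
        maximal ideal, which can only be \<open>m\<close>.\<close>
      define F where "F = {J. ideal J R \<and> c \<in> J \<and> J \<noteq> carrier R}"
      have "PIdl\<^bsub>R\<^esub> c \<in> F"
      proof -
        have "\<one>\<^bsub>R\<^esub> \<notin> PIdl\<^bsub>R\<^esub> c" using no unfolding cgenideal_def by force
        then show ?thesis unfolding F_def using cgenideal_ideal cgenideal_self c by auto
      qed
      then have "F \<noteq> {}" by blast
      moreover have "submod R (carrier R) J \<and> J \<subseteq> carrier R" if "J \<in> F" for J
        using that submod_iff_ideal[of J] unfolding F_def submod_def by blast
      ultimately have "\<exists>J\<in>F. \<forall>J'\<in>F. J \<subseteq> J' \<longrightarrow> J' = J" by (rule acc_maximal[OF acc])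
      then obtain J where J: "J \<in> F" "\<And>J'. J' \<in> F \<Longrightarrow> J \<subseteq> J' \<Longrightarrow> J' = J" by blast
      have "maximalideal J R"
      proof (rule maximalidealI)
        show "ideal J R" "carrier R \<noteq> J" using J(1) unfolding F_def by auto
        fix J' assume "ideal J' R" "J \<subseteq> J'" "J' \<subseteq> carrier R"
        then show "J' = J \<or> J' = carrier R" using J unfolding F_def by blast
      qed
      then have "J = m" by (rule un)
      then show False using J(1) c unfolding F_def by blast
    qed
  qed
qed

section \<open>Valuations restricted to the domain\<close>

definition ring_valuation :: "('a, 'm) ring_scheme \<Rightarrow> ('a \<Rightarrow> int) \<Rightarrow> bool" where
  "ring_valuation R v \<longleftrightarrow>
     (\<forall>x\<in>carrier R - {\<zero>\<^bsub>R\<^esub>}. \<forall>y\<in>carrier R - {\<zero>\<^bsub>R\<^esub>}. v (x \<otimes>\<^bsub>R\<^esub> y) = v x + v y \<and>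
       (x \<oplus>\<^bsub>R\<^esub> y \<noteq> \<zero>\<^bsub>R\<^esub> \<longrightarrow> min (v x) (v y) \<le> v (x \<oplus>\<^bsub>R\<^esub> y))) \<and>
     (\<forall>x\<in>carrier R - {\<zero>\<^bsub>R\<^esub>}. 0 \<le> v x)"

lemma divisorial_ring_valuation:
  assumes "quotient_field R K" "divisorial_valuation R K v"
  shows "ring_valuation R v"
    and "center R K v = {x \<in> carrier R. x = \<zero>\<^bsub>R\<^esub> \<or> 0 < v x}"
proof -
  have RK: "R = K\<lparr>carrier := carrier R\<rparr>" and sub: "carrier R \<subseteq> carrier K"
    using assms(1) subringE(1)[of "carrier R" K] unfolding quotient_field_def by auto
  have eqs: "monoid.mult R = monoid.mult K" "add R = add K" "\<zero>\<^bsub>R\<^esub> = \<zero>\<^bsub>K\<^esub>" by (subst RK, simp)+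
  have dv: "discrete_valuation K v" and pos: "carrier R \<subseteq> carrier (valuation_ring K v)"
    using assms(2) unfolding divisorial_valuation_def by auto
  show "ring_valuation R v"
    unfolding ring_valuation_def eqs
  proof (intro conjI ballI)
    fix x assume x: "x \<in> carrier R - {\<zero>\<^bsub>K\<^esub>}"
    then have xK: "x \<in> carrier K - {\<zero>\<^bsub>K\<^esub>}" using sub by blast
    show "0 \<le> v x" using x pos unfolding valuation_ring_def by auto
    fix y assume "y \<in> carrier R - {\<zero>\<^bsub>K\<^esub>}"
    then have yK: "y \<in> carrier K - {\<zero>\<^bsub>K\<^esub>}" using sub by blast
    have *: "v (x \<otimes>\<^bsub>K\<^esub> y) = v x + v y \<and>
        (x \<oplus>\<^bsub>K\<^esub> y \<noteq> \<zero>\<^bsub>K\<^esub> \<longrightarrow> min (v x) (v y) \<le> v (x \<oplus>\<^bsub>K\<^esub> y))"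
      using dv xK yK unfolding discrete_valuation_def by blast
    show "v (x \<otimes>\<^bsub>K\<^esub> y) = v x + v y" using * by (rule conjunct1)
    show "x \<oplus>\<^bsub>K\<^esub> y \<noteq> \<zero>\<^bsub>K\<^esub> \<longrightarrow> min (v x) (v y) \<le> v (x \<oplus>\<^bsub>K\<^esub> y)" using * by (rule conjunct2)
  qed
  show "center R K v = {x \<in> carrier R. x = \<zero>\<^bsub>R\<^esub> \<or> 0 < v x}"
    using sub unfolding center_def valuation_max_ideal_def eqs by auto
qed

context domain
begin

lemma valuation_mult:
  assumes "ring_valuation R v" "x \<in> carrier R" "y \<in> carrier R" "x \<noteq> \<zero>" "y \<noteq> \<zero>"
  shows "v (x \<otimes> y) = v x + v y"
  using assms unfolding ring_valuation_def by blast

lemma valuation_nonneg: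
  assumes "ring_valuation R v" "x \<in> carrier R" "x \<noteq> \<zero>"
  shows "0 \<le> v x"
  using assms unfolding ring_valuation_def by blast

text \<open>The disjunction \<open>x = \<zero> \<or> k \<le> v x\<close> stands for
  \<open>k \<le> v x\<close> with infinite value at \<open>\<zero>\<close>, where \<open>v\<close>
  itself is unspecified.\<close>

lemma valuation_add:
  assumes "ring_valuation R v" "x \<in> carrier R" "y \<in> carrier R" "x = \<zero> \<or> k \<le> v x" "y = \<zero> \<or> k \<le> v y"
  shows "x \<oplus> y = \<zero> \<or> k \<le> v (x \<oplus> y)"
proof (cases "x = \<zero> \<or> y = \<zero>")
  case True
  then show ?thesis using assms by auto
next
  case False
  then have "x \<oplus> y = \<zero> \<or> min (v x) (v y) \<le> v (x \<oplus> y)"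
    using assms(1-3) unfolding ring_valuation_def by blast
  then show ?thesis using assms(4,5) False by auto
qed

lemma valuation_ge_mult:
  assumes "ring_valuation R v" "x \<in> carrier R" "y \<in> carrier R" "x = \<zero> \<or> k \<le> v x" "y = \<zero> \<or> l \<le> v y"
  shows "x \<otimes> y = \<zero> \<or> k + l \<le> v (x \<otimes> y)"
proof (cases "x = \<zero> \<or> y = \<zero>")
  case True
  then show ?thesis using assms by auto
next
  case False
  then show ?thesis using valuation_mult[OF assms(1-3)] assms(4,5) by auto
qed

lemma valuation_one:
  assumes "ring_valuation R v" shows "v \<one> = 0"
  using valuation_mult[OF assms, of \<one> \<one>] by simp

lemma valuation_pow:
  assumes "ring_valuation R v" "x \<in> carrier R" "x \<noteq> \<zero>"
  shows "x [^] (k::nat) \<noteq> \<zero> \<and> v (x [^] k) = int k * v x"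
proof (induction k)
  case 0
  then show ?case using valuation_one[OF assms(1)] by simp
next
  case (Suc k)
  then show ?case using valuation_mult[OF assms(1), of "x [^] k" x] assms integral[of "x [^] k" x]
    by (auto simp: algebra_simps)
qed

lemma valuation_ideal_submod:
  assumes "ring_valuation R v" shows "submod R (carrier R) (valuation_ideal R v n)"
  unfolding submod_def
proof (intro conjI ballI)
  show "valuation_ideal R v n \<subseteq> carrier R" "\<zero> \<in> valuation_ideal R v n" unfolding valuation_ideal_def by auto
  show "x \<oplus> y \<in> valuation_ideal R v n" if "x \<in> valuation_ideal R v n" "y \<in> valuation_ideal R v n" for x y
    using that valuation_add[OF assms, of x y "int n"] unfolding valuation_ideal_def by auto
  show "c \<otimes> x \<in> valuation_ideal R v n" if "c \<in> carrier R" "x \<in> valuation_ideal R v n" for c x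
    using that valuation_ge_mult[OF assms, of c x 0 "int n"] valuation_nonneg[OF assms that(1)]
    unfolding valuation_ideal_def by auto
qed

lemma valuation_center_prime:
  assumes "ring_valuation R v" shows "primeideal {x \<in> carrier R. x = \<zero> \<or> 0 < v x} R"
proof (rule primeidealI)
  have "{x \<in> carrier R. x = \<zero> \<or> 0 < v x} = valuation_ideal R v 1" unfolding valuation_ideal_def by auto
  then show "ideal {x \<in> carrier R. x = \<zero> \<or> 0 < v x} R"
    using valuation_ideal_submod[OF assms, of 1] submod_iff_ideal by simp
  show "carrier R \<noteq> {x \<in> carrier R. x = \<zero> \<or> 0 < v x}"
    using valuation_one[OF assms] one_closed one_not_zero by force
  fix a b assume ab: "a \<in> carrier R" "b \<in> carrier R" "a \<otimes> b \<in> {x \<in> carrier R. x = \<zero> \<or> 0 < v x}"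
  show "a \<in> {x \<in> carrier R. x = \<zero> \<or> 0 < v x} \<or> b \<in> {x \<in> carrier R. x = \<zero> \<or> 0 < v x}"
  proof (cases "a = \<zero> \<or> b = \<zero>")
    case False
    then have "a \<otimes> b \<noteq> \<zero>" using ab integral by blast
    then have "0 < v a + v b" using valuation_mult[OF assms ab(1,2)] False ab(3) by auto
    then show ?thesis using ab(1,2) by auto
  qed (use ab in auto)
qed (rule cring_axioms)

end

text \<open>A supremum that is at least \<open>Suc e\<close> exceeds \<open>e\<close>, so some chain
  is longer than \<open>e\<close>, and its initial part has the exact length. The argument covers
  infinite dimension as well.\<close>

lemma enat_le_krull_dim:
  assumes "enat (Suc e) \<le> krull_dim S" shows "\<exists>P. prime_chain S P (Suc e)"
proof -
  have "enat e < enat (Suc e)" by simp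
  then have "enat e < (SUP n \<in> {n. \<exists>P. prime_chain S P n}. enat n)" using assms unfolding krull_dim_def by (rule less_le_trans)
  then obtain n P where "prime_chain S P n" "e < n" unfolding less_SUP_iff by auto
  then have "prime_chain S P (Suc e)" unfolding prime_chain_def by auto
  then show ?thesis by blast
qed

lemma prime_chain_le_krull_dim: "prime_chain S P n \<Longrightarrow> enat n \<le> krull_dim S"
  unfolding krull_dim_def by (intro SUP_upper) blast

lemma (in coefficient_ring) adjoins_mem:
  assumes "submod R C J" "set xs \<subseteq> carrier R" shows "set xs \<subseteq> adjoins R C J xs"
  using assms
proof (induction xs arbitrary: J)
  case (Cons x xs)
  have x: "x \<in> carrier R" "set xs \<subseteq> carrier R" using Cons.prems(2) by auto
  note s = adjoin_submod[OF Cons.prems(1) x(1)]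
  have "x \<in> adjoins R C (adjoin R C J x) xs"
    using adjoin_mem[OF Cons.prems(1) x(1)] adjoins_subset[OF s x(2)] by blast
  then show ?case using Cons.IH[OF s x(2)] by simp
qed simp

section \<open>The Rees ring, its fiber over \<open>m\<close>, and the analytic spread\<close>

context polys_over_local
begin

lemma rees_subring:
  assumes "filtration R I" shows "subring (carrier (rees_ring R I)) P"
proof (rule P.subringI)
  have I: "\<And>n. ideal (I n) R" "I 0 = carrier R" "\<And>i j. ideal_prod R (I i) (I j) \<subseteq> I (i + j)"
    using assms unfolding filtration_def by auto
  have Is: "idl (I n)" for n using I(1) R.submod_iff_ideal by blast
  note Ic = submodD[OF Is]
  have car: "carrier (rees_ring R I) = {p \<in> carrier P. \<forall>n. cf p n \<in> I n}"
    unfolding rees_ring_def P_def by simp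
  show "carrier (rees_ring R I) \<subseteq> carrier P" unfolding car by blast
  show "\<one>\<^bsub>P\<^esub> \<in> carrier (rees_ring R I)" unfolding car using I(2) Ic(2) by simp
  show "\<ominus>\<^bsub>P\<^esub> h \<in> carrier (rees_ring R I)" if "h \<in> carrier (rees_ring R I)" for h
    using that submod_uminus[OF Is] unfolding car by simp
  fix g h assume "g \<in> carrier (rees_ring R I)" "h \<in> carrier (rees_ring R I)"
  then have gh: "g \<in> carrier P" "h \<in> carrier P" "\<And>n. cf g n \<in> I n" "\<And>n. cf h n \<in> I n" unfolding car by auto
  show "g \<oplus>\<^bsub>P\<^esub> h \<in> carrier (rees_ring R I)" unfolding car using gh Ic(3) by simp
  have "(\<Oplus>i\<in>{..n}. cf g i \<otimes> cf h (n - i)) \<in> I n" for n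
  proof (rule R.finsum_mem)
    fix i assume "i \<in> {..n}"
    then show "cf g i \<otimes> cf h (n - i) \<in> I n"
      using I(3)[of i "n - i"] ideal_prod.prod[where R = R, OF gh(3)[of i] gh(4)[of "n - i"]] by auto
  qed (use Ic in auto)
  then show "g \<otimes>\<^bsub>P\<^esub> h \<in> carrier (rees_ring R I)" unfolding car using gh by simp
qed

text \<open>The primes are preimages under the projection of the Rees ring onto its fiber ring.
  Inclusions stay strict because every element of the quotient is a coset.\<close>

lemma fiber_chain:
  assumes I: "filtration R I" and e: "enat (Suc e) \<le> analytic_spread R m I"
  obtains Ps where "\<And>i. i \<le> Suc e \<Longrightarrow> prime_in P (carrier (rees_ring R I)) (Ps i)"
    "\<And>i. i < Suc e \<Longrightarrow> Ps i \<subset> Ps (Suc i)" "cst ` m \<subseteq> Ps 0"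
proof -
  let ?B = "carrier (rees_ring R I)"
  define S where "S = rees_ring R I"
  have SP: "S = P\<lparr>carrier := ?B\<rparr>" unfolding S_def rees_ring_def P_def by simp
  note B = rees_subring[OF I]
  have car: "?B = {p \<in> carrier P. \<forall>n. cf p n \<in> I n}"
    unfolding rees_ring_def P_def by simp
  interpret S: cring S unfolding SP using P.subcring_iff[of ?B] P.subcringI'[OF B] subringE(1)[OF B] by blast
  have I0: "I 0 = carrier R" "\<And>n. \<zero> \<in> I n"
    using I submodD(2)[OF iffD2[OF R.submod_iff_ideal]] unfolding filtration_def by auto
  have mB: "cst ` m \<subseteq> carrier S" unfolding S_def car using m_carrier I0 by auto
  define J where "J = Idl\<^bsub>S\<^esub> (cst ` m)"
  have Ji: "ideal J S" unfolding J_def by (rule S.genideal_ideal[OF mB])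
  have mJ: "cst ` m \<subseteq> J" unfolding J_def by (rule S.genideal_self[OF mB])
  have "analytic_spread R m I = krull_dim (S Quot J)"
    unfolding analytic_spread_def J_def S_def P_def ..
  then obtain Pc where Pc: "prime_chain (S Quot J) Pc (Suc e)" using e enat_le_krull_dim by metis
  interpret J: ideal J S by (rule Ji)
  interpret h: ring_hom_ring S "S Quot J" "(+>\<^bsub>S\<^esub>) J" by (rule J.rcos_ring_hom_ring)
  define Ps where "Ps i = {x \<in> carrier S. J +>\<^bsub>S\<^esub> x \<in> Pc i}" for i
  have Pp: "primeideal (Ps i) S" if "i \<le> Suc e" for i
    unfolding Ps_def using Pc that S.is_cring by (intro h.primeideal_vimage) (auto simp: prime_chain_def)
  show thesis
  proof (rule that[of Ps])
    fix i assume i: "i \<le> Suc e"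
    interpret Pi: primeideal "Ps i" S by (rule Pp[OF i])
    have "\<one>\<^bsub>S\<^esub> \<notin> Ps i" using Pi.one_imp_carrier Pi.I_notcarr by blast
    moreover have "Ps i \<subseteq> carrier P" using Pi.a_subset subringE(1)[OF B] unfolding S_def by blast
    moreover have "\<zero>\<^bsub>S\<^esub> \<in> Ps i" "\<And>x y. x \<in> Ps i \<Longrightarrow> y \<in> Ps i \<Longrightarrow> x \<oplus>\<^bsub>S\<^esub> y \<in> Ps i"
      "\<And>c x. c \<in> ?B \<Longrightarrow> x \<in> Ps i \<Longrightarrow> c \<otimes>\<^bsub>S\<^esub> x \<in> Ps i"
      using Pi.I_l_closed unfolding S_def[symmetric] by auto
    moreover have "\<And>a b. a \<in> ?B \<Longrightarrow> b \<in> ?B \<Longrightarrow> a \<otimes>\<^bsub>S\<^esub> b \<in> Ps i \<Longrightarrow> a \<in> Ps i \<or> b \<in> Ps i"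
      using Pi.I_prime unfolding S_def[symmetric] by blast
    moreover have "Ps i \<subseteq> ?B" using Pi.a_subset unfolding S_def .
    moreover have "\<one>\<^bsub>S\<^esub> = \<one>\<^bsub>P\<^esub>" "\<zero>\<^bsub>S\<^esub> = \<zero>\<^bsub>P\<^esub>" "monoid.mult S = monoid.mult P" "add S = add P" by (subst SP, simp)+
    ultimately show "prime_in P ?B (Ps i)" unfolding prime_in_def submod_def by simp
  next
    fix i assume i: "i < Suc e"
    then have "Pc i \<subset> Pc (Suc i)" and pp: "primeideal (Pc (Suc i)) (S Quot J)" using Pc unfolding prime_chain_def by auto
    then obtain Z where Z: "Z \<in> Pc (Suc i)" "Z \<notin> Pc i" by blast
    have "Z \<in> carrier (S Quot J)" by (rule ideal.Icarr[OF primeideal.axioms(1)[OF pp] Z(1)])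
    then obtain x where x: "x \<in> carrier S" "Z = J +>\<^bsub>S\<^esub> x"
      unfolding FactRing_def A_RCOSETS_def' by auto
    then have "x \<in> Ps (Suc i)" "x \<notin> Ps i" using Z unfolding Ps_def by auto
    moreover have "Ps i \<subseteq> Ps (Suc i)" using \<open>Pc i \<subset> Pc (Suc i)\<close> unfolding Ps_def by blast
    ultimately show "Ps i \<subset> Ps (Suc i)" by blast
  next
    have "primeideal (Pc 0) (S Quot J)" using Pc unfolding prime_chain_def by auto
    then have "\<zero>\<^bsub>S Quot J\<^esub> \<in> Pc 0"
      using additive_subgroup.zero_closed[OF ideal.axioms(1)[OF primeideal.axioms(1)]] by blast
    moreover have "\<zero>\<^bsub>S Quot J\<^esub> = J" unfolding FactRing_def by simp
    moreover have "J +>\<^bsub>S\<^esub> x = J" if "x \<in> J" for x by (rule S.a_rcos_zero[OF Ji that])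
    ultimately show "cst ` m \<subseteq> Ps 0" unfolding Ps_def using mJ mB by auto
  qed
qed

text \<open>No valuation centered at \<open>m\<close>: then some \<open>c \<in> m\<close> is a unit for all of them, so that
  \<open>cR[t] \<inter> R[I] = cR[I]\<close> and every prime of the fiber ring contains a prime of the form
  \<open>pR[t] \<inter> R[I]\<close> with \<open>c \<in> p\<close>.\<close>

lemma analytic_spread_less:
  assumes dom: "domain R" and I: "filtration R I"
    and v: "\<And>i. i \<in> T \<Longrightarrow> ring_valuation R (v i)" "finite T"
    and cen: "\<And>i. i \<in> T \<Longrightarrow> {x \<in> carrier R. x = \<zero> \<or> 0 < v i x} \<noteq> m"
    and In: "\<And>n. 1 \<le> n \<Longrightarrow> I n = carrier R \<inter> (\<Inter>i\<in>T. valuation_ideal R (v i) (a i * n))"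
    and I1: "I 1 \<noteq> carrier R"
  shows "analytic_spread R m I \<noteq> krull_dim R"
proof
  assume eq: "analytic_spread R m I = krull_dim R"
  interpret D: domain R by (rule dom)
  let ?B = "carrier (rees_ring R I)"
  let ?ctr = "\<lambda>i. {x \<in> carrier R. x = \<zero> \<or> 0 < v i x}"
  have B: "subring ?B P" by (rule rees_subring[OF I])
  note Bc = subringE[OF B]
  have car: "?B = {p \<in> carrier P. \<forall>n. cf p n \<in> I n}"
    unfolding rees_ring_def P_def by simp
  have I0: "I 0 = carrier R" "\<And>n. I (Suc n) \<subseteq> I n" using I unfolding filtration_def by auto
  have Is: "idl (I n)" for n using I R.submod_iff_ideal unfolding filtration_def by blast
  have Idec: "I j \<subseteq> I i" if "i \<le> j" for i j by (rule lift_Suc_antimono_le[of I, OF I0(2) that])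
  have Im: "I n \<subseteq> m" if "1 \<le> n" for n using Idec[OF that] proper_le_m[OF Is I1] by blast
  have KB: "K \<subseteq> ?B" unfolding car using I0(1) submodD(2)[OF Is] by auto
  have monB: "mon x i \<in> ?B" if "x \<in> I i" for x i
    unfolding car using that submodD(1,2)[OF Is] by auto
  have "\<exists>c\<in>m. \<forall>P\<in>?ctr ` T. c \<notin> P"
  proof (rule prime_avoidance)
    show "finite (?ctr ` T)" using v(2) by blast
    show "\<forall>P\<in>?ctr ` T. primeideal P R \<and> \<not> m \<subseteq> P"
    proof
      fix Q assume "Q \<in> ?ctr ` T"
      then obtain i where i: "i \<in> T" "Q = ?ctr i" by blast
      have Q: "primeideal Q R" unfolding i(2) by (rule D.valuation_center_prime[OF v(1)[OF i(1)]])
      moreover have "Q \<noteq> m" unfolding i(2) by (rule cen[OF i(1)])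
      ultimately show "primeideal Q R \<and> \<not> m \<subseteq> Q" using primeideal_le_m[OF Q] by blast
    qed
  qed (rule m)
  then obtain c where cm: "c \<in> m" and cT: "\<forall>P\<in>?ctr ` T. c \<notin> P" ..
  have c: "c \<in> m" "\<And>i. i \<in> T \<Longrightarrow> c \<notin> ?ctr i" using cm bspec[OF cT imageI] by blast+
  have cR: "c \<in> carrier R" using c m_carrier by blast
  \<comment> \<open>Every center contains \<open>\<zero>\<close>, so with \<open>T\<close> nonempty
    \<open>c\<close> cannot be zero. This is what later makes \<open>dim R/q\<close> smaller than
    \<open>dim R\<close>.\<close>
  have "T \<noteq> {}" using In[of 1] I1 by auto
  then have c0: "c \<noteq> \<zero>" using c(2) cR by auto
  have vc: "v i c = 0" if "i \<in> T" for i
    using c(2)[OF that] cR c0 D.valuation_nonneg[OF v(1)[OF that] cR c0] by auto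
  have cI: "x \<in> I n" if x: "x \<in> carrier R" and cx: "c \<otimes> x \<in> I n" for x n
  proof (cases "n = 0")
    case True
    then show ?thesis using I0(1) x by simp
  next
    case False
    then have n: "1 \<le> n" by simp
    have "x = \<zero> \<or> int (a i * n) \<le> v i x" if i: "i \<in> T" for i
    proof (cases "x = \<zero>")
      case False
      have "c \<otimes> x \<noteq> \<zero>" using D.integral[OF _ cR x] c0 False by blast
      then have "int (a i * n) \<le> v i (c \<otimes> x)" using cx i unfolding In[OF n] valuation_ideal_def by auto
      then show ?thesis using D.valuation_mult[OF v(1)[OF i] cR x c0 False] vc[OF i] by simp
    qed simp
    then show ?thesis unfolding In[OF n] valuation_ideal_def using x by auto
  qed
  have main: False
    if e: "enat (Suc d) \<le> analytic_spread R m I"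
      and sop: "\<And>q. primeideal q R \<Longrightarrow> c \<in> q \<Longrightarrow>
        \<exists>xs l. length xs = d \<and> set xs \<subseteq> m \<and> colen (adjs q xs) l" for d
  proof -
    obtain Ps where Ps: "\<And>i. i \<le> Suc d \<Longrightarrow> prime_in P ?B (Ps i)" "\<And>i. i < Suc d \<Longrightarrow> Ps i \<subset> Ps (Suc i)"
      and mP: "cst ` m \<subseteq> Ps 0"
      using fiber_chain[OF I e] by blast
    have P0: "prime_in P ?B (Ps 0)" using Ps(1)[of 0] by simp
    note P0c = submodD[OF prime_inD(1)[OF P0]]
    \<comment> \<open>The ideals \<open>J\<close> containing \<open>c\<close> with
      \<open>J R[t] \<inter> R[I] \<subseteq> Ps 0\<close>. A maximal one is prime: if
      \<open>x y \<in> q\<close>, polynomials outside \<open>Ps 0\<close> over \<open>q + Rx\<close>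
      and \<open>q + Ry\<close> would have a product over \<open>q\<close>, hence in the prime
      \<open>Ps 0\<close>.\<close>
    define F where "F = {J. idl J \<and> c \<in> J \<and> (\<forall>f\<in>?B. (\<forall>i. cf f i \<in> J) \<longrightarrow> f \<in> Ps 0)}"
    have "PIdl c \<in> F"
    proof -
      have "idl (PIdl c)" using R.cgenideal_ideal[OF cR] R.submod_iff_ideal by blast
      moreover have "c \<in> PIdl c" by (rule R.cgenideal_self[OF cR])
      moreover have "f \<in> Ps 0" if f: "f \<in> ?B" and fc: "\<And>i. cf f i \<in> PIdl c" for f
      proof -
        have fP: "f \<in> carrier P" "\<And>i. cf f i \<in> I i" using f unfolding car by auto
        have "(\<Oplus>\<^bsub>P\<^esub> i \<in> {..deg R f}. mon (cf f i) i) \<in> Ps 0"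
        proof (rule P.finsum_mem)
          fix i
          obtain x where x: "x \<in> carrier R" "cf f i = x \<otimes> c" using fc[of i] unfolding cgenideal_def by blast
          then have xc: "cf f i = c \<otimes> x" using cR by (simp add: R.m_comm)
          then have "x \<in> I i" using cI[OF x(1)] fP(2)[of i] by simp
          then have "mon x i \<otimes>\<^bsub>P\<^esub> cst c \<in> Ps 0" using P0c(4)[OF monB] mP c(1) by blast
          then show "mon (cf f i) i \<in> Ps 0" using monom_times[OF x(1) cR, of i 0] x(2) by simp
        qed (use P0c in auto)
        then show ?thesis using up_repr[OF fP(1)] by simp
      qed
      ultimately show ?thesis unfolding F_def by blast
    qed
    then have "F \<noteq> {}" by blast
    moreover have "idl J \<and> J \<subseteq> carrier R" if "J \<in> F" for J
      using that unfolding F_def submod_def by blast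
    ultimately have "\<exists>q\<in>F. \<forall>J\<in>F. q \<subseteq> J \<longrightarrow> J = q" by (rule acc_maximal[OF acc])
    then obtain q where qF: "q \<in> F" and max: "\<And>J. J \<in> F \<Longrightarrow> q \<subseteq> J \<Longrightarrow> J = q" by blast
    have qs: "idl q" and cq: "c \<in> q" and qP: "\<And>f. f \<in> ?B \<Longrightarrow> (\<And>i. cf f i \<in> q) \<Longrightarrow> f \<in> Ps 0"
      using qF unfolding F_def by auto
    note qc = submodD[OF qs]
    have q: "primeideal q R"
    proof (rule prime_of_maximal[OF qs])
      show "q \<noteq> carrier R"
      proof
        assume "q = carrier R"
        then have "\<one>\<^bsub>P\<^esub> \<in> Ps 0" using qP[OF Bc(3)] by simp
        then show False using prime_inD(3)[OF P0] by blast
      qed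
      fix x y assume xy: "x \<in> carrier R" "y \<in> carrier R" "x \<otimes> y \<in> q" "x \<notin> q" "y \<notin> q"
      have big: "\<exists>f\<in>?B. (\<forall>i. cf f i \<in> adj q w) \<and> f \<notin> Ps 0" if w: "w \<in> carrier R" "w \<notin> q" for w
      proof (rule ccontr)
        assume "\<not> ?thesis"
        moreover have "c \<in> adj q w" using adjoin_subset[OF qs w(1)] cq by blast
        ultimately have "adj q w \<in> F" unfolding F_def using adjoin_submod[OF qs w(1)] by blast
        then have "adj q w = q" by (rule max) (rule adjoin_subset[OF qs w(1)])
        then show False using adj_psubset[OF qs w] by simp
      qed
      obtain f where f: "f \<in> ?B" "\<And>i. cf f i \<in> adj q x" "f \<notin> Ps 0" using big[OF xy(1,4)] by blast
      obtain g where g: "g \<in> ?B" "\<And>i. cf g i \<in> adj q y" "g \<notin> Ps 0" using big[OF xy(2,5)] by blast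
      have fgc: "f \<in> carrier P" "g \<in> carrier P" using f g Bc(1) by auto
      have prod: "r \<otimes> s \<in> q" if r: "r \<in> adj q x" and s: "s \<in> adj q y" for r s
      proof -
        obtain r1 r2 where r: "r1 \<in> q" "r2 \<in> carrier R" "r = r1 \<oplus> r2 \<otimes> x" using r unfolding adjoin_def by blast
        obtain s1 s2 where s: "s1 \<in> q" "s2 \<in> carrier R" "s = s1 \<oplus> s2 \<otimes> y" using s unfolding adjoin_def by blast
        have cc: "r1 \<in> carrier R" "s1 \<in> carrier R" using qc(1) r s by auto
        have "r \<otimes> s = (s \<otimes> r1) \<oplus> ((r2 \<otimes> x) \<otimes> s1 \<oplus> (r2 \<otimes> s2) \<otimes> (x \<otimes> y))"
          unfolding r(3) s(3) using cc r(2) s(2) xy(1,2)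
          by (simp add: R.l_distr R.r_distr R.m_ac R.a_ac)
        moreover have "s \<in> carrier R" unfolding s(3) using cc s(2) xy by simp
        ultimately show ?thesis using qc(3,4) r s xy(1-3) by simp
      qed
      have "(\<Oplus>j\<in>{..i}. cf f j \<otimes> cf g (i - j)) \<in> q" for i
        by (rule R.finsum_mem) (use prod f(2) g(2) qc in auto)
      then have "cf (f \<otimes>\<^bsub>P\<^esub> g) i \<in> q" for i using fgc by simp
      then have "f \<otimes>\<^bsub>P\<^esub> g \<in> Ps 0" by (intro qP[OF Bc(6)[OF f(1) g(1)]])
      then show False using prime_inD(4)[OF P0 f(1) g(1)] f(3) g(3) by blast
    qed
    \<comment> \<open>Otherwise \<open>Ps 0\<close> contains \<open>m\<close> and everything of
      positive degree. An element of \<open>Ps 1\<close> then differs from one of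
      \<open>Ps 0\<close> by a constant in \<open>Ps 1\<close>, which is no unit and so lies in
      \<open>m\<close>; this gives \<open>Ps 1 \<subseteq> Ps 0\<close>.\<close>
    have "\<exists>n z. 1 \<le> n \<and> z \<in> I n \<and> mon z n \<notin> Ps 0"
    proof (rule ccontr)
      assume "\<not> ?thesis"
      then have all: "\<And>n z. 1 \<le> n \<Longrightarrow> z \<in> I n \<Longrightarrow> mon z n \<in> Ps 0" by blast
      have P1: "prime_in P ?B (Ps 1)" "Ps 0 \<subset> Ps 1" using Ps(1)[of 1] Ps(2)[of 0] by auto
      note P1c = submodD[OF prime_inD(1)[OF P1(1)]]
      interpret B: coefficient_ring P ?B
        by (intro coefficient_ring.intro coefficient_ring_axioms.intro B UP_cring)
      have "f \<in> Ps 0" if f: "f \<in> Ps 1" for f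
      proof -
        have fB: "f \<in> ?B" using f prime_inD(2)[OF P1(1)] by blast
        have fP: "f \<in> carrier P" "\<And>i. cf f i \<in> I i" using fB unfolding car by auto
        have pos: "mon (cf f i) i \<in> Ps 0" if "1 \<le> i" for i using all[OF that fP(2)] .
        let ?g = "\<Oplus>\<^bsub>P\<^esub> i \<in> {1..deg R f}. mon (cf f i) i"
        have g: "?g \<in> Ps 0" by (rule P.finsum_mem) (use pos P0c in auto)
        have "{..deg R f} = insert 0 {1..deg R f}" by auto
        then have "f = (\<Oplus>\<^bsub>P\<^esub> i \<in> insert 0 {1..deg R f}. mon (cf f i) i)" using up_repr[OF fP(1)] by simp
        also have "\<dots> = cst (cf f 0) \<oplus>\<^bsub>P\<^esub> ?g" using fP(1) by (intro P.finsum_insert) auto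
        finally have fg: "f = cst (cf f 0) \<oplus>\<^bsub>P\<^esub> ?g" .
        have f0: "cf f 0 \<in> carrier R" using fP(1) by simp
        have g1: "?g \<in> Ps 1" using g P1(2) by blast
        have gc: "?g \<in> carrier P" using P1c(1)[OF g1] .
        have "?g \<oplus>\<^bsub>P\<^esub> cst (cf f 0) \<in> Ps 1" using f fg gc f0 by (simp add: P.a_comm)
        then have c1: "cst (cf f 0) \<in> Ps 1" using B.submod_add_cancel[OF prime_inD(1)[OF P1(1)] g1] f0 by simp
        have "cf f 0 \<in> m"
        proof (rule ccontr)
          assume "cf f 0 \<notin> m"
          then obtain w where w: "w \<in> carrier R" "w \<otimes> cf f 0 = \<one>" using m_unit f0 by blast
          have "cst w \<otimes>\<^bsub>P\<^esub> cst (cf f 0) \<in> Ps 1" using P1c(4)[OF _ c1] KB w(1) by blast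
          then have "\<one>\<^bsub>P\<^esub> \<in> Ps 1" using monom_times[OF w(1) f0, of 0 0] w(2) cst_one by simp
          then show False using prime_inD(3)[OF P1(1)] by blast
        qed
        then have "cst (cf f 0) \<in> Ps 0" using mP by blast
        then have "cst (cf f 0) \<oplus>\<^bsub>P\<^esub> ?g \<in> Ps 0" using P0c(3) g by blast
        then show ?thesis using fg by simp
      qed
      then show False using P1(2) by blast
    qed
    then obtain n1 z where z: "1 \<le> n1" "z \<in> I n1" "mon z n1 \<notin> Ps 0" by blast
    have "z \<notin> q"
    proof
      assume zq: "z \<in> q"
      have "cf (mon z n1) i \<in> q" for i using zq qc(1,2) by simp
      then have "mon z n1 \<in> Ps 0" by (rule qP[OF monB[OF z(2)]])
      then show False using z(3) by blast
    qed
    obtain xs l where xs: "length xs = d" "set xs \<subseteq> m" "colen (adjs q xs) l"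
      using sop[OF q cq] by blast
    show False
    proof (rule no_long_prime_chain[OF B KB Ps mP q qP _ \<open>z \<notin> q\<close> _ _ xs(2,1,3)])
      show "z \<in> m" using Im[OF z(1)] z(2) by blast
      show "0 < n1" using z(1) by simp
      show "mon z r \<in> ?B" if "r \<le> n1" for r using monB Idec[OF that] z(2) by blast
    qed
  qed
  show False
  proof (cases "krull_dim R")
    \<comment> \<open>Infinite dimension falls to the same bound, with generators of
      \<open>m\<close> in place of parameters: modulo every prime \<open>q\<close> they leave
      colength \<open>1\<close>.\<close>
    case infinity
    have zs: "idl {\<zero>}" using R.zeroideal R.submod_iff_ideal by blast
    then obtain xs where xs: "set xs \<subseteq> m" "adjs {\<zero>} xs = m"
      using m_finitely_generated[OF zs] submodD(2)[OF m] by blast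
    have xc: "set xs \<subseteq> carrier R" using xs m_carrier by blast
    show False
    proof (rule main[of "length xs"])
      show "enat (Suc (length xs)) \<le> analytic_spread R m I" unfolding eq infinity by simp
      fix q assume q: "primeideal q R"
      note qs = primeideal_submod[OF q]
      have qx: "idl (adjs q xs)" by (rule adjoins_submod[OF qs xc])
      have "m \<subseteq> adjs q xs" unfolding xs(2)[symmetric]
      proof (rule adjoins_least[OF qx])
        show "{\<zero>} \<subseteq> adjs q xs" using submodD(2)[OF qx] by blast
        show "set xs \<subseteq> adjs q xs" by (rule adjoins_mem[OF qs xc])
      qed
      moreover have "adjs q xs \<subseteq> m" by (rule adjoins_least[OF m primeideal_le_m[OF q] xs(1)])
      ultimately have "colen (adjs q xs) 1" using colen_m by simp
      then show "\<exists>ys l. length ys = length xs \<and> set ys \<subseteq> m \<and> colen (adjs q ys) l" using xs(1) by blast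
    qed
  next
    case (enat n)
    have zp: "primeideal {\<zero>} R" by (rule D.zeroprimeideal)
    \<comment> \<open>A chain of primes containing \<open>c \<noteq> \<zero>\<close> is prolonged
      downward by the zero ideal.\<close>
    have le: "Suc k \<le> n" if Q: "prime_chain R Q k" "c \<in> Q 0" for Q k
    proof -
      have "primeideal (Q 0) R" using Q(1) unfolding prime_chain_def by blast
      then have "{\<zero>} \<subset> Q 0" using submodD(2)[OF primeideal_submod] Q(2) c0 by blast
      then have "prime_chain R (case_nat {\<zero>} Q) (Suc k)" by (rule prime_chain_extend[OF Q(1) zp])
      then have "enat (Suc k) \<le> enat n" using prime_chain_le_krull_dim enat by metis
      then show ?thesis by simp
    qed
    have "prime_chain R (\<lambda>_. m) 0" unfolding prime_chain_def using m_prime by simp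
    then have "1 \<le> n" using le[of "\<lambda>_. m" 0] c(1) by simp
    then obtain d where d: "n = Suc d" by (cases n) auto
    show False
    proof (rule main[of d])
      show "enat (Suc d) \<le> analytic_spread R m I" unfolding eq enat d by simp
      fix q assume q: "primeideal q R" "c \<in> q"
      show "\<exists>xs l. length xs = d \<and> set xs \<subseteq> m \<and> colen (adjs q xs) l"
      proof (rule system_of_parameters[OF primeideal_submod[OF q(1)]])
        fix k Q assume "prime_chain R Q k" "q \<subseteq> Q 0"
        then show "k \<le> d" using le[of Q k] q(2) unfolding d by auto
      qed
    qed
  qed
qed

end

section \<open>Integral closure and associated primes\<close>

lemma (in cring) ideals_set_pow:
  assumes "ideal J R"
  shows "J [^]\<^bsub>ideals_set R\<^esub> (0::nat) = carrier R"
    "J [^]\<^bsub>ideals_set R\<^esub> Suc k = ideal_prod R (J [^]\<^bsub>ideals_set R\<^esub> k) J"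
    "J [^]\<^bsub>ideals_set R\<^esub> (1::nat) = J"
proof -
  interpret M: comm_monoid "ideals_set R" by (rule ideals_set_is_comm_monoid)
  show "J [^]\<^bsub>ideals_set R\<^esub> (0::nat) = carrier R" using M.nat_pow_0 by (simp add: ideals_set_def)
  show "J [^]\<^bsub>ideals_set R\<^esub> Suc k = ideal_prod R (J [^]\<^bsub>ideals_set R\<^esub> k) J"
    using M.nat_pow_Suc[of J k] by (simp add: ideals_set_def)
  show "J [^]\<^bsub>ideals_set R\<^esub> (1::nat) = J" using assms by (intro M.nat_pow_eone) (simp add: ideals_set_def)
qed

context domain
begin

interpretation whole: coefficient_ring R "carrier R"
  by (intro coefficient_ring.intro coefficient_ring_axioms.intro carrier_is_subring cring_axioms)

lemma ideal_pow_valuation: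
  assumes v: "ring_valuation R v" and J: "ideal J R" "J \<subseteq> valuation_ideal R v n"
  shows "J [^]\<^bsub>ideals_set R\<^esub> k \<subseteq> valuation_ideal R v (k * n)"
proof (induction k)
  case 0
  then show ?case using ideals_set_pow(1)[OF J(1)] valuation_nonneg[OF v] unfolding valuation_ideal_def by auto
next
  case (Suc k)
  note V = submodD[OF valuation_ideal_submod[OF v, of "Suc k * n"]]
  have "x \<in> valuation_ideal R v (Suc k * n)" if "x \<in> ideal_prod R (J [^]\<^bsub>ideals_set R\<^esub> k) J" for x
    using that
  proof (induction rule: ideal_prod.induct)
    case (prod i j)
    then have "i \<in> valuation_ideal R v (k * n)" "j \<in> valuation_ideal R v n" using Suc J(2) by auto
    then show ?case using valuation_ge_mult[OF v, of i j "int (k * n)" "int n"]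
      unfolding valuation_ideal_def by (auto simp: algebra_simps)
  next
    case (sum x y)
    then show ?case using V(3) by blast
  qed
  then show ?case unfolding ideals_set_pow(2)[OF J(1)] by blast
qed

text \<open>A valuation smaller than \<open>n\<close> at \<open>x\<close> would be attained only by the leading term of an
  equation of integral dependence.\<close>

lemma integral_closure_valuation:
  assumes v: "ring_valuation R v" and J: "ideal J R" "J \<subseteq> valuation_ideal R v n"
    and x: "x \<in> integral_closure R J"
  shows "x \<in> valuation_ideal R v n"
proof (rule ccontr)
  assume no: "x \<notin> valuation_ideal R v n"
  obtain k c where xR: "x \<in> carrier R" and k: "0 < (k::nat)"
    and c: "\<And>i. i \<in> {1..k} \<Longrightarrow> c i \<in> J [^]\<^bsub>ideals_set R\<^esub> i"
    and e: "x [^] k \<oplus> (\<Oplus>i\<in>{1..k}. c i \<otimes> x [^] (k - i)) = \<zero>"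
    using x unfolding integral_closure_def by blast
  have x0: "x \<noteq> \<zero>" and vx: "v x < int n" using no xR unfolding valuation_ideal_def by auto
  \<comment> \<open>One more than the value of \<open>x^k\<close>. The \<open>i\<close>-th term has
    value at least \<open>i n + (k - i) v(x)\<close>, which exceeds \<open>k v(x)\<close> by
    \<open>i (n - v(x)) \<ge> 1\<close>.\<close>
  define b where "b = int k * v x + 1"
  let ?S = "{y \<in> carrier R. y = \<zero> \<or> b \<le> v y}"
  let ?s = "\<Oplus>i\<in>{1..k}. c i \<otimes> x [^] (k - i)"
  have s: "?s \<in> ?S"
  proof (rule finsum_mem)
    fix i assume i: "i \<in> {1..k}"
    then have ci: "c i \<in> valuation_ideal R v (i * n)" using c ideal_pow_valuation[OF v J] by blast
    then have ciR: "c i \<in> carrier R" "c i = \<zero> \<or> int (i * n) \<le> v (c i)" unfolding valuation_ideal_def by auto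
    have xp: "x [^] (k - i) = \<zero> \<or> int (k - i) * v x \<le> v (x [^] (k - i))"
      using valuation_pow[OF v xR x0, of "k - i"] by simp
    have "b \<le> int (i * n) + int (k - i) * v x"
    proof -
      have "1 \<le> int i * (int n - v x)" using i vx mult_mono[of 1 "int i" 1 "int n - v x"] by simp
      moreover have "int (k - i) = int k - int i" using i by simp
      ultimately show ?thesis unfolding b_def by (simp add: algebra_simps)
    qed
    then show "c i \<otimes> x [^] (k - i) \<in> ?S"
      using valuation_ge_mult[OF v ciR(1) _ ciR(2) xp] ciR(1) xR by auto
  next
    show "y \<oplus> w \<in> ?S" if "y \<in> ?S" "w \<in> ?S" for y w using that valuation_add[OF v, of y w b] by auto
  qed auto
  have sR: "?s \<in> carrier R" using s by blast
  have "x [^] k = \<ominus> \<one> \<otimes> ?s" using e xR sR by (simp add: l_minus minus_equality)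
  moreover have "\<ominus> \<one> = \<zero> \<or> 0 \<le> v (\<ominus> \<one>)" using valuation_nonneg[OF v, of "\<ominus> \<one>"] by blast
  then have "\<ominus> \<one> \<otimes> ?s = \<zero> \<or> 0 + b \<le> v (\<ominus> \<one> \<otimes> ?s)"
    using s by (intro valuation_ge_mult[OF v]) auto
  ultimately have "x [^] k = \<zero> \<or> b \<le> v (x [^] k)" by simp
  then show False using valuation_pow[OF v xR x0, of k] unfolding b_def by simp
qed

lemma subset_integral_closure:
  assumes "ideal J R" shows "J \<subseteq> integral_closure R J"
proof
  interpret J: ideal J R by fact
  fix x assume x: "x \<in> J"
  then have xR: "x \<in> carrier R" by (rule J.Icarr)
  have c: "\<forall>i\<in>{1..1}. \<ominus> x \<in> J [^]\<^bsub>ideals_set R\<^esub> (i::nat)"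
    using ideals_set_pow(3)[OF assms] J.a_inv_closed[OF x] by simp
  have "x [^] (1::nat) \<oplus> (\<Oplus>i\<in>{1..1::nat}. \<ominus> x \<otimes> x [^] (1 - i)) = \<zero>" using xR by (simp add: r_neg)
  then show "x \<in> integral_closure R J" unfolding integral_closure_def using c xR
    by (intro CollectI conjI exI[of _ "1::nat"] exI[of _ "\<lambda>_. \<ominus> x"]) simp_all
qed

end

text \<open>Choose \<open>z \<in> J - I\<close> with maximal annihilator modulo \<open>I\<close>. If
  \<open>x \<in> m\<close> and \<open>x z \<notin> I\<close>, the annihilator of \<open>x z\<close>
  is no larger than that of \<open>z\<close>, so by induction no power of \<open>x\<close> kills
  \<open>z\<close>, against \<open>nil\<close>. Thus \<open>m\<close> annihilates \<open>z\<close>,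
  and the annihilator is proper because \<open>z \<notin> I\<close>.\<close>

lemma (in noetherian_local) m_associated:
  assumes I: "idl I" and J: "idl J" and g: "g \<in> J - I"
    and nil: "\<And>x y. x \<in> m \<Longrightarrow> y \<in> J \<Longrightarrow> \<exists>k::nat. x [^] k \<otimes> y \<in> I"
  shows "m \<in> associated_primes R I"
proof -
  define col where "col y = {x \<in> carrier R. x \<otimes> y \<in> I}" for y
  note Ic = submodD[OF I] and Jc = submodD[OF J]
  have cols: "idl (col y)" if y: "y \<in> J" for y
    unfolding submod_def
  proof (intro conjI ballI)
    have yR: "y \<in> carrier R" using Jc(1)[OF y] .
    show "col y \<subseteq> carrier R" "\<zero> \<in> col y" unfolding col_def using Ic(2) yR by auto
    show "u \<oplus> w \<in> col y" if "u \<in> col y" "w \<in> col y" for u w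
      using that Ic(3) yR unfolding col_def by (simp add: l_distr)
    show "c \<otimes> u \<in> col y" if "c \<in> carrier R" "u \<in> col y" for c u
      using that Ic(4) yR unfolding col_def by (simp add: m_assoc)
  qed
  have "\<exists>H\<in>col ` (J - I). \<forall>H'\<in>col ` (J - I). H \<subseteq> H' \<longrightarrow> H' = H"
  proof (rule acc_maximal[OF acc])
    show "col ` (J - I) \<noteq> {}" using g by blast
    fix H assume "H \<in> col ` (J - I)"
    then obtain y where "y \<in> J" "H = col y" by blast
    then show "idl H \<and> H \<subseteq> carrier R" using cols unfolding col_def by auto
  qed
  then obtain H where H: "H \<in> col ` (J - I)" and Hmax: "\<forall>H'\<in>col ` (J - I). H \<subseteq> H' \<longrightarrow> H' = H" ..
  from H obtain z where Hz: "H = col z" and zJ: "z \<in> J - I" ..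
  have z: "z \<in> J" "z \<notin> I" using zJ by simp_all
  have max: "col y = col z" if "y \<in> J - I" "col z \<subseteq> col y" for y
    using bspec[OF Hmax imageI[OF that(1)]] that(2) unfolding Hz by simp
  have zR: "z \<in> carrier R" using Jc(1)[OF z(1)] .
  have "m \<subseteq> col z"
  proof
    fix x assume x: "x \<in> m"
    have xR: "x \<in> carrier R" using x m_carrier by blast
    show "x \<in> col z"
    proof (rule ccontr)
      assume "x \<notin> col z"
      then have "x \<otimes> z \<in> J - I" using xR Jc(4)[OF xR z(1)] unfolding col_def by blast
      moreover have "col z \<subseteq> col (x \<otimes> z)"
      proof
        fix w assume "w \<in> col z"
        then have w: "w \<in> carrier R" "w \<otimes> z \<in> I" unfolding col_def by auto
        have "w \<otimes> (x \<otimes> z) = x \<otimes> (w \<otimes> z)" using w xR zR by (simp add: m_lcomm)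
        then show "w \<in> col (x \<otimes> z)" unfolding col_def using w Ic(4)[OF xR w(2)] by simp
      qed
      ultimately have eq: "col (x \<otimes> z) = col z" by (rule max)
      have "x [^] k \<otimes> z \<notin> I" for k :: nat
      proof (induction k)
        case 0
        then show ?case using z(2) zR by simp
      next
        case (Suc k)
        show ?case
        proof
          assume "x [^] Suc k \<otimes> z \<in> I"
          then have "x [^] k \<in> col (x \<otimes> z)" unfolding col_def using xR zR by (simp add: m_assoc)
          then have "x [^] k \<in> col z" unfolding eq .
          then show False using Suc unfolding col_def by simp
        qed
      qed
      then show False using nil[OF x z(1)] by blast
    qed
  qed
  moreover have "col z \<subseteq> m"
  proof (rule proper_le_m[OF cols[OF z(1)]])
    have "\<one> \<notin> col z" using z(2) zR unfolding col_def by simp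
    then show "col z \<noteq> carrier R" using one_closed by metis
  qed
  ultimately have colm: "col z = m" by blast
  have Ii: "ideal I R" using I submod_iff_ideal by blast
  interpret Ii: ideal I R by (rule Ii)
  interpret h: ring_hom_ring R "R Quot I" "(+>) I" by (rule Ii.rcos_ring_hom_ring)
  have "(I +> f) \<otimes>\<^bsub>R Quot I\<^esub> (I +> z) = \<zero>\<^bsub>R Quot I\<^esub> \<longleftrightarrow> f \<otimes> z \<in> I" if f: "f \<in> carrier R" for f
  proof -
    have "(I +> f) \<otimes>\<^bsub>R Quot I\<^esub> (I +> z) = I +> (f \<otimes> z)" using h.hom_mult[OF f zR] by simp
    moreover have "\<zero>\<^bsub>R Quot I\<^esub> = I" unfolding FactRing_def by simp
    moreover have "I +> (f \<otimes> z) = I \<longleftrightarrow> f \<otimes> z \<in> I"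
      using a_rcos_zero[OF Ii, of "f \<otimes> z"] Ii.rcos_const_imp_mem[OF m_closed[OF f zR]] by blast
    ultimately show ?thesis by simp
  qed
  then have "m = {f \<in> carrier R. (I +> f) \<otimes>\<^bsub>R Quot I\<^esub> (I +> z) = \<zero>\<^bsub>R Quot I\<^esub>}"
    unfolding colm[symmetric] col_def by blast
  moreover have "I +> z \<in> carrier (R Quot I)" using h.hom_closed[OF zR] .
  ultimately show ?thesis unfolding associated_primes_def using m_prime by blast
qed

theorem theorem1p4:
  fixes R K :: "('a, 'm) ring_scheme"
    and m :: "'a set"
    and I :: "nat \<Rightarrow> 'a set"
    and r :: nat
    and \<nu> :: "nat \<Rightarrow> 'a \<Rightarrow> int"
    and a :: "nat \<Rightarrow> nat"
  assumes "local_domain R m"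
    and "quotient_field R K"
    and "divisorial_filtration R K I"
    and "1 \<le> r"
    and "\<forall>i\<in>{1..r}. divisorial_valuation R K (\<nu> i)"
    and "\<forall>i\<in>{1..r}. 0 < a i"
    and "\<forall>n\<ge>1. I n = (\<Inter>i\<in>{1..r}. valuation_ideal R (\<nu> i) (a i * n))"
    and "analytic_spread R m I = krull_dim R"
  shows "(\<exists>i\<in>{1..r}. center R K (\<nu> i) = m) \<and>
         (\<exists>n0>0. \<forall>n\<ge>n0. I n = integral_closure R (I n) \<and> m \<in> associated_primes R (I n))"
proof -
  interpret noetherian_local R m by (rule local_domain_noetherian_local(1)[OF assms(1)])
  interpret domain R by (rule local_domain_noetherian_local(2)[OF assms(1)])
  interpret U: polys_over_local R "UP R" m by unfold_locales
  have filt: "filtration R I" using assms(3) unfolding divisorial_filtration_def by blast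
  have v: "ring_valuation R (\<nu> i)" if "i \<in> {1..r}" for i
    using divisorial_ring_valuation(1)[OF assms(2)] assms(5) that by blast
  have cen: "center R K (\<nu> i) = {x \<in> carrier R. x = \<zero>\<^bsub>R\<^esub> \<or> 0 < \<nu> i x}" if "i \<in> {1..r}" for i
    using divisorial_ring_valuation(2)[OF assms(2)] assms(5) that by blast
  define T where "T = {i \<in> {1..r}. center R K (\<nu> i) \<noteq> m}"
  have T: "T \<subseteq> {1..r}" unfolding T_def by blast
  \<comment> \<open>Intersecting with \<open>carrier R\<close> matters for empty \<open>T\<close>,
    where \<open>J n\<close> is the whole ring.\<close>
  define J where "J n = carrier R \<inter> (\<Inter>i\<in>T. valuation_ideal R (\<nu> i) (a i * n))" for n
  have In: "I n = (\<Inter>i\<in>{1..r}. valuation_ideal R (\<nu> i) (a i * n))" if "1 \<le> n" for n using assms(7) that by blast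
  have r1: "1 \<in> {1..r}" using assms(4) by simp
  have Ii: "ideal (I n) R" for n using filt unfolding filtration_def by blast
  have Is: "idl (I n)" for n using Ii submod_iff_ideal by blast
  have Js: "idl (J n)" for n
    unfolding J_def submod_def
  proof (intro conjI ballI)
    note V = submodD[OF valuation_ideal_submod[OF v[OF subsetD[OF T]]]]
    show "carrier R \<inter> (\<Inter>i\<in>T. valuation_ideal R (\<nu> i) (a i * n)) \<subseteq> carrier R"
      "\<zero>\<^bsub>R\<^esub> \<in> carrier R \<inter> (\<Inter>i\<in>T. valuation_ideal R (\<nu> i) (a i * n))" using V(2) by auto
  qed (use submodD(3,4)[OF valuation_ideal_submod[OF v[OF subsetD[OF T]]]] in auto)
  have I1: "I 1 \<noteq> carrier R"
  proof
    assume "I 1 = carrier R"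
    then have "\<one>\<^bsub>R\<^esub> \<in> valuation_ideal R (\<nu> 1) (a 1 * 1)" using In[of 1] r1 one_closed by blast
    then have "int (a 1) \<le> 0" using valuation_one[OF v[OF r1]] unfolding valuation_ideal_def by simp
    then show False using assms(6) r1 by fastforce
  qed
  have "\<exists>n\<ge>1. J n \<noteq> I n"
  proof (rule ccontr)
    assume "\<not> ?thesis"
    then have eq: "I n = J n" if "1 \<le> n" for n using that by auto
    have "analytic_spread R m I \<noteq> krull_dim R"
    proof (rule U.analytic_spread_less[OF domain_axioms filt, of T \<nu> a])
      show "finite T" using T finite_subset by blast
      show "ring_valuation R (\<nu> i)" if "i \<in> T" for i using v T that by blast
      show "{x \<in> carrier R. x = \<zero>\<^bsub>R\<^esub> \<or> 0 < \<nu> i x} \<noteq> m" if "i \<in> T" for i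
        using that cen[of i] unfolding T_def by auto
      show "I n = carrier R \<inter> (\<Inter>i\<in>T. valuation_ideal R (\<nu> i) (a i * n))" if "1 \<le> n" for n
        using eq[OF that] unfolding J_def .
    qed (rule I1)
    then show False using assms(8) by blast
  qed
  then obtain n1 where n1: "1 \<le> n1" "J n1 \<noteq> I n1" by blast
  have "I n1 \<subseteq> J n1" unfolding J_def In[OF n1(1)] using T r1 by (auto simp: valuation_ideal_def)
  then obtain f where f: "f \<in> J n1" "f \<notin> I n1" using n1(2) by blast
  have fR: "f \<in> carrier R" using f(1) unfolding J_def by blast
  obtain i0 where i0: "i0 \<in> {1..r}" "f \<notin> valuation_ideal R (\<nu> i0) (a i0 * n1)"
    using f(2) unfolding In[OF n1(1)] by blast
  then have f0: "f \<noteq> \<zero>\<^bsub>R\<^esub>" and vf: "\<nu> i0 f < int (a i0 * n1)" using fR unfolding valuation_ideal_def by auto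
  \<comment> \<open>\<open>f\<close> meets the conditions for all indices in \<open>T\<close> and
    fails the one for \<open>i0\<close>, so \<open>\<nu> i0\<close> is centered at \<open>m\<close>.
    This settles the claim about centers.\<close>
  have "i0 \<notin> T" using f(1) i0(2) unfolding J_def by blast
  then have cm: "center R K (\<nu> i0) = m" using i0(1) unfolding T_def by blast
  \<comment> \<open>For \<open>n \<ge> n0\<close> the quotient \<open>q = n div n1\<close> is at
    least \<open>a i0 * n1\<close>. The power \<open>f^(q+1)\<close> is in \<open>J n\<close>
    because \<open>(q+1) n1 > n\<close>. At \<open>i0\<close> each of its factors falls short of the
    value \<open>a i0 * n1\<close> by at least one, and these \<open>q + 1\<close> deficits outweigh
    the one surplus factor, so the power is not in \<open>I n\<close>.\<close>
  define n0 where "n0 = Suc (a i0 * n1 * n1)"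
  have ic: "I n = integral_closure R (I n)" if n: "1 \<le> n" for n
  proof
    show "I n \<subseteq> integral_closure R (I n)" by (rule subset_integral_closure[OF Ii])
    show "integral_closure R (I n) \<subseteq> I n"
    proof
      fix x assume x: "x \<in> integral_closure R (I n)"
      have "x \<in> valuation_ideal R (\<nu> i) (a i * n)" if i: "i \<in> {1..r}" for i
      proof (rule integral_closure_valuation[OF v[OF i] Ii _ x])
        show "I n \<subseteq> valuation_ideal R (\<nu> i) (a i * n)" unfolding In[OF n] using i by blast
      qed
      then show "x \<in> I n" unfolding In[OF n] by blast
    qed
  qed
  have ass: "m \<in> associated_primes R (I n)" if n: "n0 \<le> n" for n
  proof -
    have n_pos: "1 \<le> n" using n unfolding n0_def by simp
    let ?q = "n div n1"
    have qn: "n < Suc ?q * n1" using n1(1) by (metis dividend_less_div_times less_le_trans mult_Suc zero_less_one)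
    have "a i0 * n1 * n1 \<le> n" using n unfolding n0_def by simp
    then have "a i0 * n1 * n1 div n1 \<le> ?q" by (rule div_le_mono)
    then have q: "a i0 * n1 \<le> ?q" using n1(1) by simp
    let ?g = "f [^]\<^bsub>R\<^esub> Suc ?q"
    have gR: "?g \<in> carrier R" using fR by simp
    have "?g \<in> J n"
    proof -
      have "?g \<in> valuation_ideal R (\<nu> i) (a i * n)" if i: "i \<in> T" for i
      proof -
        have vi: "ring_valuation R (\<nu> i)" using v T i by blast
        have "int (a i * n1) \<le> \<nu> i f" using f(1) i f0 unfolding J_def valuation_ideal_def by auto
        then have "int (Suc ?q) * int (a i * n1) \<le> int (Suc ?q) * \<nu> i f" by (intro mult_left_mono) simp_all
        moreover have "int (a i * n) \<le> int (Suc ?q) * int (a i * n1)"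
        proof -
          have "a i * n \<le> a i * (Suc ?q * n1)" using qn by (intro mult_le_mono2) simp
          also have "\<dots> = Suc ?q * (a i * n1)" by (simp only: mult_ac)
          finally show ?thesis by (metis of_nat_le_iff of_nat_mult)
        qed
        ultimately have "int (a i * n) \<le> int (Suc ?q) * \<nu> i f" by (rule order_trans[rotated])
        then have "int (a i * n) \<le> \<nu> i ?g" using valuation_pow[OF vi fR f0, of "Suc ?q"] by metis
        then show ?thesis using gR unfolding valuation_ideal_def by blast
      qed
      then show ?thesis unfolding J_def using gR by blast
    qed
    moreover have "?g \<notin> I n"
    proof
      assume "?g \<in> I n"
      then have "int (a i0 * n) \<le> \<nu> i0 ?g"
        using i0(1) valuation_pow[OF v[OF i0(1)] fR f0, of "Suc ?q"] unfolding In[OF n_pos] valuation_ideal_def by blast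
      also have "\<dots> = int (Suc ?q) * \<nu> i0 f" using valuation_pow[OF v[OF i0(1)] fR f0, of "Suc ?q"] by blast
      also have "\<dots> \<le> int (Suc ?q) * (int (a i0 * n1) - 1)" using vf by (intro mult_left_mono) simp_all
      also have "\<dots> = int (?q * (a i0 * n1)) + int (a i0 * n1) - int ?q - 1" by (simp add: algebra_simps)
      also have "\<dots> < int (?q * (a i0 * n1))" using q by linarith
      also have "\<dots> \<le> int (a i0 * n)"
      proof -
        have "?q * (a i0 * n1) = a i0 * (?q * n1)" by (simp only: mult_ac)
        also have "\<dots> \<le> a i0 * n" by (intro mult_le_mono2) simp
        finally show ?thesis by (simp only: of_nat_le_iff)
      qed
      finally show False by simp
    qed
    ultimately have g: "?g \<in> J n - I n" by blast
    have nil: "\<exists>k::nat. x [^]\<^bsub>R\<^esub> k \<otimes>\<^bsub>R\<^esub> y \<in> I n" if x: "x \<in> m" and y: "y \<in> J n" for x y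
    proof -
      \<comment> \<open>A common exponent, at least \<open>a i * n\<close> for every
        \<open>i\<close>. For \<open>i \<in> T\<close> the element \<open>y\<close> has enough value
        already; for the others a nonzero \<open>x \<in> m\<close> has value at least
        \<open>1\<close>, so \<open>x^k\<close> supplies it.\<close>
      define k where "k = (\<Sum>i\<in>{1..r}. a i * n)"
      have xR: "x \<in> carrier R" and yR: "y \<in> carrier R" using x m_carrier y submodD(1)[OF Js] by auto
      have xk: "x [^]\<^bsub>R\<^esub> k \<in> carrier R" using xR by simp
      have "x [^]\<^bsub>R\<^esub> k \<otimes>\<^bsub>R\<^esub> y \<in> valuation_ideal R (\<nu> i) (a i * n)" if i: "i \<in> {1..r}" for i
      proof (cases "i \<in> T")
        case True
        then have "y \<in> valuation_ideal R (\<nu> i) (a i * n)" using y unfolding J_def by blast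
        then show ?thesis using submodD(4)[OF valuation_ideal_submod[OF v[OF i]] xk] by blast
      next
        case False
        then have "x \<in> {x \<in> carrier R. x = \<zero>\<^bsub>R\<^esub> \<or> 0 < \<nu> i x}" using x i cen[OF i] unfolding T_def by auto
        then have x1: "x = \<zero>\<^bsub>R\<^esub> \<or> 1 \<le> \<nu> i x" by auto
        have ki: "a i * n \<le> k" unfolding k_def using i by (intro member_le_sum) auto
        have "x [^]\<^bsub>R\<^esub> k = \<zero>\<^bsub>R\<^esub> \<or> int k \<le> \<nu> i (x [^]\<^bsub>R\<^esub> k)"
        proof (cases "x = \<zero>\<^bsub>R\<^esub>")
          case True
          then show ?thesis
          proof (cases "k = 0")
            case True
            then show ?thesis using valuation_one[OF v[OF i]] by simp
          next
            case False
            then show ?thesis using \<open>x = \<zero>\<^bsub>R\<^esub>\<close> by (simp add: nat_pow_zero)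
          qed
        next
          case False
          then have "int k * 1 \<le> int k * \<nu> i x" using x1 by (intro mult_left_mono) simp_all
          then show ?thesis using valuation_pow[OF v[OF i] xR False, of k] by simp
        qed
        moreover have "y = \<zero>\<^bsub>R\<^esub> \<or> 0 \<le> \<nu> i y" using valuation_nonneg[OF v[OF i] yR] by blast
        ultimately have "x [^]\<^bsub>R\<^esub> k \<otimes>\<^bsub>R\<^esub> y = \<zero>\<^bsub>R\<^esub> \<or> int k + 0 \<le> \<nu> i (x [^]\<^bsub>R\<^esub> k \<otimes>\<^bsub>R\<^esub> y)"
          by (rule valuation_ge_mult[OF v[OF i] xk yR])
        moreover have "int (a i * n) \<le> int k + 0" using ki by (simp only: add_0_right of_nat_le_iff)
        ultimately have "x [^]\<^bsub>R\<^esub> k \<otimes>\<^bsub>R\<^esub> y = \<zero>\<^bsub>R\<^esub> \<or> int (a i * n) \<le> \<nu> i (x [^]\<^bsub>R\<^esub> k \<otimes>\<^bsub>R\<^esub> y)"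
          by (meson order_trans)
        then show ?thesis unfolding valuation_ideal_def using m_closed[OF xk yR] by blast
      qed
      then have "x [^]\<^bsub>R\<^esub> k \<otimes>\<^bsub>R\<^esub> y \<in> I n" unfolding In[OF n_pos] by blast
      then show ?thesis by blast
    qed
    show ?thesis by (rule m_associated[OF Is Js g nil])
  qed
  have "0 < n0" "1 \<le> n0" unfolding n0_def by simp_all
  then have "\<forall>n\<ge>n0. I n = integral_closure R (I n) \<and> m \<in> associated_primes R (I n)"
    using ic ass by (meson order_trans)
  then show ?thesis using cm i0(1) \<open>0 < n0\<close> by blast
qed

end
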